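(* Let $X$ be a subordinator with drift $\delta>0$ and Lévy measure $\Pi$ with $\beta(\Pi)<1$, and let $q\ge 0$. Suppose that $\bar\Pi(x)=\bar\Pi_1(x)+\bar\Pi_2(x)$ for $x>0$, where $\Pi_1$ is purely atomic with possible (finite) accumulation point of atoms only at zero, and $\bar\Pi_2$ is infinitely differentiable on $(0,\infty)$. Then, for every integer $k\ge 1$ and every $x>0$, $$U^{(q)}\text{ is }(k+1)\text{-times differentiable at }x\quad\Longleftrightarrow\quad x\notin G_k .$$ In particular, if $x>0$ cannot be reached by atomic jumps only (that is, $x\notin\bigcup_{k\ge1}G_k$), then $U^{(q)}$ is infinitely differentiable at $x$.
   Context: A subordinator is a Lévy process $X=(X_t)_{t\ge0}$ with $X_0=0$ and almost surely non-decreasing paths; $X_t=\delta t+\sum_{s\le t}\Delta_s$ with drift $\delta$ and jumps $\Delta_s$ governed by a Poisson random measure with Lévy measure $\Pi$, a measure on $(0,\infty)$ with $\int_0^\infty(1\wedge x)\,\Pi(dx)<\infty$. The Blumenthal–Getoor index is $\beta(\Pi)=\inf\{\gamma>0:\int_0^1x^\gamma\,\Pi(dx)<\infty\}$. The tail of $\Pi$ is $\bar\Pi(x)=\Pi([x,\infty))$ for $x>0$; here $\Pi=\Pi_1+\Pi_2$ is a sum of two (Lévy) measures on $(0,\infty)$ with tails $\bar\Pi_i(x)=\Pi_i([x,\infty))$. For $q\ge0$ the $q$-potential measure is $U^{(q)}(dx)=\mathbb{E}\left[\int_0^\infty e^{-qt}\mathbf 1_{\{X_t\in dx\}}\,dt\right]$,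 and $U^{(q)}(x)=U^{(q)}([0,x])$ denotes its distribution function. $G$ denotes the set of atoms of $\Pi$, and for $k\ge1$ $$G_k=\Big\{x>0: x=\sum_{i=1}^{j}g_i,\ g_i\in G,\ 1\le j\le k\Big\}$$ (the $g_i$ need not be distinct). *)

theory Defs
  imports "HOL-Probability.Probability"
begin

section \<open>Pointwise higher differentiability\<close>

text \<open>The \<open>(Suc n)\<close>-st derivative exists at \<open>x\<close> if the \<open>n\<close>-th derivative exists in a
  neighbourhood of \<open>x\<close> and is differentiable at \<open>x\<close>. Since \<^term>\<open>deriv\<close> is total, the existence
  of the lower derivatives near \<open>x\<close> has to be demanded explicitly.\<close>

primrec times_differentiable_at :: "nat \<Rightarrow> (real \<Rightarrow> real) \<Rightarrow> real \<Rightarrow> bool" where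
  "times_differentiable_at 0 f x \<longleftrightarrow> True"
| "times_differentiable_at (Suc n) f x \<longleftrightarrow>
     (\<forall>\<^sub>F y in nhds x. times_differentiable_at n f y) \<and> (deriv ^^ n) f differentiable (at x)"

definition infinitely_differentiable_at :: "(real \<Rightarrow> real) \<Rightarrow> real \<Rightarrow> bool" where
  "infinitely_differentiable_at f x \<longleftrightarrow> (\<forall>n. times_differentiable_at n f x)"


section \<open>Measures on the positive half-line\<close>

text \<open>A measure on \<open>(0,\<infinity>)\<close> is represented by a Borel measure on the reals that does not charge
  \<open>(-\<infinity>,0]\<close>.\<close>

definition levy_measure :: "real measure \<Rightarrow> bool" where
  "levy_measure \<Lambda> \<longleftrightarrow>
     sets \<Lambda> = sets borel \<and> emeasure \<Lambda> {..0} = 0 \<and> (\<integral>\<^sup>+ x. ennreal (min 1 x) \<partial>\<Lambda>) < \<infinity>"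

text \<open>For a measure satisfying \<^const>\<open>levy_measure\<close> the tail is finite at every \<open>x > 0\<close>, so no
  information is lost by taking it real-valued there.\<close>

definition tail :: "real measure \<Rightarrow> real \<Rightarrow> real" where
  "tail \<Lambda> x = measure \<Lambda> {x..}"

definition blumenthal_getoor :: "real measure \<Rightarrow> real" where
  "blumenthal_getoor \<Lambda> =
     Inf {\<gamma>. \<gamma> > 0 \<and> (\<integral>\<^sup>+ x\<in>{0<..1}. ennreal (x powr \<gamma>) \<partial>\<Lambda>) < \<infinity>}"

definition atoms :: "real measure \<Rightarrow> real set" where
  "atoms \<Lambda> = {x. emeasure \<Lambda> {x} > 0}"

definition purely_atomic :: "real measure \<Rightarrow> bool" where
  "purely_atomic \<Lambda> \<longleftrightarrow> (AE x in \<Lambda>. x \<in> atoms \<Lambda>)"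

definition atom_sums :: "real measure \<Rightarrow> nat \<Rightarrow> real set" where
  "atom_sums \<Lambda> k =
     {x. x > 0 \<and> (\<exists>j g. 1 \<le> j \<and> j \<le> k \<and> (\<forall>i\<in>{1..j}. g i \<in> atoms \<Lambda>) \<and> x = (\<Sum>i=1..j. g i))}"


section \<open>Subordinators\<close>

definition cadlag :: "(real \<Rightarrow> real) \<Rightarrow> bool" where
  "cadlag f \<longleftrightarrow> (\<forall>t\<ge>0. (f \<longlongrightarrow> f t) (at_right t)) \<and> (\<forall>t>0. \<exists>l. (f \<longlongrightarrow> l) (at_left t))"

definition jump :: "(real \<Rightarrow> real) \<Rightarrow> real \<Rightarrow> real" where
  "jump f s = f s - Lim (at_left s) f"

text \<open>Processes are indexed by the reals; only their values at times \<open>t \<ge> 0\<close> matter.\<close>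

definition levy_process :: "'a measure \<Rightarrow> (real \<Rightarrow> 'a \<Rightarrow> real) \<Rightarrow> bool" where
  "levy_process M X \<longleftrightarrow>
     prob_space M \<and>
     (\<forall>t\<ge>0. X t \<in> borel_measurable M) \<and>
     (AE \<omega> in M. X 0 \<omega> = 0) \<and>
     (\<forall>n (t :: nat \<Rightarrow> real). 0 \<le> t 0 \<and> (\<forall>i<n. t i \<le> t (Suc i)) \<longrightarrow>
        prob_space.indep_vars M (\<lambda>_. borel) (\<lambda>i \<omega>. X (t (Suc i)) \<omega> - X (t i) \<omega>) {..<n}) \<and>
     (\<forall>s\<ge>0. \<forall>t\<ge>0. distr M borel (\<lambda>\<omega>. X (s + t) \<omega> - X s \<omega>) = distr M borel (\<lambda>\<omega>. X t \<omega> - X 0 \<omega>)) \<and>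
     (AE \<omega> in M. cadlag (\<lambda>t. X t \<omega>))"

text \<open>The Poisson weights are written out because \<^const>\<open>poisson_pmf\<close> is only specified for a
  strictly positive rate, whereas \<open>\<nu> A = 0\<close> is allowed here.\<close>

definition poisson_random_measure ::
    "'a measure \<Rightarrow> ('a \<Rightarrow> 'b measure) \<Rightarrow> 'b measure \<Rightarrow> bool" where
  "poisson_random_measure M N \<nu> \<longleftrightarrow>
     (\<forall>\<omega>\<in>space M. sets (N \<omega>) = sets \<nu>) \<and>
     (\<forall>A\<in>sets \<nu>. (\<lambda>\<omega>. emeasure (N \<omega>) A) \<in> borel_measurable M) \<and>
     (\<forall>A\<in>sets \<nu>. emeasure \<nu> A < \<infinity> \<longrightarrow>
        (\<forall>n. measure M {\<omega>\<in>space M. emeasure (N \<omega>) A = of_nat n} =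
               measure \<nu> A ^ n / fact n * exp (- measure \<nu> A))) \<and>
     (\<forall>A\<in>sets \<nu>. emeasure \<nu> A = \<infinity> \<longrightarrow> (AE \<omega> in M. emeasure (N \<omega>) A = \<infinity>)) \<and>
     (\<forall>n (A :: nat \<Rightarrow> 'b set). (\<forall>i<n. A i \<in> sets \<nu>) \<and> disjoint_family_on A {..<n} \<longrightarrow>
        prob_space.indep_vars M (\<lambda>_. borel) (\<lambda>i \<omega>. emeasure (N \<omega>) (A i)) {..<n})"

text \<open>The point process \<open>(s, \<Delta>\<^sub>s)\<close> of times and sizes of the jumps is a Poisson random measure
  \<open>N\<close> with intensity \<open>ds \<otimes> \<Lambda>(dx)\<close> on \<open>(0,\<infinity>)\<^sup>2\<close>. Paths are regular only almost surely,
  hence the identification of \<open>N\<close> with the jump counts is almost sure as well.\<close>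

definition subordinator ::
    "'a measure \<Rightarrow> (real \<Rightarrow> 'a \<Rightarrow> real) \<Rightarrow> real \<Rightarrow> real measure \<Rightarrow> bool" where
  "subordinator M X \<delta> \<Lambda> \<longleftrightarrow>
     levy_process M X \<and>
     (AE \<omega> in M. mono_on {0..} (\<lambda>t. X t \<omega>)) \<and>
     0 \<le> \<delta> \<and> levy_measure \<Lambda> \<and>
     (AE \<omega> in M. \<forall>t\<ge>0.
        ((\<lambda>s. jump (\<lambda>r. X r \<omega>) s) has_sum (X t \<omega> - \<delta> * t)) {0<..t}) \<and>
     (\<exists>N. poisson_random_measure M N (density lborel (indicator {0<..}) \<Otimes>\<^sub>M \<Lambda>) \<and>
        (AE \<omega> in M. \<forall>A\<in>sets (borel \<Otimes>\<^sub>M borel).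
           emeasure (N \<omega>) A =
           emeasure (count_space UNIV)
             {s. 0 < s \<and> jump (\<lambda>r. X r \<omega>) s \<noteq> 0 \<and> (s, jump (\<lambda>r. X r \<omega>) s) \<in> A}))"


section \<open>Potential measures\<close>

definition potential ::
    "'a measure \<Rightarrow> (real \<Rightarrow> 'a \<Rightarrow> real) \<Rightarrow> real \<Rightarrow> real set \<Rightarrow> ennreal" where
  "potential M X q A =
     (\<integral>\<^sup>+ \<omega>. (\<integral>\<^sup>+ t\<in>{0..}. ennreal (exp (- q * t)) * indicator A (X t \<omega>) \<partial>lborel) \<partial>M)"

text \<open>For \<open>\<delta> > 0\<close> the value at \<open>x \<ge> 0\<close> is at most \<open>x / \<delta>\<close>, so the conversion to a
  real number is harmless.\<close>

definition potential_cdf :: "'a measure \<Rightarrow> (real \<Rightarrow> 'a \<Rightarrow> real) \<Rightarrow> real \<Rightarrow> real \<Rightarrow> real" where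
  "potential_cdf M X q x = enn2real (potential M X q {0..x})"

end

theory Submission
  imports Defs
begin

text \<open>
  Write \<open>\<kappa> = (q + tail \<Lambda>) / \<delta>\<close> on \<open>(0,\<infinity>)\<close> and \<open>L\<phi> = \<kappa> * \<phi>\<close>. Comparing Laplace transforms shows that
  \<open>U\<close> solves the renewal equation \<open>U + L U = x / \<delta>\<close>. Iterating it \<open>n\<close> times gives
  \<open>U = (\<Sum>i<n. (-1)^i L^i(x / \<delta>)) + (-1)^n L^n U\<close>.

  Because the Blumenthal-Getoor index is below 1, \<open>L\<close> raises the Hoelder exponent of every locally bounded
  function on \<open>[0,\<infinity>)\<close> by a fixed amount, so the remainder \<open>L^n U\<close> is as smooth as desired once \<open>n\<close> is large.
  It remains to study the finitely many functions \<open>\<phi>\<^sub>i = L^i(x / \<delta>)\<close>. Away from 0 the kernel is a smooth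
  function minus steps \<open>a\<^sub>g 1(y > g)\<close> at the atoms \<open>g\<close>, and convolution with such a step is integration
  followed by translation by \<open>g\<close>. Hence at a point \<open>x\<^sub>0\<close> which is a sum of \<open>i\<close> but not of fewer atoms, \<open>\<phi>\<^sub>i\<close>
  is a \<open>C^(i+1)\<close> function plus \<open>c (x - x\<^sub>0)\<^sub>+^(i+1)\<close> with \<open>(-1)^i c > 0\<close>; the sign excludes cancellations.
  All other \<open>\<phi>\<^sub>j\<close> are of class \<open>C^(i+1)\<close> near \<open>x\<^sub>0\<close>.
\<close>

section \<open>Functions of class C^k and truncated powers\<close>

text \<open>If \<Lambda> has infinite mass, \<kappa> is unbounded at 0, and its steps may accumulate
  there. The analysis is therefore localised with a level \<epsilon> chosen after the point: below
  \<epsilon> the kernel only averages over a short window and preserves the local class of its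
  argument, and above \<epsilon> finitely many steps remain. The cut creates an artificial jump at
  \<epsilon>, harmless because the argument is still regular at x - \<epsilon>. The critical case is
  a point where \<open>\<phi> i\<close> already has its singularity c (x - x0)_+^(i+1). This term is
  only of class C^i, but its convolution with any locally integrable kernel is of class C^(i+1), so
  later powers cannot repeat the singularity at the same order. A point of
  \<open>atom_sums \<Lambda> k\<close> may be a sum of fewer than k atoms; with i the least number
  of atoms, differentiability fails already at order i + 1, hence at order k + 1. In the renewal
  equation the transforms of U and \<kappa> at c are 1 / (c (q + \<delta> c + \<psi> c)) and (q +
  \<psi> c) / (c \<delta>), and multiplying the first by one plus the second gives 1 / (\<delta>
  c^2), the transform of x / \<delta>.\<close>

primrec Ck_on :: "nat \<Rightarrow> (real \<Rightarrow> real) \<Rightarrow> real set \<Rightarrow> bool" where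
  "Ck_on 0 f S \<longleftrightarrow> continuous_on S f"
| "Ck_on (Suc k) f S \<longleftrightarrow> (\<exists>g. (\<forall>x\<in>S. (f has_real_derivative g x) (at x)) \<and> Ck_on k g S)"

lemma Ck_on_SucI:
  "(\<And>x. x \<in> S \<Longrightarrow> (f has_real_derivative g x) (at x)) \<Longrightarrow> Ck_on k g S \<Longrightarrow> Ck_on (Suc k) f S"
  by auto

lemma Ck_on_SucE:
  assumes "Ck_on (Suc k) f S"
  obtains g where "\<And>x. x \<in> S \<Longrightarrow> (f has_real_derivative g x) (at x)" "Ck_on k g S"
  using assms by auto

definition Ck_near :: "nat \<Rightarrow> (real \<Rightarrow> real) \<Rightarrow> real \<Rightarrow> bool" where
  "Ck_near k f x \<longleftrightarrow> (\<exists>r>0. Ck_on k f {x - r<..<x + r})"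

lemma Ck_on_subset: "Ck_on k f S \<Longrightarrow> T \<subseteq> S \<Longrightarrow> Ck_on k f T"
proof (induction k arbitrary: f)
  case 0 then show ?case by (auto intro: continuous_on_subset)
next
  case (Suc k)
  obtain g where "\<And>x. x \<in> S \<Longrightarrow> (f has_real_derivative g x) (at x)" "Ck_on k g S"
    using Ck_on_SucE[OF Suc.prems(1)] by blast
  with Suc show ?case by (intro Ck_on_SucI[of T f g]) auto
qed

lemma Ck_on_cong:
  assumes "Ck_on k f S" "open S" "\<And>x. x \<in> S \<Longrightarrow> f x = g x"
  shows "Ck_on k g S"
proof (cases k)
  case 0
  with assms show ?thesis by (auto cong: continuous_on_cong)
next
  case (Suc j)
  have "(g has_real_derivative d) (at x)" if "(f has_real_derivative d) (at x)" "x \<in> S" for d x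
    using has_field_derivative_transform_within_open[OF that(1) assms(2) that(2)] assms(3) by auto
  moreover obtain f' where "\<And>x. x \<in> S \<Longrightarrow> (f has_real_derivative f' x) (at x)" "Ck_on j f' S"
    using assms(1) Suc by auto
  ultimately show ?thesis unfolding Suc by (intro Ck_on_SucI[of S g f']) auto
qed

lemma Ck_on_imp_continuous_on: "Ck_on k f S \<Longrightarrow> continuous_on S f"
  by (cases k) (auto intro!: continuous_at_imp_continuous_on intro: DERIV_isCont)

lemma Ck_on_SucD: "Ck_on (Suc k) f S \<Longrightarrow> Ck_on k f S"
proof (induction k arbitrary: f)
  case 0 then show ?case using Ck_on_imp_continuous_on[of 1 f S] by simp
next
  case (Suc k)
  then obtain g where "\<forall>x\<in>S. (f has_real_derivative g x) (at x)" "Ck_on (Suc k) g S"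
    by (metis Ck_on.simps(2))
  with Suc.IH[of g] show ?case by (intro Ck_on_SucI[of S f g]) auto
qed

lemma Ck_on_le: "Ck_on k f S \<Longrightarrow> j \<le> k \<Longrightarrow> Ck_on j f S"
  by (induction k) (use Ck_on_SucD le_Suc_eq in blast)+

lemma Ck_on_add: "Ck_on k f S \<Longrightarrow> Ck_on k g S \<Longrightarrow> Ck_on k (\<lambda>x. f x + g x) S"
proof (induction k arbitrary: f g)
  case 0 then show ?case by (auto intro: continuous_intros)
next
  case (Suc k)
  then obtain f' g' where "\<forall>x\<in>S. (f has_real_derivative f' x) (at x)" "Ck_on k f' S"
    "\<forall>x\<in>S. (g has_real_derivative g' x) (at x)" "Ck_on k g' S" by auto
  with Suc.IH[of f' g'] show ?case
    by (auto intro!: exI[of _ "\<lambda>x. f' x + g' x"] derivative_eq_intros)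
qed

lemma Ck_on_cmult: "Ck_on k f S \<Longrightarrow> Ck_on k (\<lambda>x. c * f x) S"
proof (induction k arbitrary: f)
  case 0 then show ?case by (auto intro: continuous_intros)
next
  case (Suc k)
  then obtain f' where "\<forall>x\<in>S. (f has_real_derivative f' x) (at x)" "Ck_on k f' S" by auto
  with Suc.IH[of f'] show ?case
    by (auto intro!: exI[of _ "\<lambda>x. c * f' x"] derivative_eq_intros)
qed

lemma Ck_on_const: "Ck_on k (\<lambda>x. c) S"
proof (induction k arbitrary: c)
  case (Suc k) then show ?case by (auto intro!: exI[of _ "\<lambda>x. 0"])
qed simp

lemma Ck_on_shift: "Ck_on k f {a - t<..<b - t} \<Longrightarrow> Ck_on k (\<lambda>x. f (x - t)) {a<..<b}"
proof (induction k arbitrary: f)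
  case 0 then show ?case
    by (auto intro!: continuous_on_compose2[where f = "\<lambda>x. x - t" and g = f] continuous_intros)
next
  case (Suc k)
  then obtain f' where f': "\<forall>x\<in>{a - t<..<b - t}. (f has_real_derivative f' x) (at x)"
    "Ck_on k f' {a - t<..<b - t}" by auto
  have "((\<lambda>x. f (x - t)) has_real_derivative f' (x - t)) (at x)" if "x \<in> {a<..<b}" for x
  proof -
    have "(f has_real_derivative f' (x - t)) (at (x + - t))" using f' that by auto
    then show ?thesis by (subst (asm) DERIV_shift) simp
  qed
  with Suc.IH[OF f'(2)] show ?case by (intro Ck_on_SucI) auto
qed

lemma Ck_nearI: "Ck_on k f S \<Longrightarrow> open S \<Longrightarrow> x \<in> S \<Longrightarrow> Ck_near k f x"
  unfolding Ck_near_def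
proof -
  assume *: "Ck_on k f S" "open S" "x \<in> S"
  then obtain e where e: "e > 0" "ball x e \<subseteq> S" using open_contains_ball by blast
  moreover have "ball x e = {x - e<..<x + e}" by (auto simp: dist_real_def)
  ultimately show "\<exists>r>0. Ck_on k f {x - r<..<x + r}" using Ck_on_subset[OF *(1)] by metis
qed

lemma Ck_nearI_UNIV: "Ck_on k f UNIV \<Longrightarrow> Ck_near k f x"
  using Ck_nearI open_UNIV by blast

lemma Ck_near_add:
  assumes "Ck_near k f x" "Ck_near k g x" shows "Ck_near k (\<lambda>x. f x + g x) x"
proof -
  obtain r s where rs: "r > 0" "s > 0" "Ck_on k f {x - r<..<x + r}" "Ck_on k g {x - s<..<x + s}"
    using assms by (auto simp: Ck_near_def)
  have "Ck_on k (\<lambda>x. f x + g x) {x - min r s<..<x + min r s}"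
    by (intro Ck_on_add Ck_on_subset[OF rs(3)] Ck_on_subset[OF rs(4)]) auto
  with rs show ?thesis unfolding Ck_near_def by (intro exI[of _ "min r s"]) auto
qed

lemma Ck_near_cmult: "Ck_near k f x \<Longrightarrow> Ck_near k (\<lambda>x. c * f x) x"
  by (auto simp: Ck_near_def intro: Ck_on_cmult)

lemma Ck_near_diff: "Ck_near k f x \<Longrightarrow> Ck_near k g x \<Longrightarrow> Ck_near k (\<lambda>x. f x - g x) x"
  using Ck_near_add[of k f x "\<lambda>x. (-1) * g x"] Ck_near_cmult[of k g x "-1"] by simp

lemma Ck_near_const: "Ck_near k (\<lambda>x. c) x"
  using Ck_nearI_UNIV Ck_on_const by blast

lemma Ck_near_sum: "(\<And>i. i \<in> I \<Longrightarrow> Ck_near k (f i) x) \<Longrightarrow> Ck_near k (\<lambda>x. \<Sum>i\<in>I. f i x) x"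
  by (induction I rule: infinite_finite_induct) (auto intro: Ck_near_const Ck_near_add)

lemma Ck_near_shift: "Ck_near k f (x - t) \<Longrightarrow> Ck_near k (\<lambda>x. f (x - t)) x"
  unfolding Ck_near_def
proof (elim exE conjE)
  fix r :: real assume "r > 0" "Ck_on k f {x - t - r<..<x - t + r}"
  then show "\<exists>r>0. Ck_on k (\<lambda>x. f (x - t)) {x - r<..<x + r}"
    by (intro exI[of _ r] conjI Ck_on_shift) (auto simp: algebra_simps)
qed

lemma Ck_near_le: "Ck_near k f x \<Longrightarrow> j \<le> k \<Longrightarrow> Ck_near j f x"
  unfolding Ck_near_def using Ck_on_le by blast

lemma Ck_near_cong_ev:
  assumes "Ck_near k f x" "\<forall>\<^sub>F y in nhds x. f y = g y"
  shows "Ck_near k g x"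
proof -
  obtain r where r: "r > 0" "Ck_on k f {x - r<..<x + r}" using assms by (auto simp: Ck_near_def)
  obtain T where T: "open T" "x \<in> T" "\<And>y. y \<in> T \<Longrightarrow> f y = g y"
    using assms(2) unfolding eventually_nhds by auto
  have "Ck_on k g (T \<inter> {x - r<..<x + r})"
    by (rule Ck_on_cong[OF Ck_on_subset[OF r(2)]]) (use T in \<open>auto intro!: open_Int\<close>)
  then show ?thesis by (rule Ck_nearI) (use T r in \<open>auto intro!: open_Int\<close>)
qed

lemma Ck_near_antideriv:
  assumes "\<And>x. (F has_real_derivative f x) (at x)" "Ck_near k f x"
  shows "Ck_near (Suc k) F x"
  using assms(2) unfolding Ck_near_def
  by (elim exE conjE, intro exI conjI Ck_on_SucI[of _ F f] assms(1)) auto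

section \<open>Iterated pointwise derivatives and classes C^k\<close>

lemma funpow_deriv_cong:
  assumes "open S" "\<And>x. x \<in> S \<Longrightarrow> f x = g x" "x \<in> S"
  shows "(deriv ^^ n) f x = (deriv ^^ n) g x"
  using assms(3)
proof (induction n arbitrary: x)
  case (Suc n)
  have "\<forall>\<^sub>F y in nhds x. (deriv ^^ n) f y = (deriv ^^ n) g y"
    using Suc eventually_nhds assms(1) by blast
  then show ?case by (simp add: deriv_cong_ev)
qed (use assms in auto)

lemma times_differentiable_at_antideriv:
  assumes "open S" "\<And>x. x \<in> S \<Longrightarrow> (f has_real_derivative g x) (at x)"
    and "\<And>x. x \<in> S \<Longrightarrow> times_differentiable_at n g x" "x \<in> S"
  shows "times_differentiable_at (Suc n) f x"
  using assms(3,4)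
proof (induction n arbitrary: x)
  case 0
  then show ?case using assms(2)[of x] by (auto intro: differentiableI simp: real_differentiable_def)
next
  case (Suc n)
  have "times_differentiable_at (Suc n) f y" if "y \<in> S" for y
    using Suc.IH[of y] Suc.prems(1) that assms(1) by (auto simp: eventually_nhds_x_imp_x dest: eventually_nhds_x_imp_x)
  then have 1: "\<forall>\<^sub>F y in nhds x. times_differentiable_at (Suc n) f y"
    using Suc.prems assms(1) eventually_nhds by blast
  have eq: "(deriv ^^ Suc n) f y = (deriv ^^ n) g y" if "y \<in> S" for y
    using funpow_deriv_cong[OF assms(1), of "deriv f" g y n] assms(2) that
    by (simp add: DERIV_imp_deriv funpow_swap1)
  have "(deriv ^^ n) g differentiable (at x)" using Suc.prems(1)[OF Suc.prems(2)] by simp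
  then have "(deriv ^^ Suc n) f differentiable (at x)"
    unfolding real_differentiable_def
    using has_field_derivative_transform_within_open[OF _ assms(1) Suc.prems(2), of "(deriv ^^ n) g" _ "(deriv ^^ Suc n) f"] eq
    by metis
  with 1 show ?case by simp
qed

lemma Ck_on_imp_times_differentiable_at:
  "Ck_on k f S \<Longrightarrow> open S \<Longrightarrow> x \<in> S \<Longrightarrow> times_differentiable_at k f x"
proof (induction k arbitrary: f x)
  case (Suc k)
  then obtain g where g: "\<forall>x\<in>S. (f has_real_derivative g x) (at x)" "Ck_on k g S" by auto
  show ?case
    by (rule times_differentiable_at_antideriv[of S f g]) (use g Suc in auto)
qed simp

lemma Ck_near_imp_times_differentiable_at: "Ck_near k f x \<Longrightarrow> times_differentiable_at k f x"
  unfolding Ck_near_def using Ck_on_imp_times_differentiable_at[of k f "{x - _<..<x + _}"] by auto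

lemma times_differentiable_at_le:
  "times_differentiable_at m f x \<Longrightarrow> j \<le> m \<Longrightarrow> times_differentiable_at j f x"
  by (induction m) (auto simp: le_Suc_eq dest: eventually_nhds_x_imp_x)

text \<open>One order is lost, since the derivative of order k + 1 exists but may be discontinuous.
  The loss does not matter for a function with derivatives of all orders, such as the smooth part of
  the tail.\<close>

lemma times_differentiable_at_imp_Ck_on:
  assumes "\<And>x. x \<in> S \<Longrightarrow> times_differentiable_at (Suc k) f x"
  shows "Ck_on k f S"
proof -
  have *: "((deriv ^^ i) f has_real_derivative (deriv ^^ Suc i) f x) (at x)" if "x \<in> S" "i \<le> k" for i x
  proof -
    have "times_differentiable_at (Suc i) f x"
      by (rule times_differentiable_at_le[OF assms[OF that(1)]]) (use that in simp)
    then have "(deriv ^^ i) f differentiable (at x)" by simp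
    then show ?thesis by (simp add: DERIV_deriv_iff_real_differentiable)
  qed
  have "Ck_on j ((deriv ^^ i) f) S" if "i + j = k" for i j
    using that
  proof (induction j arbitrary: i)
    case 0
    then show ?case using * by (auto intro!: continuous_at_imp_continuous_on DERIV_isCont)
  next
    case (Suc j)
    then show ?case using *[of _ i] by (auto intro!: exI[of _ "(deriv ^^ Suc i) f"] Suc.IH[of "Suc i", simplified])
  qed
  from this[of 0 k] show ?thesis by simp
qed

lemma times_differentiable_at_deriv:
  "times_differentiable_at (Suc n) f x \<Longrightarrow> times_differentiable_at n (deriv f) x"
proof (induction n arbitrary: x)
  case (Suc n)
  then have "\<forall>\<^sub>F y in nhds x. times_differentiable_at (Suc n) f y"
    "(deriv ^^ Suc n) f differentiable (at x)" by (simp_all del: funpow.simps)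
  then show ?case using Suc.IH by (auto simp: funpow_swap1 elim: eventually_mono)
qed simp

text \<open>For n = 0 this is constantly 1 because 0 ^ 0 = 1, and not the step function; hence the
  exponents \<open>Suc n\<close> below and a separate indicator as the derivative of
  \<open>trunc_power 1 a\<close>.\<close>

definition trunc_power :: "nat \<Rightarrow> real \<Rightarrow> real \<Rightarrow> real" where
  "trunc_power n a x = max 0 (x - a) ^ n"

lemma trunc_power_has_derivative:
  "(trunc_power (Suc (Suc n)) a has_real_derivative (real (n + 2) * trunc_power (Suc n) a x)) (at x)"
proof -
  consider "x < a" | "x = a" | "x > a" by linarith
  then show ?thesis
  proof cases
    case 1
    have "(trunc_power (Suc (Suc n)) a has_real_derivative 0) (at x)"
      by (rule has_field_derivative_transform_within_open[of "\<lambda>_. 0" _ _ "{..<a}"])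
        (use 1 in \<open>auto simp: trunc_power_def max_def\<close>)
    then show ?thesis using 1 by (simp add: trunc_power_def max_def)
  next
    case 2
    have "isCont (trunc_power (Suc n) a) a"
      unfolding trunc_power_def by (intro continuous_intros)
    \<comment> \<open>Caratheodory's criterion at the knot: the slope function is the truncated
      power of one degree less, which is continuous and vanishes at a.\<close>
    moreover have "trunc_power (Suc (Suc n)) a z - trunc_power (Suc (Suc n)) a a = trunc_power (Suc n) a z * (z - a)" for z
      by (simp add: trunc_power_def max_def)
    ultimately show ?thesis unfolding CARAT_DERIV using 2
      by (intro exI[of _ "trunc_power (Suc n) a"]) (auto simp: trunc_power_def)
  next
    case 3
    have "((\<lambda>x. (x - a) ^ (Suc (Suc n))) has_real_derivative (real (n + 2) * (x - a) ^ Suc n)) (at x)"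
      by (rule derivative_eq_intros refl | simp add: algebra_simps)+
    then have "(trunc_power (Suc (Suc n)) a has_real_derivative (real (n + 2) * (x - a) ^ Suc n)) (at x)"
      by (rule has_field_derivative_transform_within_open[of _ _ _ "{a<..}"]) (use 3 in \<open>auto simp: trunc_power_def max_def\<close>)
    then show ?thesis using 3 by (simp add: trunc_power_def max_def)
  qed
qed

lemma trunc_power_1_not_differentiable: "\<not> trunc_power 1 a differentiable (at a)"
proof
  assume "trunc_power 1 a differentiable (at a)"
  then obtain d where "(trunc_power 1 a has_real_derivative d) (at a)" by (auto simp: real_differentiable_def)
  then have lim: "((\<lambda>h. trunc_power 1 a (a + h) / h) \<longlongrightarrow> d) (at 0)"
    by (simp add: DERIV_def trunc_power_def)
  have "((\<lambda>h. trunc_power 1 a (a + h) / h) \<longlongrightarrow> 1) (at_right 0)"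
    by (rule tendsto_eventually) (auto simp: trunc_power_def eventually_at_right_field intro!: exI[of _ 1])
  moreover have "((\<lambda>h. trunc_power 1 a (a + h) / h) \<longlongrightarrow> 0) (at_left 0)"
    by (rule tendsto_eventually) (auto simp: trunc_power_def eventually_at_left_field intro!: exI[of _ "-1"])
  ultimately show False
    using lim tendsto_unique[of "at_right (0::real)" "\<lambda>h. trunc_power 1 a (a + h) / h" 1 d]
      tendsto_unique[of "at_left (0::real)" "\<lambda>h. trunc_power 1 a (a + h) / h" 0 d]
    by (simp add: filterlim_at_split)
qed

text \<open>Each differentiation lowers the class of \<psi> and the degree of the truncated power by
  one, and after k of them the kink of \<open>trunc_power 1 a\<close> stands beside a differentiable
  function.\<close>

lemma not_times_differentiable_at_trunc_power:
  assumes "Ck_on (Suc k) \<psi> S" "open S" "a \<in> S" "c \<noteq> 0"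
    and "\<And>x. x \<in> S \<Longrightarrow> f x = \<psi> x + c * trunc_power (Suc k) a x"
  shows "\<not> times_differentiable_at (Suc k) f a"
  using assms
proof (induction k arbitrary: f \<psi> c)
  case 0
  show ?case
  proof
    assume "times_differentiable_at (Suc 0) f a"
    then obtain d where d: "(f has_real_derivative d) (at a)" by (auto simp: real_differentiable_def)
    obtain e where e: "(\<psi> has_real_derivative e) (at a)" using 0 by auto
    have "((\<lambda>x. (f x - \<psi> x) / c) has_real_derivative (d - e) / c) (at a)"
      using d e by (auto intro!: derivative_eq_intros simp: \<open>c \<noteq> 0\<close>)
    then have "(trunc_power 1 a has_real_derivative (d - e) / c) (at a)"
      by (rule has_field_derivative_transform_within_open[of _ _ _ S]) (use 0 in auto)
    then show False using trunc_power_1_not_differentiable real_differentiable_def by blast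
  qed
next
  case (Suc k)
  obtain g where g: "\<forall>x\<in>S. (\<psi> has_real_derivative g x) (at x)" "Ck_on (Suc k) g S"
    using Suc.prems(1) by (metis Ck_on.simps(2))
  have "deriv f x = g x + c * real (k + 2) * trunc_power (Suc k) a x" if "x \<in> S" for x
  proof (rule DERIV_imp_deriv)
    have "((\<lambda>x. \<psi> x + c * trunc_power (Suc (Suc k)) a x) has_real_derivative
        g x + c * (real (k + 2) * trunc_power (Suc k) a x)) (at x)"
      using g that by (intro DERIV_add DERIV_cmult trunc_power_has_derivative) auto
    then have "(f has_real_derivative g x + c * (real (k + 2) * trunc_power (Suc k) a x)) (at x)"
      by (rule has_field_derivative_transform_within_open[of _ _ _ S]) (use Suc.prems that in auto)
    then show "(f has_real_derivative g x + c * real (k + 2) * trunc_power (Suc k) a x) (at x)"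
      by (simp add: mult.assoc)
  qed
  then have "\<not> times_differentiable_at (Suc k) (deriv f) a"
    using Suc.IH[OF g(2) Suc.prems(2,3), of "c * real (k + 2)" "deriv f"] Suc.prems(4) by simp
  then show ?case using times_differentiable_at_deriv by blast
qed

section \<open>Convolution with locally integrable kernels\<close>

text \<open>Dominated convergence along sequences. Continuity is asked only almost everywhere so
  that a step function can be convolved, its jump being met at a single y.\<close>

lemma isCont_LINT:
  fixes f :: "real \<Rightarrow> 'b \<Rightarrow> real"
  assumes "x0 \<in> {a<..<b}" "\<And>x. x \<in> {a<..<b} \<Longrightarrow> f x \<in> borel_measurable M"
    and "AE y in M. isCont (\<lambda>x. f x y) x0"
    and "\<And>x y. x \<in> {a<..<b} \<Longrightarrow> y \<in> space M \<Longrightarrow> \<bar>f x y\<bar> \<le> w y" "integrable M w"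
  shows "isCont (\<lambda>x. LINT y|M. f x y) x0"
  unfolding isCont_def LIMSEQ_SEQ_conv[symmetric]
proof (intro allI impI, elim conjE)
  fix s assume s: "\<forall>n. s n \<noteq> x0" "s \<longlonglongrightarrow> x0"
  have "\<forall>\<^sub>F n in sequentially. s n \<in> {a<..<b}"
    using s(2) assms(1) by (intro topological_tendstoD) auto
  then obtain N where N: "\<And>n. n \<ge> N \<Longrightarrow> s n \<in> {a<..<b}" unfolding eventually_sequentially by blast
  have "(\<lambda>n. LINT y|M. f (s (n + N)) y) \<longlonglongrightarrow> (LINT y|M. f x0 y)"
  proof (rule integral_dominated_convergence[where w = w])
    show "AE y in M. (\<lambda>n. f (s (n + N)) y) \<longlonglongrightarrow> f x0 y"
      using assms(3) by eventually_elim (rule isCont_tendsto_compose[OF _ LIMSEQ_ignore_initial_segment[OF s(2)]])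
  qed (use assms N in auto)
  then show "(\<lambda>n. LINT y|M. f (s n) y) \<longlonglongrightarrow> (LINT y|M. f x0 y)"
    by (rule LIMSEQ_offset)
qed

text \<open>The majorant bounds difference quotients instead of derivatives: for
  \<open>trunc_power 1\<close> the derivative is missing at one point, while the Lipschitz bound
  holds throughout.\<close>

lemma DERIV_LINT_AE:
  fixes f :: "real \<Rightarrow> 'b \<Rightarrow> real"
  assumes "x0 \<in> {a<..<b}" "\<And>x. x \<in> {a<..<b} \<Longrightarrow> integrable M (f x)"
    and "AE y in M. ((\<lambda>x. f x y) has_real_derivative g y) (at x0)"
    and "\<And>x y. x \<in> {a<..<b} \<Longrightarrow> y \<in> space M \<Longrightarrow> \<bar>f x y - f x0 y\<bar> \<le> w y * \<bar>x - x0\<bar>"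
    and "integrable M w" "g \<in> borel_measurable M"
  shows "((\<lambda>x. LINT y|M. f x y) has_real_derivative (LINT y|M. g y)) (at x0)"
  unfolding has_field_derivative_iff LIMSEQ_SEQ_conv[symmetric]
proof (intro allI impI, elim conjE)
  fix s assume s: "\<forall>n. s n \<noteq> x0" "s \<longlonglongrightarrow> x0"
  have "\<forall>\<^sub>F n in sequentially. s n \<in> {a<..<b}"
    using s(2) assms(1) by (intro topological_tendstoD) auto
  then obtain N where N: "\<And>n. n \<ge> N \<Longrightarrow> s n \<in> {a<..<b}" unfolding eventually_sequentially by blast
  have "(\<lambda>n. LINT y|M. (f (s (n + N)) y - f x0 y) / (s (n + N) - x0)) \<longlonglongrightarrow> (LINT y|M. g y)"
  proof (rule integral_dominated_convergence[where w = w])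
    show "AE y in M. (\<lambda>n. (f (s (n + N)) y - f x0 y) / (s (n + N) - x0)) \<longlonglongrightarrow> g y"
      using assms(3)
    proof eventually_elim
      case (elim y)
      then have "(\<lambda>x. (f x y - f x0 y) / (x - x0)) \<midarrow>x0\<rightarrow> g y" by (simp add: has_field_derivative_iff)
      then have "(\<lambda>n. (f (s n) y - f x0 y) / (s n - x0)) \<longlonglongrightarrow> g y"
        using s unfolding LIMSEQ_SEQ_conv[symmetric] by blast
      then show ?case by (rule LIMSEQ_ignore_initial_segment)
    qed
    show "AE y in M. norm ((f (s (n + N)) y - f x0 y) / (s (n + N) - x0)) \<le> w y" for n
      using assms(4)[of "s (n + N)"] N[of "n + N"] s by (auto simp: divide_simps)
    show "(\<lambda>y. (f (s (n + N)) y - f x0 y) / (s (n + N) - x0)) \<in> borel_measurable M" for n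
      using assms(2)[of "s (n + N)"] assms(2)[of x0] N[of "n + N"] assms(1) by auto
  qed (use assms in auto)
  also have "(\<lambda>n. LINT y|M. (f (s (n + N)) y - f x0 y) / (s (n + N) - x0))
     = (\<lambda>n. ((LINT y|M. f (s (n + N)) y) - (LINT y|M. f x0 y)) / (s (n + N) - x0))"
    using assms(2) N assms(1) by (auto simp: Bochner_Integration.integral_diff)
  finally show "(\<lambda>n. ((LINT y|M. f (s n) y) - (LINT y|M. f x0 y)) / (s n - x0)) \<longlonglongrightarrow> (LINT y|M. g y)"
    by (rule LIMSEQ_offset)
qed

lemma DERIV_LINT:
  fixes f g :: "real \<Rightarrow> 'b \<Rightarrow> real"
  assumes "x0 \<in> {a<..<b}" "\<And>x. x \<in> {a<..<b} \<Longrightarrow> integrable M (f x)"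
    and "\<And>x y. x \<in> {a<..<b} \<Longrightarrow> y \<in> space M \<Longrightarrow> ((\<lambda>x. f x y) has_real_derivative g x y) (at x)"
    and "\<And>x y. x \<in> {a<..<b} \<Longrightarrow> y \<in> space M \<Longrightarrow> \<bar>g x y\<bar> \<le> w y"
    and "integrable M w" "g x0 \<in> borel_measurable M"
  shows "((\<lambda>x. LINT y|M. f x y) has_real_derivative (LINT y|M. g x0 y)) (at x0)"
proof (rule DERIV_LINT_AE[where w = w])
  fix x y assume xy: "x \<in> {a<..<b}" "y \<in> space M"
  have "norm (f x y - f x0 y) \<le> w y * norm (x - x0)"
    by (rule field_differentiable_bound[of "{a<..<b}" "\<lambda>x. f x y" "\<lambda>x. g x y"])
      (use assms xy in \<open>auto intro: has_field_derivative_at_within\<close>)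
  then show "\<bar>f x y - f x0 y\<bar> \<le> w y * \<bar>x - x0\<bar>" by simp
qed (use assms in auto)

section \<open>Causal functions and convolution on the half-line\<close>

definition conv :: "(real \<Rightarrow> real) \<Rightarrow> (real \<Rightarrow> real) \<Rightarrow> real \<Rightarrow> real" where
  "conv \<kappa> \<phi> x = (LINT y|lborel. \<kappa> y * \<phi> (x - y))"

text \<open>Integrability is required only up to each finite K: for q > 0 the kernel \<kappa> tends
  to q / \<delta> at infinity and is not integrable on the half-line.\<close>

definition kernel :: "(real \<Rightarrow> real) \<Rightarrow> bool" where
  "kernel \<kappa> \<longleftrightarrow> \<kappa> \<in> borel_measurable borel \<and> (\<forall>y\<le>0. \<kappa> y = 0) \<and>
     (\<forall>K. integrable lborel (\<lambda>y. indicator {..K} y * \<kappa> y))"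

definition causal :: "(real \<Rightarrow> real) \<Rightarrow> bool" where
  "causal \<phi> \<longleftrightarrow> \<phi> \<in> borel_measurable borel \<and> (\<forall>x\<le>0. \<phi> x = 0) \<and> (\<forall>K. \<exists>C. \<forall>x\<le>K. \<bar>\<phi> x\<bar> \<le> C)"

lemma kernel_measurable[measurable_dest]: "kernel \<kappa> \<Longrightarrow> \<kappa> \<in> borel_measurable borel" by (simp add: kernel_def)
lemma causal_measurable[measurable_dest]: "causal \<phi> \<Longrightarrow> \<phi> \<in> borel_measurable borel" by (simp add: causal_def)

lemma causal_bound:
  assumes "causal \<phi>" obtains C where "C \<ge> 0" "\<And>x. x \<le> K \<Longrightarrow> \<bar>\<phi> x\<bar> \<le> C"
proof -
  obtain C where "\<forall>x\<le>K. \<bar>\<phi> x\<bar> \<le> C" using assms unfolding causal_def by blast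
  then show ?thesis by (intro that[of "max 0 C"]) fastforce+
qed

text \<open>The integrand lives on 0 < y < x, where \<phi> is bounded and the kernel integrable. The
  majorant serves all x \<le> K at once, as continuity and differentiation under the integral
  require.\<close>

lemma conv_dominated:
  assumes "kernel \<kappa>" "causal \<phi>"
  obtains w where "integrable lborel w" "\<And>x y. x \<le> K \<Longrightarrow> \<bar>\<kappa> y * \<phi> (x - y)\<bar> \<le> w y"
proof -
  obtain C where C: "C \<ge> 0" "\<And>z. z \<le> K \<Longrightarrow> \<bar>\<phi> z\<bar> \<le> C" using causal_bound[OF assms(2)] by metis
  have "\<bar>\<kappa> y * \<phi> (x - y)\<bar> \<le> C * \<bar>indicator {..K} y * \<kappa> y\<bar>" if "x \<le> K" for x y
  proof (cases "y \<le> 0 \<or> y \<ge> x")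
    case True
    then have eq: "\<kappa> y * \<phi> (x - y) = 0" using assms by (auto simp: kernel_def causal_def)
    show ?thesis using C(1) by (subst eq) simp
  next
    case False
    then have "\<bar>\<phi> (x - y)\<bar> \<le> C" using C that by auto
    then show ?thesis using False that mult_left_mono[of "\<bar>\<phi> (x - y)\<bar>" C "\<bar>\<kappa> y\<bar>"]
      by (auto simp: abs_mult mult.commute)
  qed
  moreover have "integrable lborel (\<lambda>y. C * \<bar>indicator {..K} y * \<kappa> y\<bar>)"
    using assms by (auto simp: kernel_def)
  ultimately show ?thesis using that by blast
qed

lemma conv_integrable:
  assumes "kernel \<kappa>" "causal \<phi>"
  shows "integrable lborel (\<lambda>y. \<kappa> y * \<phi> (x - y))"
proof -
  note [measurable] = kernel_measurable[OF assms(1)] causal_measurable[OF assms(2)]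
  obtain w where w: "integrable lborel w" "\<And>x' y. x' \<le> x \<Longrightarrow> \<bar>\<kappa> y * \<phi> (x' - y)\<bar> \<le> w y"
    using conv_dominated[OF assms] by metis
  show ?thesis
    by (rule Bochner_Integration.integrable_bound[OF w(1)])
      (use w(2)[of x] in \<open>auto intro!: AE_I2 order_trans[OF _ abs_ge_self]\<close>)
qed

lemma conv_causal:
  assumes "kernel \<kappa>" "causal \<phi>"
  shows "causal (conv \<kappa> \<phi>)"
  unfolding causal_def
proof (intro conjI allI impI)
  note [measurable] = kernel_measurable[OF assms(1)] causal_measurable[OF assms(2)]
  show "conv \<kappa> \<phi> \<in> borel_measurable borel" unfolding conv_def by measurable
  fix K
  {
    fix x :: real assume "x \<le> 0"
    then have "\<kappa> y * \<phi> (x - y) = 0" for y using assms by (cases "y \<le> 0") (auto simp: kernel_def causal_def)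
    then show "conv \<kappa> \<phi> x = 0" unfolding conv_def by (simp only: integral_zero)
  }
  obtain w where w: "integrable lborel w" "\<And>x' y. x' \<le> K \<Longrightarrow> \<bar>\<kappa> y * \<phi> (x' - y)\<bar> \<le> w y"
    using conv_dominated[OF assms] by metis
  have "\<bar>conv \<kappa> \<phi> x\<bar> \<le> (LINT y|lborel. w y)" if "x \<le> K" for x
  proof -
    have "\<bar>conv \<kappa> \<phi> x\<bar> \<le> (LINT y|lborel. \<bar>\<kappa> y * \<phi> (x - y)\<bar>)"
      unfolding conv_def by (rule integral_abs_bound)
    also have "\<dots> \<le> (LINT y|lborel. w y)"
      using w that conv_integrable[OF assms] by (intro integral_mono) auto
    finally show ?thesis .
  qed
  then show "\<exists>C. \<forall>x\<le>K. \<bar>conv \<kappa> \<phi> x\<bar> \<le> C" by blast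
qed

lemma causal_add: assumes "causal \<phi>" "causal \<psi>" shows "causal (\<lambda>x. \<phi> x + \<psi> x)"
proof -
  have "\<exists>C. \<forall>x\<le>K. \<bar>\<phi> x + \<psi> x\<bar> \<le> C" for K
  proof -
    obtain C D where "\<forall>x\<le>K. \<bar>\<phi> x\<bar> \<le> C" "\<forall>x\<le>K. \<bar>\<psi> x\<bar> \<le> D" using assms unfolding causal_def by metis
    then have "\<forall>x\<le>K. \<bar>\<phi> x + \<psi> x\<bar> \<le> C + D" by fastforce
    then show ?thesis by blast
  qed
  with assms show ?thesis by (auto simp: causal_def)
qed

lemma causal_cmult: assumes "causal \<phi>" shows "causal (\<lambda>x. c * \<phi> x)"
proof -
  have "\<exists>C. \<forall>x\<le>K. \<bar>c * \<phi> x\<bar> \<le> C" for K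
  proof -
    obtain C where "\<forall>x\<le>K. \<bar>\<phi> x\<bar> \<le> C" using assms unfolding causal_def by metis
    then have "\<forall>x\<le>K. \<bar>c * \<phi> x\<bar> \<le> \<bar>c\<bar> * C" by (auto simp: abs_mult intro: mult_left_mono)
    then show ?thesis by blast
  qed
  with assms show ?thesis by (auto simp: causal_def)
qed

lemma causal_continuous:
  assumes "continuous_on UNIV \<phi>" "\<And>x. x \<le> 0 \<Longrightarrow> \<phi> x = 0"
  shows "causal \<phi>"
  unfolding causal_def
proof (intro conjI allI impI)
  show "\<phi> \<in> borel_measurable borel" using assms(1) by (rule borel_measurable_continuous_onI)
  fix K
  have "compact (\<phi> ` {0..K})"
    by (intro compact_continuous_image continuous_on_subset[OF assms(1)]) auto
  then obtain C where C: "\<And>x. x \<in> {0..K} \<Longrightarrow> norm (\<phi> x) \<le> C"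
    using bounded_iff compact_imp_bounded by (metis imageI)
  have "\<bar>\<phi> x\<bar> \<le> max 0 C" if "x \<le> K" for x
    using C[of x] assms(2)[of x] that by (cases "x \<le> 0") auto
  then show "\<exists>C. \<forall>x\<le>K. \<bar>\<phi> x\<bar> \<le> C" by blast
qed (use assms in auto)

lemma conv_add: "kernel \<kappa> \<Longrightarrow> causal \<phi> \<Longrightarrow> causal \<psi> \<Longrightarrow> conv \<kappa> (\<lambda>x. \<phi> x + \<psi> x) x = conv \<kappa> \<phi> x + conv \<kappa> \<psi> x"
  unfolding conv_def by (simp add: distrib_left conv_integrable)

lemma conv_cmult: "conv \<kappa> (\<lambda>x. c * \<phi> x) x = c * conv \<kappa> \<phi> x"
  unfolding conv_def by (simp flip: Bochner_Integration.integral_mult_right_zero add: mult_ac)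

lemma conv_continuous:
  assumes "kernel \<kappa>" "causal \<phi>" "continuous_on UNIV \<phi>"
  shows "continuous_on UNIV (conv \<kappa> \<phi>)"
proof (rule continuous_at_imp_continuous_on, rule ballI)
  fix x :: real
  note [measurable] = kernel_measurable[OF assms(1)] causal_measurable[OF assms(2)]
  obtain w where w: "integrable lborel w" "\<And>x' y. x' \<le> x + 1 \<Longrightarrow> \<bar>\<kappa> y * \<phi> (x' - y)\<bar> \<le> w y"
    using conv_dominated[OF assms(1,2)] by metis
  have "isCont (\<lambda>x. \<kappa> y * \<phi> (x - y)) x" for y
    using assms(3) by (intro continuous_mult continuous_const isCont_o2[of x "\<lambda>x. x - y" \<phi>] continuous_intros)
      (auto simp: continuous_on_eq_continuous_at)
  then show "isCont (conv \<kappa> \<phi>) x"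
    unfolding conv_def[abs_def]
    by (intro isCont_LINT[of x "x - 1" "x + 1" _ _ w]) (use w in auto)
qed

lemma conv_has_derivative:
  assumes "kernel \<kappa>" "causal \<phi>" "causal \<psi>" "\<And>x. (\<phi> has_real_derivative \<psi> x) (at x)"
  shows "(conv \<kappa> \<phi> has_real_derivative conv \<kappa> \<psi> x) (at x)"
proof -
  note [measurable] = kernel_measurable[OF assms(1)] causal_measurable[OF assms(3)]
  obtain w where w: "integrable lborel w" "\<And>x' y. x' \<le> x + 1 \<Longrightarrow> \<bar>\<kappa> y * \<psi> (x' - y)\<bar> \<le> w y"
    using conv_dominated[OF assms(1,3)] by metis
  have "((\<lambda>x. \<phi> (x - y)) has_real_derivative \<psi> (x - y)) (at x)" for x y
    using assms(4)[of "x + - y"] by (subst (asm) DERIV_shift) simp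
  then have "((\<lambda>x. \<kappa> y * \<phi> (x - y)) has_real_derivative \<kappa> y * \<psi> (x - y)) (at x)" for x y
    by (rule DERIV_cmult)
  then show ?thesis unfolding conv_def[abs_def]
    by (intro DERIV_LINT[of x "x - 1" "x + 1" _ _ "\<lambda>x y. \<kappa> y * \<psi> (x - y)" w])
      (use w conv_integrable[OF assms(1,2)] in auto)
qed

text \<open>Integration from 0 is convolution with the Heaviside step, so that linearity, causality
  and integrability are instances of the facts on \<open>conv\<close>.\<close>

abbreviation antideriv :: "(real \<Rightarrow> real) \<Rightarrow> real \<Rightarrow> real" where
  "antideriv \<equiv> conv (indicator {0<..})"

lemma kernel_indicator: "kernel (indicator {0<..})"
proof -
  have "(\<lambda>y. indicator {..K} y * indicator {0<..} y) = (indicator {0<..K} :: real \<Rightarrow> real)" for K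
    by (auto simp: indicator_def fun_eq_iff)
  moreover have "integrable lborel (indicator {0<..K} :: real \<Rightarrow> real)" for K
    by (cases "0 \<le> K") (auto simp: integrable_indicator_iff)
  ultimately show ?thesis by (auto simp: kernel_def)
qed

lemma antideriv_eq: "antideriv \<phi> x = (LINT y|lborel. indicator {..<x} y * \<phi> y)"
  unfolding conv_def
  by (subst lborel_integral_real_affine[of "-1" _ x])
    (auto intro!: Bochner_Integration.integral_cong simp: indicator_def)

lemma antideriv_has_derivative:
  assumes "causal \<phi>" "continuous_on UNIV \<phi>"
  shows "(antideriv \<phi> has_real_derivative \<phi> x) (at x)"
proof -
  \<comment> \<open>A lower limit to the left of both 0 and x: nothing is integrated below 0, and x
    is interior to the interval on which the fundamental theorem is applied.\<close>
  define a where "a = min 0 x - 1"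
  have a: "a < x" "a < 0" by (auto simp: a_def)
  have eq: "antideriv \<phi> z = (LBINT y=a..z. \<phi> y)" if "a < z" for z
  proof -
    have "\<phi> y = 0" if "y \<le> a" for y using assms(1) a that by (auto simp: causal_def)
    then show ?thesis using that unfolding antideriv_eq
      by (auto simp: interval_lebesgue_integral_def set_lebesgue_integral_def indicator_def
        intro!: Bochner_Integration.integral_cong)
  qed
  have "((\<lambda>z. LBINT y=a..z. \<phi> y) has_vector_derivative \<phi> x) (at x within {a..x + 1})"
    by (rule interval_integral_FTC2) (use a assms in \<open>auto intro: continuous_on_subset\<close>)
  then have "((\<lambda>z. LBINT y=a..z. \<phi> y) has_real_derivative \<phi> x) (at x within {a..x + 1})"
    by (simp add: has_real_derivative_iff_has_vector_derivative)
  moreover have "at x within {a..x + 1} = at x" using a by (intro at_within_interior) auto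
  ultimately have "((\<lambda>z. LBINT y=a..z. \<phi> y) has_real_derivative \<phi> x) (at x)" by simp
  then show ?thesis
    by (rule has_field_derivative_transform_within_open[of _ _ _ "{a<..}"]) (use a eq in auto)
qed

lemma antideriv_unique:
  assumes "causal \<phi>" "continuous_on UNIV \<phi>" "\<And>x. (F has_real_derivative \<phi> x) (at x)" "F 0 = 0"
  shows "F x = antideriv \<phi> x"
proof -
  have "((\<lambda>x. F x - antideriv \<phi> x) has_real_derivative 0) (at x)" for x
    using DERIV_diff[OF assms(3)[of x] antideriv_has_derivative[OF assms(1,2)]] by simp
  then have "F x - antideriv \<phi> x = F 0 - antideriv \<phi> 0" by (intro DERIV_const_ratio_const DERIV_isconst_all) auto
  moreover have "antideriv \<phi> 0 = 0" using conv_causal[OF kernel_indicator assms(1)] by (simp add: causal_def)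
  ultimately show ?thesis using assms(4) by simp
qed

section \<open>Kernels supported near zero\<close>

lemma conv_short_measurable:
  assumes "kernel \<kappa>" "\<And>y. y \<ge> \<epsilon> \<Longrightarrow> \<kappa> y = 0" "continuous_on {a - \<epsilon><..<b} \<phi>" "x \<in> {a<..<b}"
  shows "(\<lambda>y. \<kappa> y * \<phi> (x - y)) \<in> borel_measurable borel"
proof -
  note [measurable] = kernel_measurable[OF assms(1)]
  have [measurable]: "(\<lambda>z. indicator {a - \<epsilon><..<b} z *\<^sub>R \<phi> z) \<in> borel_measurable borel"
    by (rule borel_measurable_continuous_on_indicator[OF _ assms(3)]) simp
  \<comment> \<open>Only values of \<phi> in the window a - \<epsilon> to b are seen by the kernel,
    and \<phi> is controlled only there; cutting it off outside makes it measurable without changing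
    the integrand.\<close>
  have "(\<lambda>y. \<kappa> y * \<phi> (x - y)) = (\<lambda>y. \<kappa> y * (indicator {a - \<epsilon><..<b} (x - y) *\<^sub>R \<phi> (x - y)))"
  proof
    fix y show "\<kappa> y * \<phi> (x - y) = \<kappa> y * (indicator {a - \<epsilon><..<b} (x - y) *\<^sub>R \<phi> (x - y))"
      using assms(1,2,4) by (cases "y \<le> 0 \<or> y \<ge> \<epsilon>") (auto simp: kernel_def indicator_def)
  qed
  also have "\<dots> \<in> borel_measurable borel" by measurable
  finally show ?thesis .
qed

lemma conv_short_dominated:
  assumes "kernel \<kappa>" "\<And>y. y \<ge> \<epsilon> \<Longrightarrow> \<kappa> y = 0" "continuous_on {a - \<epsilon><..<b} \<phi>" "x \<in> {a<..<b}"
  obtains a' b' w where "a < a'" "a' < x" "x < b'" "b' < b" "integrable lborel w"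
    "\<And>x y. x \<in> {a'<..<b'} \<Longrightarrow> \<bar>\<kappa> y * \<phi> (x - y)\<bar> \<le> w y"
proof -
  \<comment> \<open>On the open window \<phi> may be unbounded near the ends, so the majorant is
    built on a compact part; midpoints keep x inside.\<close>
  define a' b' where "a' = (a + x) / 2" and "b' = (x + b) / 2"
  have ab: "a < a'" "a' < x" "x < b'" "b' < b" using assms(4) by (auto simp: a'_def b'_def)
  have "compact (\<phi> ` {a' - \<epsilon>..b'})"
    by (intro compact_continuous_image continuous_on_subset[OF assms(3)]) (use ab in auto)
  then obtain C where C: "\<And>z. z \<in> {a' - \<epsilon>..b'} \<Longrightarrow> norm (\<phi> z) \<le> C"
    using bounded_iff compact_imp_bounded by (metis imageI)
  have "\<bar>\<kappa> y * \<phi> (z - y)\<bar> \<le> \<bar>C\<bar> * \<bar>indicator {..\<epsilon>} y * \<kappa> y\<bar>" if "z \<in> {a'<..<b'}" for z y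
  proof (cases "y \<le> 0 \<or> y \<ge> \<epsilon>")
    case True
    then have eq: "\<kappa> y = 0" using assms by (auto simp: kernel_def)
    show ?thesis by (simp add: eq)
  next
    case False
    then have "\<bar>\<phi> (z - y)\<bar> \<le> \<bar>C\<bar>" using C[of "z - y"] that by auto
    then show ?thesis using False that mult_left_mono[of "\<bar>\<phi> (z - y)\<bar>" "\<bar>C\<bar>" "\<bar>\<kappa> y\<bar>"]
      by (auto simp: abs_mult mult.commute)
  qed
  moreover have "integrable lborel (\<lambda>y. \<bar>C\<bar> * \<bar>indicator {..\<epsilon>} y * \<kappa> y\<bar>)"
    using assms by (auto simp: kernel_def)
  ultimately show ?thesis using that ab by blast
qed

lemma conv_short_integrable:
  assumes "kernel \<kappa>" "\<And>y. y \<ge> \<epsilon> \<Longrightarrow> \<kappa> y = 0" "continuous_on {a - \<epsilon><..<b} \<phi>" "x \<in> {a<..<b}"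
  shows "integrable lborel (\<lambda>y. \<kappa> y * \<phi> (x - y))"
proof -
  obtain a' b' w where w: "a < a'" "a' < x" "x < b'" "b' < b" "integrable lborel w"
    "\<And>x y. x \<in> {a'<..<b'} \<Longrightarrow> \<bar>\<kappa> y * \<phi> (x - y)\<bar> \<le> w y"
    using conv_short_dominated[OF assms] by metis
  show ?thesis
    by (rule Bochner_Integration.integrable_bound[OF w(5)])
      (use conv_short_measurable[OF assms] w(2,3) w(6)[of x] in \<open>auto intro!: AE_I2 order_trans[OF _ abs_ge_self]\<close>)
qed

text \<open>All derivatives fall on \<phi>, the kernel being merely integrable. This absorbs the
  singularity of \<kappa> at 0 together with the possibly infinitely many steps below
  \<epsilon>.\<close>

lemma Ck_on_conv_short:
  assumes "kernel \<kappa>" "\<And>y. y \<ge> \<epsilon> \<Longrightarrow> \<kappa> y = 0" "Ck_on k \<phi> {a - \<epsilon><..<b}"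
  shows "Ck_on k (conv \<kappa> \<phi>) {a<..<b}"
  using assms(3)
proof (induction k arbitrary: \<phi>)
  case 0
  then have cont: "continuous_on {a - \<epsilon><..<b} \<phi>" by simp
  have "isCont (conv \<kappa> \<phi>) x" if x: "x \<in> {a<..<b}" for x
  proof -
    obtain a' b' w where w: "a < a'" "a' < x" "x < b'" "b' < b" "integrable lborel w"
      "\<And>x y. x \<in> {a'<..<b'} \<Longrightarrow> \<bar>\<kappa> y * \<phi> (x - y)\<bar> \<le> w y"
      using conv_short_dominated[OF assms(1,2) cont x] by metis
    have "isCont (\<lambda>x. \<kappa> y * \<phi> (x - y)) x" for y
    proof (cases "y \<le> 0 \<or> y \<ge> \<epsilon>")
      case True
      then have eq: "\<kappa> y = 0" using assms by (auto simp: kernel_def)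
      show ?thesis by (simp add: eq)
    next
      case False
      then have "isCont \<phi> (x - y)" using cont x by (auto simp: continuous_on_eq_continuous_at)
      then show ?thesis
        by (intro continuous_mult continuous_const isCont_o2[of x "\<lambda>x. x - y" \<phi>] continuous_intros)
    qed
    then show ?thesis
      unfolding conv_def[abs_def]
      by (intro isCont_LINT[of x a' b' _ _ w])
        (use w conv_short_measurable[OF assms(1,2) cont] in auto)
  qed
  then show ?case by (auto intro: continuous_at_imp_continuous_on)
next
  case (Suc k)
  from Suc.prems obtain \<psi> where \<psi>: "\<And>x. x \<in> {a - \<epsilon><..<b} \<Longrightarrow> (\<phi> has_real_derivative \<psi> x) (at x)"
    "Ck_on k \<psi> {a - \<epsilon><..<b}" by (metis Ck_on.simps(2))
  have cont: "continuous_on {a - \<epsilon><..<b} \<phi>" "continuous_on {a - \<epsilon><..<b} \<psi>"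
    using Ck_on_imp_continuous_on Suc.prems \<psi>(2) by blast+
  have "(conv \<kappa> \<phi> has_real_derivative conv \<kappa> \<psi> x) (at x)" if x: "x \<in> {a<..<b}" for x
  proof -
    obtain a' b' w where w: "a < a'" "a' < x" "x < b'" "b' < b" "integrable lborel w"
      "\<And>x y. x \<in> {a'<..<b'} \<Longrightarrow> \<bar>\<kappa> y * \<psi> (x - y)\<bar> \<le> w y"
      using conv_short_dominated[OF assms(1,2) cont(2) x] by metis
    have "((\<lambda>x. \<kappa> y * \<phi> (x - y)) has_real_derivative \<kappa> y * \<psi> (x - y)) (at x)" if "x \<in> {a'<..<b'}" for x y
    proof (cases "y \<le> 0 \<or> y \<ge> \<epsilon>")
      case True
      then have eq: "\<kappa> y = 0" using assms by (auto simp: kernel_def)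
      show ?thesis by (simp add: eq)
    next
      case False
      then have "(\<phi> has_real_derivative \<psi> (x - y)) (at (x + - y))" using \<psi>(1) w that by auto
      then have "((\<lambda>x. \<phi> (x - y)) has_real_derivative \<psi> (x - y)) (at x)"
        by (subst (asm) DERIV_shift) simp
      then show ?thesis by (rule DERIV_cmult)
    qed
    then show ?thesis
      unfolding conv_def[abs_def]
      by (intro DERIV_LINT[of x a' b' _ _ "\<lambda>x y. \<kappa> y * \<psi> (x - y)" w])
        (use w x conv_short_integrable[OF assms(1,2) cont(1)] conv_short_measurable[OF assms(1,2) cont(2)] in auto)
  qed
  then show ?case by (rule Ck_on_SucI) (use Suc.IH[OF \<psi>(2)] in auto)
qed

lemma Ck_near_conv_short:
  assumes "kernel \<kappa>" "\<And>y. y \<ge> \<epsilon> \<Longrightarrow> \<kappa> y = 0" "Ck_on k \<phi> {x - 2 * \<epsilon><..<x + \<epsilon>}" "\<epsilon> > 0"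
  shows "Ck_near k (conv \<kappa> \<phi>) x"
proof -
  have "Ck_on k (conv \<kappa> \<phi>) {x - \<epsilon><..<x + \<epsilon>}"
    by (rule Ck_on_conv_short[OF assms(1,2)]) (use assms(3) in auto)
  then show ?thesis using assms(4) by (auto simp: Ck_near_def)
qed

section \<open>Smooth kernels cut off at a positive level\<close>

abbreviation cut_below :: "real \<Rightarrow> (real \<Rightarrow> real) \<Rightarrow> real \<Rightarrow> real" where
  "cut_below \<epsilon> c \<equiv> \<lambda>y. if \<epsilon> \<le> y then c y else 0"

lemma kernel_cut_below:
  assumes "\<epsilon> > 0" "continuous_on {0<..} c"
  shows "kernel (cut_below \<epsilon> c)"
proof -
  have "continuous_on {\<epsilon>..K} c" for K
    using assms by (auto intro: continuous_on_subset)
  then have "integrable lborel (\<lambda>y. indicator {\<epsilon>..K} y *\<^sub>R c y)" for K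
    using borel_integrable_atLeastAtMost'[of \<epsilon> K c] by (simp add: set_integrable_def)
  moreover have "(\<lambda>y. indicator {\<epsilon>..K} y *\<^sub>R c y) = (\<lambda>y. indicator {..K} y * cut_below \<epsilon> c y)" for K
    by (auto simp: indicator_def fun_eq_iff)
  moreover have "(\<lambda>y. indicator {\<epsilon>..} y *\<^sub>R c y) \<in> borel_measurable borel"
    by (rule borel_measurable_continuous_on_indicator)
      (use assms in \<open>auto intro: continuous_on_subset\<close>)
  moreover have "(\<lambda>y. indicator {\<epsilon>..} y *\<^sub>R c y) = cut_below \<epsilon> c"
    by (auto simp: indicator_def fun_eq_iff)
  ultimately show ?thesis using assms(1) by (auto simp: kernel_def)
qed

text \<open>Integration by parts in y. The boundary term at y = x vanishes because
  \<open>antideriv \<phi> 0\<close> is 0; the one at \<epsilon> is the trace of the jump made by the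
  cut.\<close>

lemma conv_cut_below_by_parts:
  assumes "\<epsilon> > 0" "\<And>y. y > 0 \<Longrightarrow> (c has_real_derivative c' y) (at y)" "continuous_on {0<..} c'"
    and "causal \<phi>" "continuous_on UNIV \<phi>"
  shows "conv (cut_below \<epsilon> c) \<phi> x = c \<epsilon> * antideriv \<phi> (x - \<epsilon>) + conv (cut_below \<epsilon> c') (antideriv \<phi>) x"
proof (cases "x < \<epsilon>")
  case True
  have z: "\<phi> z = 0" "antideriv \<phi> z = 0" if "z \<le> 0" for z
    using assms(4) conv_causal[OF kernel_indicator assms(4)] that by (auto simp: causal_def)
  have "cut_below \<epsilon> c y * \<phi> (x - y) = 0" "cut_below \<epsilon> c' y * antideriv \<phi> (x - y) = 0" for y
    using True z[of "x - y"] by auto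
  then have "conv (cut_below \<epsilon> c) \<phi> x = 0" "conv (cut_below \<epsilon> c') (antideriv \<phi>) x = 0"
    unfolding conv_def[of "cut_below _ _"] by (simp_all only: integral_zero)
  then show ?thesis using True z[of "x - \<epsilon>"] by simp
next
  case False
  note J = antideriv_has_derivative[OF assms(4,5)]
  have contJ: "isCont (antideriv \<phi>) z" for z using J DERIV_isCont by blast
  have z: "\<phi> z = 0" "antideriv \<phi> z = 0" if "z \<le> 0" for z
    using assms(4) conv_causal[OF kernel_indicator assms(4)] that by (auto simp: causal_def)
  have D: "((\<lambda>y. c y * antideriv \<phi> (x - y)) has_real_derivative
      c' y * antideriv \<phi> (x - y) - c y * \<phi> (x - y)) (at y)" if "y \<ge> \<epsilon>" for y
  proof -
    have "((\<lambda>y. antideriv \<phi> (x - y)) has_real_derivative \<phi> (x - y) * (0 - 1)) (at y)"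
      by (rule DERIV_chain2[OF J]) (auto intro!: derivative_eq_intros)
    then show ?thesis using assms(1,2) that by (auto intro!: derivative_eq_intros)
  qed
  have cc: "isCont c y" "isCont c' y" if "y \<ge> \<epsilon>" for y
    using assms(1,3) that DERIV_isCont[OF assms(2)] by (auto simp: continuous_on_eq_continuous_at)
  have cp: "isCont \<phi> z" for z using assms(5) by (auto simp: continuous_on_eq_continuous_at)
  have "(LBINT y. (c' y * antideriv \<phi> (x - y) - c y * \<phi> (x - y)) * indicator {\<epsilon>..x} y)
      = c x * antideriv \<phi> (x - x) - c \<epsilon> * antideriv \<phi> (x - \<epsilon>)"
    by (rule integral_FTC_Icc_real)
      (use False D cc in \<open>auto intro!: continuous_intros isCont_o2[OF _ contJ] isCont_o2[OF _ cp]\<close>)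
  also have "(\<lambda>y. (c' y * antideriv \<phi> (x - y) - c y * \<phi> (x - y)) * indicator {\<epsilon>..x} y)
     = (\<lambda>y. cut_below \<epsilon> c' y * antideriv \<phi> (x - y) - cut_below \<epsilon> c y * \<phi> (x - y))"
    using z[of "x - _"] by (auto simp: indicator_def fun_eq_iff)
  also have "(LBINT y. cut_below \<epsilon> c' y * antideriv \<phi> (x - y) - cut_below \<epsilon> c y * \<phi> (x - y))
     = conv (cut_below \<epsilon> c') (antideriv \<phi>) x - conv (cut_below \<epsilon> c) \<phi> x"
    unfolding conv_def[of "cut_below _ _"]
    by (intro Bochner_Integration.integral_diff conv_integrable kernel_cut_below assms(1,3,4) conv_causal kernel_indicator)
      (auto intro!: continuous_at_imp_continuous_on DERIV_isCont[OF assms(2)])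
  finally show ?thesis using z[of 0] by simp
qed

lemma causal_antideriv: "causal \<phi> \<Longrightarrow> causal (antideriv \<phi>)"
  by (rule conv_causal[OF kernel_indicator])

text \<open>Away from the cut the kernel is smooth and the derivatives are put on it, so \<phi> may
  be rough elsewhere; only the jump at \<epsilon> transports local behaviour, from x - \<epsilon> to
  x. After integration by parts both terms can be differentiated once more, which drives the
  induction.\<close>

lemma Ck_near_conv_cut_below:
  assumes "\<epsilon> > 0" "\<And>k. Ck_on k c {0<..}" "causal \<phi>" "continuous_on UNIV \<phi>" "Ck_near k \<phi> (x - \<epsilon>)"
  shows "Ck_near k (conv (cut_below \<epsilon> c) \<phi>) x"
  using assms(2-5)
proof (induction k arbitrary: c \<phi>)
  case 0
  have "continuous_on UNIV (conv (cut_below \<epsilon> c) \<phi>)"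
    using 0 assms(1) by (intro conv_continuous kernel_cut_below) (auto intro: Ck_on_imp_continuous_on)
  then show ?case by (intro Ck_nearI_UNIV) simp
next
  case (Suc k)
  obtain c' where c': "\<And>y. y > 0 \<Longrightarrow> (c has_real_derivative c' y) (at y)"
    using Suc.prems(1)[of 1] by auto
  \<comment> \<open>Each order of smoothness of c comes with its own witness for the first
    derivative; uniqueness of derivatives identifies them all with the fixed c'.\<close>
  have smooth: "Ck_on k c' {0<..}" for k
  proof -
    obtain d where d: "\<And>y. y > 0 \<Longrightarrow> (c has_real_derivative d y) (at y)" "Ck_on k d {0<..}"
      using Suc.prems(1)[of "Suc k"] by (auto elim!: Ck_on_SucE)
    have "Ck_on k c' {0<..}"
      by (rule Ck_on_cong[OF d(2)]) (use DERIV_unique[OF d(1) c'] in auto)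
    then show ?thesis .
  qed
  have "Ck_near k \<phi> (x - \<epsilon>)" using Suc.prems by (auto intro: Ck_near_le)
  then have "Ck_near k (conv (cut_below \<epsilon> c') \<phi>) x"
    using Suc.IH[of c' \<phi>] Suc.prems smooth by blast
  moreover have "(conv (cut_below \<epsilon> c') (antideriv \<phi>) has_real_derivative conv (cut_below \<epsilon> c') \<phi> x) (at x)" for x
    using assms(1) smooth[THEN Ck_on_imp_continuous_on] Suc.prems
    by (intro conv_has_derivative kernel_cut_below causal_antideriv antideriv_has_derivative) auto
  ultimately have 1: "Ck_near (Suc k) (conv (cut_below \<epsilon> c') (antideriv \<phi>)) x"
    by (intro Ck_near_antideriv)
  have "Ck_near (Suc k) (antideriv \<phi>) (x - \<epsilon>)"
    by (rule Ck_near_antideriv[OF antideriv_has_derivative]) (use Suc.prems in \<open>auto intro: Ck_near_le\<close>)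
  then have 2: "Ck_near (Suc k) (\<lambda>x. antideriv \<phi> (x - \<epsilon>)) x" by (rule Ck_near_shift)
  have "conv (cut_below \<epsilon> c) \<phi> = (\<lambda>x. c \<epsilon> * antideriv \<phi> (x - \<epsilon>) + conv (cut_below \<epsilon> c') (antideriv \<phi>) x)"
    using conv_cut_below_by_parts[OF assms(1) c' Ck_on_imp_continuous_on[OF smooth] Suc.prems(2,3)] by blast
  then show ?case using Ck_near_add[OF Ck_near_cmult[OF 2] 1] by simp
qed

section \<open>Convolution of truncated powers\<close>

lemma trunc_power_continuous: "continuous_on UNIV (trunc_power n a)"
  unfolding trunc_power_def by (intro continuous_intros)

lemma trunc_power_causal: "a \<ge> 0 \<Longrightarrow> causal (trunc_power (Suc n) a)"
  by (intro causal_continuous trunc_power_continuous) (auto simp: trunc_power_def max_def)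

text \<open>A truncated power of degree n + 1 is only of class C^n, its next derivative being a
  multiple of a step. Convolving the step with an integrable kernel makes it continuous, which gains
  the missing order.\<close>

lemma Ck_on_conv_trunc_power:
  assumes "kernel \<kappa>" "a \<ge> 0"
  shows "Ck_on (Suc n) (conv \<kappa> (trunc_power (Suc n) a)) UNIV"
proof (induction n)
  case 0
  note [measurable] = kernel_measurable[OF assms(1)]
  define \<theta> where "\<theta> = (indicator {a<..} :: real \<Rightarrow> real)"
  have [measurable]: "\<theta> \<in> borel_measurable borel" by (simp add: \<theta>_def)
  have c\<theta>: "causal \<theta>" using assms(2) by (auto simp: causal_def \<theta>_def indicator_def intro!: exI[of _ 1])
  have loc: "isCont \<theta> z" "(trunc_power (Suc 0) a has_real_derivative \<theta> z) (at z)" if "z \<noteq> a" for z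
  proof -
    have "isCont \<theta> z \<and> (trunc_power (Suc 0) a has_real_derivative \<theta> z) (at z)"
    proof (cases "z < a")
      case True
      have "(trunc_power (Suc 0) a has_real_derivative 0) (at z)" "(\<theta> has_real_derivative 0) (at z)"
        by (rule has_field_derivative_transform_within_open[of "\<lambda>_. 0" _ _ "{..<a}"];
            use True in \<open>auto simp: trunc_power_def \<theta>_def\<close>)+
      then show ?thesis using True DERIV_isCont by (auto simp: \<theta>_def)
    next
      case False
      then have za: "z > a" using that by simp
      have "((\<lambda>x. x - a) has_real_derivative 1) (at z)" by (auto intro!: derivative_eq_intros)
      then have "(trunc_power (Suc 0) a has_real_derivative 1) (at z)"
        by (rule has_field_derivative_transform_within_open[of _ _ _ "{a<..}"])
          (use za in \<open>auto simp: trunc_power_def\<close>)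
      moreover have "(\<theta> has_real_derivative 0) (at z)"
        by (rule has_field_derivative_transform_within_open[of "\<lambda>_. 1" _ _ "{a<..}"])
          (use za in \<open>auto simp: \<theta>_def\<close>)
      ultimately show ?thesis using za DERIV_isCont by (auto simp: \<theta>_def)
    qed
    then show "isCont \<theta> z" "(trunc_power (Suc 0) a has_real_derivative \<theta> z) (at z)" by auto
  qed
  have AEx: "AE y in lborel. x - y \<noteq> a" for x
    using AE_lborel_singleton[of "x - a"] by eventually_elim auto
  have "(conv \<kappa> (trunc_power (Suc 0) a) has_real_derivative conv \<kappa> \<theta> x) (at x)" for x
    unfolding conv_def[abs_def]
  proof (rule DERIV_LINT_AE[of x "x - 1" "x + 1" _ _ _ "\<lambda>y. \<bar>indicator {..x + 1} y * \<kappa> y\<bar>"])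
    show "AE y in lborel. ((\<lambda>x. \<kappa> y * trunc_power (Suc 0) a (x - y)) has_real_derivative \<kappa> y * \<theta> (x - y)) (at x)"
      using AEx[of x]
    proof eventually_elim
      case (elim y)
      have "(trunc_power (Suc 0) a has_real_derivative \<theta> (x - y)) (at (x + - y))" using loc(2)[OF elim] by simp
      then have "((\<lambda>x. trunc_power (Suc 0) a (x - y)) has_real_derivative \<theta> (x - y)) (at x)"
        by (subst (asm) DERIV_shift) simp
      then show ?case by (rule DERIV_cmult)
    qed
    fix z y assume z: "z \<in> {x - 1<..<x + 1}"
    \<comment> \<open>The truncated power is 1-Lipschitz, and both values vanish for y > x + 1
      because a is nonnegative.\<close>
    have "\<bar>trunc_power (Suc 0) a (z - y) - trunc_power (Suc 0) a (x - y)\<bar> \<le> indicator {..x + 1} y * \<bar>z - x\<bar>"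
      using z assms(2) by (auto simp: trunc_power_def indicator_def)
    then have "\<bar>\<kappa> y\<bar> * \<bar>trunc_power (Suc 0) a (z - y) - trunc_power (Suc 0) a (x - y)\<bar> \<le> \<bar>\<kappa> y\<bar> * (indicator {..x + 1} y * \<bar>z - x\<bar>)"
      by (intro mult_left_mono) auto
    then show "\<bar>\<kappa> y * trunc_power (Suc 0) a (z - y) - \<kappa> y * trunc_power (Suc 0) a (x - y)\<bar>
        \<le> \<bar>indicator {..x + 1} y * \<kappa> y\<bar> * \<bar>z - x\<bar>"
      by (simp add: abs_mult mult_ac flip: right_diff_distrib)
  qed (use assms conv_integrable[OF assms(1) trunc_power_causal[OF assms(2)]] in \<open>auto simp: kernel_def\<close>)
  moreover have "isCont (conv \<kappa> \<theta>) x" for x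
  proof -
    obtain w where w: "integrable lborel w" "\<And>x' y. x' \<le> x + 1 \<Longrightarrow> \<bar>\<kappa> y * \<theta> (x' - y)\<bar> \<le> w y"
      using conv_dominated[OF assms(1) c\<theta>] by metis
    have "AE y in lborel. isCont (\<lambda>x. \<kappa> y * \<theta> (x - y)) x"
      using AEx[of x]
      by eventually_elim (intro continuous_mult continuous_const isCont_o2[of x "\<lambda>x. x - _" \<theta>] continuous_intros loc(1))
    then show ?thesis
      unfolding conv_def[abs_def]
      by (intro isCont_LINT[of x "x - 1" "x + 1" _ _ w]) (use w in auto)
  qed
  ultimately show ?case
    by (intro Ck_on_SucI[where g = "conv \<kappa> \<theta>"]) (auto intro: continuous_at_imp_continuous_on)
next
  case (Suc n)
  have "(conv \<kappa> (trunc_power (Suc (Suc n)) a) has_real_derivative conv \<kappa> (\<lambda>x. real (n + 2) * trunc_power (Suc n) a x) x) (at x)" for x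
    by (intro conv_has_derivative assms trunc_power_causal trunc_power_has_derivative causal_cmult)
  then have "(conv \<kappa> (trunc_power (Suc (Suc n)) a) has_real_derivative real (n + 2) * conv \<kappa> (trunc_power (Suc n) a) x) (at x)" for x
    unfolding conv_cmult .
  then show ?case by (rule Ck_on_SucI[OF _ Ck_on_cmult[OF Suc]])
qed

section \<open>Local regularity of the convolution powers\<close>

lemma Ck_on_ident: "Ck_on k (\<lambda>x. x) S"
proof (cases k)
  case (Suc j) then show ?thesis using Ck_on_SucI[OF _ Ck_on_const[of j 1 S], of "\<lambda>x. x"] by simp
qed simp

text \<open>\<open>asums A j\<close> collects the sums of fewer than \<open>j\<close> elements of \<open>A\<close>, so that \<open>asums A 0\<close> is empty and
  \<open>asums A 1 = {0}\<close>.\<close>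

primrec asums :: "real set \<Rightarrow> nat \<Rightarrow> real set" where
  "asums A 0 = {}"
| "asums A (Suc j) = {0} \<union> asums A j \<union> {s + g | s g. s \<in> asums A j \<and> g \<in> A}"

lemma asums_mono: "i \<le> j \<Longrightarrow> asums A i \<subseteq> asums A j"
  by (induction j) (auto simp: le_Suc_eq)

lemma asums_diff: "x \<notin> asums A (Suc j) \<Longrightarrow> g \<in> A \<Longrightarrow> x - g \<notin> asums A j"
  by (auto simp: algebra_simps)

lemma asums_nonneg: "(\<And>g. g \<in> A \<Longrightarrow> g > 0) \<Longrightarrow> x \<in> asums A j \<Longrightarrow> x \<ge> 0"
  by (induction j arbitrary: x) (auto intro!: add_nonneg_nonneg dest: less_imp_le)

lemma conv_diff: "kernel \<kappa> \<Longrightarrow> causal \<phi> \<Longrightarrow> causal \<psi> \<Longrightarrow> conv \<kappa> (\<lambda>x. \<phi> x - \<psi> x) x = conv \<kappa> \<phi> x - conv \<kappa> \<psi> x"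
  using conv_add[of \<kappa> \<phi> "\<lambda>x. (-1) * \<psi> x" x] causal_cmult[of \<psi> "-1"] conv_cmult[of \<kappa> "-1" \<psi> x] by simp

lemma causal_diff: "causal \<phi> \<Longrightarrow> causal \<psi> \<Longrightarrow> causal (\<lambda>x. \<phi> x - \<psi> x)"
  using causal_add[of \<phi> "\<lambda>x. (-1) * \<psi> x"] causal_cmult[of \<psi> "-1"] by simp

lemma kernel_indicator_Ioi: assumes "g \<ge> 0" shows "kernel (indicator {g<..})"
proof -
  have "(\<lambda>y. indicator {..K} y * indicator {g<..} y) = (indicator {g<..K} :: real \<Rightarrow> real)" for K
    by (auto simp: indicator_def fun_eq_iff)
  moreover have "integrable lborel (indicator {g<..K} :: real \<Rightarrow> real)" for K
    by (cases "g \<le> K") (auto simp: integrable_indicator_iff)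
  ultimately show ?thesis using assms by (auto simp: kernel_def)
qed

lemma conv_indicator_Ioi: "conv (indicator {g<..}) \<phi> x = antideriv \<phi> (x - g)"
  unfolding conv_def
  by (subst lborel_integral_real_affine[of 1 _ g])
    (auto intro!: Bochner_Integration.integral_cong simp: indicator_def algebra_simps)

lemma kernel_restrict: assumes "kernel \<kappa>" shows "kernel (\<lambda>y. if y < \<epsilon> then \<kappa> y else 0)"
proof -
  note [measurable] = kernel_measurable[OF assms]
  have "integrable lborel (\<lambda>y. indicator {..K} y * (if y < \<epsilon> then \<kappa> y else 0))" for K
    by (rule Bochner_Integration.integrable_bound[of _ "\<lambda>y. indicator {..K} y * \<kappa> y"])
      (use assms in \<open>auto simp: kernel_def\<close>)
  then show ?thesis using assms by (auto simp: kernel_def)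
qed

lemma causal_funpow: "kernel \<kappa> \<Longrightarrow> causal \<phi> \<Longrightarrow> causal ((conv \<kappa> ^^ n) \<phi>)"
  by (induction n) (auto intro: conv_causal)

lemma continuous_funpow:
  "kernel \<kappa> \<Longrightarrow> causal \<phi> \<Longrightarrow> continuous_on UNIV \<phi> \<Longrightarrow> continuous_on UNIV ((conv \<kappa> ^^ n) \<phi>)"
  by (induction n) (auto intro: conv_continuous causal_funpow)

lemma funpow_conv_diff:
  assumes "kernel \<kappa>" "causal \<phi>" "causal \<psi>"
  shows "(conv \<kappa> ^^ n) (\<lambda>x. \<phi> x - \<psi> x) = (\<lambda>x. (conv \<kappa> ^^ n) \<phi> x - (conv \<kappa> ^^ n) \<psi> x)"
proof (induction n)
  case (Suc n)
  have "(conv \<kappa> ^^ Suc n) (\<lambda>x. \<phi> x - \<psi> x) = conv \<kappa> (\<lambda>x. (conv \<kappa> ^^ n) \<phi> x - (conv \<kappa> ^^ n) \<psi> x)"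
    using Suc by simp
  also have "\<dots> = (\<lambda>x. (conv \<kappa> ^^ Suc n) \<phi> x - (conv \<kappa> ^^ Suc n) \<psi> x)"
    using assms by (simp add: fun_eq_iff conv_diff causal_funpow)
  finally show ?case .
qed simp

text \<open>The smooth part c may depend on \<epsilon> and K, because the total height of the steps
  above \<epsilon> can grow without bound as \<epsilon> tends to 0. Steps have the form
  \<open>indicator {g<..}\<close> because the tail at y = g still counts the atom g; they are
  subtracted because the tail decreases.\<close>

locale jump_kernel =
  fixes \<kappa> :: "real \<Rightarrow> real" and A :: "real set" and a :: "real \<Rightarrow> real"
  assumes kernel: "kernel \<kappa>"
    and A_pos: "g \<in> A \<Longrightarrow> g > 0"
    and a_pos: "g \<in> A \<Longrightarrow> a g > 0"
    and A_finite: "0 < \<epsilon> \<Longrightarrow> finite (A \<inter> {\<epsilon>..K})"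
    and decomp: "0 < \<epsilon> \<Longrightarrow> \<exists>c. (\<forall>k. Ck_on k c {0<..}) \<and>
      (\<forall>y\<in>{\<epsilon>..K}. \<kappa> y = c y - (\<Sum>g\<in>A \<inter> {\<epsilon>..K}. a g * indicator {g<..} y))"
begin

text \<open>The parts of \<kappa> below \<epsilon> and the smooth part above it preserve class C^k,
  so near x0 only the shifted primitives can destroy it. The level stays free below \<epsilon>0, so
  that a prescribed atom can be kept in the finite sum.\<close>

lemma conv_local:
  assumes "causal \<phi>" "continuous_on UNIV \<phi>" "Ck_near k \<phi> x0"
  obtains \<epsilon>0 where "\<epsilon>0 > 0" "\<And>\<epsilon>. 0 < \<epsilon> \<Longrightarrow> \<epsilon> < \<epsilon>0 \<Longrightarrow>
    Ck_near k (\<lambda>x. conv \<kappa> \<phi> x + (\<Sum>g\<in>A \<inter> {\<epsilon>..\<bar>x0\<bar> + 1}. a g * antideriv \<phi> (x - g))) x0"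
proof -
  obtain r where r: "r > 0" "Ck_on k \<phi> {x0 - r<..<x0 + r}" using assms(3) by (auto simp: Ck_near_def)
  \<comment> \<open>For x < K the kernel is only evaluated at y < K. The bound \<epsilon> < r / 2
    below keeps both the window starting at x0 - 2 \<epsilon> and the point x0 - \<epsilon> within
    the interval where \<phi> is of class C^k.\<close>
  define K where "K = \<bar>x0\<bar> + 1"
  have "Ck_near k (\<lambda>x. conv \<kappa> \<phi> x + (\<Sum>g\<in>A \<inter> {\<epsilon>..K}. a g * antideriv \<phi> (x - g))) x0"
    if \<epsilon>: "0 < \<epsilon>" "\<epsilon> < r / 2" for \<epsilon>
  proof -
    obtain c where c: "\<And>k. Ck_on k c {0<..}"
      and dec: "\<And>y. y \<in> {\<epsilon>..K} \<Longrightarrow> \<kappa> y = c y - (\<Sum>g\<in>A \<inter> {\<epsilon>..K}. a g * indicator {g<..} y)"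
      using decomp[OF \<epsilon>(1), of K] by blast
    define \<kappa>s where "\<kappa>s = (\<lambda>y. if y < \<epsilon> then \<kappa> y else 0)"
    have ks: "kernel \<kappa>s" unfolding \<kappa>s_def by (rule kernel_restrict[OF kernel])
    have kf: "kernel (cut_below \<epsilon> c)" by (rule kernel_cut_below[OF \<epsilon>(1) Ck_on_imp_continuous_on[OF c]])
    have kg: "kernel (indicator {g<..})" if "g \<in> A" for g
      by (rule kernel_indicator_Ioi) (use A_pos[OF that] in simp)
    have eq: "conv \<kappa> \<phi> x = conv \<kappa>s \<phi> x + conv (cut_below \<epsilon> c) \<phi> x - (\<Sum>g\<in>A \<inter> {\<epsilon>..K}. a g * antideriv \<phi> (x - g))"
      if x: "x < K" for x
    proof -
      have "\<kappa> y * \<phi> (x - y) = \<kappa>s y * \<phi> (x - y) + cut_below \<epsilon> c y * \<phi> (x - y)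
          - (\<Sum>g\<in>A \<inter> {\<epsilon>..K}. a g * (indicator {g<..} y * \<phi> (x - y)))" for y
      proof (cases "y \<ge> x")
        case True
        then have eq: "\<phi> (x - y) = 0" using assms(1) by (auto simp: causal_def)
        show ?thesis by (simp add: eq)
      next
        case False
        have "\<kappa> y = \<kappa>s y + cut_below \<epsilon> c y - (\<Sum>g\<in>A \<inter> {\<epsilon>..K}. a g * indicator {g<..} y)"
        proof (cases "y < \<epsilon>")
          case True
          then have "(\<Sum>g\<in>A \<inter> {\<epsilon>..K}. a g * indicator {g<..} y) = 0" by (intro sum.neutral) auto
          then show ?thesis using True by (simp add: \<kappa>s_def)
        qed (use dec[of y] x False in \<open>auto simp: \<kappa>s_def\<close>)
        then show ?thesis by (simp only: left_diff_distrib distrib_right sum_distrib_right mult.assoc)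
      qed
      then have "conv \<kappa> \<phi> x = (LBINT y. \<kappa>s y * \<phi> (x - y) + cut_below \<epsilon> c y * \<phi> (x - y)
          - (\<Sum>g\<in>A \<inter> {\<epsilon>..K}. a g * (indicator {g<..} y * \<phi> (x - y))))"
        unfolding conv_def[of \<kappa>] by presburger
      also have "\<dots> = conv \<kappa>s \<phi> x + conv (cut_below \<epsilon> c) \<phi> x
          - (\<Sum>g\<in>A \<inter> {\<epsilon>..K}. a g * conv (indicator {g<..}) \<phi> x)"
        using conv_integrable[OF ks assms(1)] conv_integrable[OF kf assms(1)] conv_integrable[OF kg assms(1)]
        unfolding conv_def by (subst Bochner_Integration.integral_diff) (auto simp: Bochner_Integration.integral_sum)
      finally show ?thesis unfolding conv_indicator_Ioi[of _ \<phi> x] .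
    qed
    have "Ck_on k \<phi> {x0 - 2 * \<epsilon><..<x0 + \<epsilon>}"
      by (rule Ck_on_subset[OF r(2)]) (use \<epsilon> in auto)
    then have "Ck_near k (conv \<kappa>s \<phi>) x0"
      by (intro Ck_near_conv_short[OF ks _ _ \<epsilon>(1)]) (auto simp: \<kappa>s_def)
    moreover have "Ck_near k \<phi> (x0 - \<epsilon>)"
      by (rule Ck_nearI[OF r(2)]) (use \<epsilon> in auto)
    then have "Ck_near k (conv (cut_below \<epsilon> c) \<phi>) x0"
      by (rule Ck_near_conv_cut_below[OF \<epsilon>(1) c assms(1,2)])
    ultimately have *: "Ck_near k (\<lambda>x. conv \<kappa>s \<phi> x + conv (cut_below \<epsilon> c) \<phi> x) x0" by (rule Ck_near_add)
    have "\<forall>\<^sub>F x in nhds x0. x < K"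
      unfolding eventually_nhds by (intro exI[of _ "{..<K}"]) (auto simp: K_def)
    then have "\<forall>\<^sub>F x in nhds x0. conv \<kappa>s \<phi> x + conv (cut_below \<epsilon> c) \<phi> x
        = conv \<kappa> \<phi> x + (\<Sum>g\<in>A \<inter> {\<epsilon>..K}. a g * antideriv \<phi> (x - g))"
      by eventually_elim (use eq in auto)
    then show ?thesis by (rule Ck_near_cong_ev[OF *])
  qed
  then show ?thesis using that[of "r / 2"] r by (auto simp: K_def)
qed

lemma Ck_near_antideriv_shift:
  assumes "causal \<phi>" "continuous_on UNIV \<phi>" "Ck_near j \<phi> (x - g)"
  shows "Ck_near (Suc j) (\<lambda>x. antideriv \<phi> (x - g)) x"
  by (intro Ck_near_shift Ck_near_antideriv[OF antideriv_has_derivative] assms)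

text \<open>At the shifted points one order less suffices, because a step of the kernel integrates
  before it translates.\<close>

lemma Ck_near_conv:
  assumes "causal \<phi>" "continuous_on UNIV \<phi>" "Ck_near (Suc j) \<phi> x0" "\<And>g. g \<in> A \<Longrightarrow> Ck_near j \<phi> (x0 - g)"
  shows "Ck_near (Suc j) (conv \<kappa> \<phi>) x0"
proof -
  obtain \<epsilon>0 where \<epsilon>0: "\<epsilon>0 > 0" "\<And>\<epsilon>. 0 < \<epsilon> \<Longrightarrow> \<epsilon> < \<epsilon>0 \<Longrightarrow>
    Ck_near (Suc j) (\<lambda>x. conv \<kappa> \<phi> x + (\<Sum>g\<in>A \<inter> {\<epsilon>..\<bar>x0\<bar> + 1}. a g * antideriv \<phi> (x - g))) x0"
    using conv_local[OF assms(1-3)] by blast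
  define \<epsilon> where "\<epsilon> = \<epsilon>0 / 2"
  have \<epsilon>: "Ck_near (Suc j) (\<lambda>x. conv \<kappa> \<phi> x + (\<Sum>g\<in>A \<inter> {\<epsilon>..\<bar>x0\<bar> + 1}. a g * antideriv \<phi> (x - g))) x0"
    using \<epsilon>0 by (simp add: \<epsilon>_def)
  have "Ck_near (Suc j) (\<lambda>x. \<Sum>g\<in>A \<inter> {\<epsilon>..\<bar>x0\<bar> + 1}. a g * antideriv \<phi> (x - g)) x0"
    by (intro Ck_near_sum Ck_near_cmult Ck_near_antideriv_shift assms) auto
  from Ck_near_diff[OF \<epsilon> this] show ?thesis by simp
qed

text \<open>The points at which the \<open>i\<close>-th convolution power need not be of class \<open>C^k\<close>: at a sum of \<open>j\<close>,
  but not fewer, atoms it is of class \<open>C^j\<close> if \<open>i = j\<close>, and of class \<open>C^(j+1)\<close> if \<open>i > j\<close>.\<close>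

definition exceptional :: "nat \<Rightarrow> nat \<Rightarrow> real set" where
  "exceptional i k = (if i < k then asums A (Suc i) else asums A (k - 1))"

lemma asums_split: "x \<in> asums A (Suc (Suc i)) \<Longrightarrow> x \<notin> asums A (Suc i) \<Longrightarrow> \<exists>g\<in>A. x - g \<in> asums A (Suc i)"
  by (auto; metis add_diff_cancel_right')

context
  fixes c0 :: real and \<phi> :: "nat \<Rightarrow> real \<Rightarrow> real"
  assumes c0: "c0 > 0"
  defines "\<phi> \<equiv> \<lambda>i. (conv \<kappa> ^^ i) (\<lambda>x. c0 * trunc_power 1 0 x)"
begin

lemma phi_Suc: "\<phi> (Suc i) = conv \<kappa> (\<phi> i)" by (simp add: \<phi>_def)

lemma phi_causal: "causal (\<phi> i)"
  unfolding \<phi>_def using trunc_power_causal[of 0 0] by (intro causal_funpow kernel causal_cmult) simp_all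

lemma phi_continuous: "continuous_on UNIV (\<phi> i)"
  unfolding \<phi>_def using trunc_power_causal[of 0 0] trunc_power_continuous[of 1 0]
  by (intro continuous_funpow kernel causal_cmult continuous_on_mult continuous_on_const) simp_all

text \<open>The two claims advance together. Where \<open>\<phi> i\<close> has its principal
  singularity, the first claim for \<open>Suc i\<close> subtracts the term provided by the second.
  Conversely the second claim for \<open>Suc i\<close> uses the first to see that
  \<open>\<phi> i\<close> is regular at x0 itself, so that the singularity comes from the points x0
  - g alone.\<close>

lemma phi_regularity:
  "(\<forall>k x0. x0 \<notin> exceptional i k \<longrightarrow> Ck_near k (\<phi> i) x0) \<and>
   (\<forall>x0\<in>asums A (Suc i) - asums A i. \<exists>c. (-1) ^ i * c > 0 \<and>
      Ck_near (Suc i) (\<lambda>x. \<phi> i x - c * trunc_power (Suc i) x0 x) x0)"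
proof (induction i)
  case 0
  have "Ck_near k (\<phi> 0) x0" if "x0 \<notin> exceptional 0 k" for k x0
  proof (cases k)
    case 0 then show ?thesis using phi_continuous by (intro Ck_nearI_UNIV) simp
  next
    case (Suc j)
    then consider "x0 < 0" | "x0 > 0" using \<open>x0 \<notin> exceptional 0 k\<close> by (cases "x0 < 0") (auto simp: exceptional_def)
    then show ?thesis
    proof cases
      case 1
      have "Ck_on k (\<phi> 0) {..<0}"
        by (rule Ck_on_cong[OF Ck_on_const[of _ 0]]) (auto simp: \<phi>_def trunc_power_def)
      then show ?thesis by (rule Ck_nearI) (use 1 in auto)
    next
      case 2
      have "Ck_on k (\<phi> 0) {0<..}"
        by (rule Ck_on_cong[OF Ck_on_cmult[OF Ck_on_ident, of _ c0]]) (auto simp: \<phi>_def trunc_power_def)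
      then show ?thesis by (rule Ck_nearI) (use 2 in auto)
    qed
  qed
  moreover have "\<exists>c. (-1) ^ 0 * c > 0 \<and> Ck_near (Suc 0) (\<lambda>x. \<phi> 0 x - c * trunc_power (Suc 0) x0 x) x0"
    if "x0 \<in> asums A (Suc 0) - asums A 0" for x0
    using that c0 Ck_near_const[of "Suc 0" 0 0] by (intro exI[of _ c0]) (auto simp: \<phi>_def)
  ultimately show ?case by blast
next
  case (Suc i)
  have regA: "Ck_near k (\<phi> i) x" if "x \<notin> exceptional i k" for k x using Suc that by blast
  have regB: "\<exists>c. (-1) ^ i * c > 0 \<and> Ck_near (Suc i) (\<lambda>x. \<phi> i x - c * trunc_power (Suc i) x0 x) x0"
    if "x0 \<in> asums A (Suc i)" "x0 \<notin> asums A i" for x0 using Suc that by blast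
  have "Ck_near k (\<phi> (Suc i)) x0" if x0: "x0 \<notin> exceptional (Suc i) k" for k x0
  proof (cases k)
    case 0 then show ?thesis using phi_continuous by (intro Ck_nearI_UNIV) simp
  next
    case k: (Suc j)
    have shift: "x0 - g \<notin> exceptional i j" if "g \<in> A" for g
    proof (cases "i < j")
      case True
      then show ?thesis using x0 k that asums_diff[of x0 A "Suc i" g] by (auto simp: exceptional_def)
    next
      case False
      then have "x0 \<notin> asums A j" using x0 k by (auto simp: exceptional_def)
      \<comment> \<open>For j = 0 natural subtraction gives \<open>asums A 0\<close>, which is
        empty.\<close>
      then have "x0 - g \<notin> asums A (j - 1)"
        using that asums_diff[of x0 A "j - 1" g] by (cases j) (auto simp del: asums.simps(2))
      then show ?thesis using False by (simp add: exceptional_def)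
    qed
    show ?thesis
    proof (cases "x0 \<in> exceptional i k")
      case False
      then show ?thesis unfolding phi_Suc k
        by (intro Ck_near_conv phi_causal phi_continuous regA) (use k shift in auto)
    next
      case True
      txt \<open>This happens only for \<open>k = i + 1\<close>, at the points where \<open>\<phi> i\<close> has its principal
        singularity, which is subtracted before applying the convolution operator.\<close>
      have ki: "j = i"
      proof (rule ccontr)
        assume "j \<noteq> i"
        then have "i < j \<or> j < i" by auto
        then show False
        proof
          assume "i < j"
          then have "x0 \<in> asums A (Suc i)" "x0 \<notin> asums A (Suc (Suc i))" using True x0 k by (auto simp: exceptional_def)
          then show False using asums_mono[OF le_SucI[OF order_refl], of A "Suc i"] by blast
        qed (use True x0 k in \<open>auto simp: exceptional_def\<close>)
      qed
      then have mem: "x0 \<in> asums A (Suc i)" "x0 \<notin> asums A i"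
        using True x0 k by (auto simp: exceptional_def simp del: asums.simps(2))
      obtain c where c: "Ck_near (Suc i) (\<lambda>x. \<phi> i x - c * trunc_power (Suc i) x0 x) x0"
        using regB[OF mem] by blast
      have x0_nn: "x0 \<ge> 0" using asums_nonneg[of A x0 "Suc i"] A_pos mem by blast
      define \<psi> where "\<psi> = (\<lambda>x. \<phi> i x - c * trunc_power (Suc i) x0 x)"
      have ct: "causal (\<lambda>x. c * trunc_power (Suc i) x0 x)" by (intro causal_cmult trunc_power_causal x0_nn)
      have \<psi>: "causal \<psi>" "continuous_on UNIV \<psi>"
        unfolding \<psi>_def using phi_continuous[of i] trunc_power_continuous[of "Suc i" x0]
        by (auto intro!: causal_diff phi_causal ct continuous_intros)
      have "Ck_near i \<psi> (x0 - g)" if "g \<in> A" for g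
      proof -
        have "Ck_near i (\<phi> i) (x0 - g)" using regA shift that ki by auto
        \<comment> \<open>The subtracted term vanishes to the left of x0, so it does not disturb the
          points x0 - g.\<close>
        moreover have "Ck_on i (\<lambda>x. c * trunc_power (Suc i) x0 x) {..<x0}"
          by (rule Ck_on_cong[OF Ck_on_const[of _ 0]]) (auto simp: trunc_power_def)
        then have "Ck_near i (\<lambda>x. c * trunc_power (Suc i) x0 x) (x0 - g)"
          by (rule Ck_nearI) (use A_pos[OF that] in auto)
        ultimately show ?thesis unfolding \<psi>_def by (rule Ck_near_diff)
      qed
      then have 1: "Ck_near (Suc i) (conv \<kappa> \<psi>) x0"
        using c by (intro Ck_near_conv \<psi>) (auto simp: \<psi>_def)
      \<comment> \<open>The truncated power itself is only of class C^i; the convolution supplies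
        the missing order.\<close>
      have 2: "Ck_near (Suc i) (\<lambda>x. c * conv \<kappa> (trunc_power (Suc i) x0) x) x0"
        by (intro Ck_near_cmult Ck_nearI_UNIV Ck_on_conv_trunc_power kernel x0_nn)
      have "conv \<kappa> (\<phi> i) x = conv \<kappa> \<psi> x + c * conv \<kappa> (trunc_power (Suc i) x0) x" for x
        using conv_diff[OF kernel phi_causal ct, of i x] by (simp add: conv_cmult \<psi>_def)
      then have "\<phi> (Suc i) = (\<lambda>x. conv \<kappa> \<psi> x + c * conv \<kappa> (trunc_power (Suc i) x0) x)"
        by (auto simp: phi_Suc)
      then show ?thesis using Ck_near_add[OF 1 2] k ki by simp
    qed
  qed
  moreover have "\<exists>c. (-1) ^ Suc i * c > 0 \<and> Ck_near (Suc (Suc i)) (\<lambda>x. \<phi> (Suc i) x - c * trunc_power (Suc (Suc i)) x0 x) x0"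
    if x0: "x0 \<in> asums A (Suc (Suc i)) - asums A (Suc i)" for x0
  proof -
    \<comment> \<open>Since x0 is not a sum of at most i atoms, \<open>\<phi> i\<close> has full
      regularity there, and \<open>conv_local\<close> leaves only the atom terms to be
      examined.\<close>
    have "Ck_near (Suc (Suc i)) (\<phi> i) x0" by (rule regA) (use x0 in \<open>auto simp: exceptional_def\<close>)
    then obtain \<epsilon>0 where \<epsilon>0: "\<epsilon>0 > 0" "\<And>\<epsilon>. 0 < \<epsilon> \<Longrightarrow> \<epsilon> < \<epsilon>0 \<Longrightarrow>
      Ck_near (Suc (Suc i)) (\<lambda>x. conv \<kappa> (\<phi> i) x + (\<Sum>g\<in>A \<inter> {\<epsilon>..\<bar>x0\<bar> + 1}. a g * antideriv (\<phi> i) (x - g))) x0"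
      using conv_local[OF phi_causal phi_continuous] by blast
    obtain g0 where g0: "g0 \<in> A" "x0 - g0 \<in> asums A (Suc i)" using asums_split x0 by blast
    \<comment> \<open>The bound by g0 keeps this atom in the finite sum F, which guarantees a
      nonzero contribution to the singular coefficient.\<close>
    define \<epsilon> where "\<epsilon> = min (\<epsilon>0 / 2) g0"
    have \<epsilon>: "0 < \<epsilon>" "\<epsilon> < \<epsilon>0" "\<epsilon> \<le> g0" using \<epsilon>0 A_pos[OF g0(1)] by (auto simp: \<epsilon>_def)
    define F where "F = A \<inter> {\<epsilon>..\<bar>x0\<bar> + 1}"
    have F: "finite F" unfolding F_def using A_finite[OF \<epsilon>(1)] .
    have g0F: "g0 \<in> F"
      using g0 \<epsilon> asums_nonneg[of A "x0 - g0" "Suc i"] A_pos by (auto simp: F_def)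
    have "\<exists>c. (x0 - g \<in> asums A (Suc i) \<longrightarrow> (-1) ^ i * c > 0) \<and> (x0 - g \<notin> asums A (Suc i) \<longrightarrow> c = 0) \<and>
        Ck_near (Suc (Suc i)) (\<lambda>x. antideriv (\<phi> i) (x - g) - c * trunc_power (Suc (Suc i)) x0 x) x0" if "g \<in> F" for g
    proof (cases "x0 - g \<in> asums A (Suc i)")
      case False
      have "Ck_near (Suc i) (\<phi> i) (x0 - g)" by (rule regA) (use False in \<open>auto simp: exceptional_def\<close>)
      then have "Ck_near (Suc (Suc i)) (\<lambda>x. antideriv (\<phi> i) (x - g)) x0"
        by (intro Ck_near_antideriv_shift phi_causal phi_continuous)
      then show ?thesis using False by (intro exI[of _ 0]) simp
    next
      case True
      have gA: "g \<in> A" using that by (simp add: F_def)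
      have "x0 - g \<notin> asums A i" using asums_diff[of x0 A i g] x0 gA by blast
      then obtain c where c: "(-1) ^ i * c > 0" "Ck_near (Suc i) (\<lambda>x. \<phi> i x - c * trunc_power (Suc i) (x0 - g) x) (x0 - g)"
        using regB[OF True] by blast
      have nn: "x0 - g \<ge> 0" using asums_nonneg[of A _ "Suc i"] A_pos True by blast
      have ct: "causal (\<lambda>x. c * trunc_power (Suc i) (x0 - g) x)" by (intro causal_cmult trunc_power_causal nn)
      have \<psi>: "causal (\<lambda>x. \<phi> i x - c * trunc_power (Suc i) (x0 - g) x)" "continuous_on UNIV (\<lambda>x. \<phi> i x - c * trunc_power (Suc i) (x0 - g) x)"
        using phi_continuous[of i] trunc_power_continuous[of "Suc i" "x0 - g"]
        by (auto intro!: causal_diff phi_causal ct continuous_intros)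
      \<comment> \<open>Integration raises the degree and divides by i + 2, so the coefficient keeps
        its sign; translation by g then moves the knot from x0 - g to x0.\<close>
      have at: "trunc_power (Suc (Suc i)) (x0 - g) x / real (i + 2) = antideriv (trunc_power (Suc i) (x0 - g)) x" for x
      proof (rule antideriv_unique[OF trunc_power_causal[OF nn] trunc_power_continuous])
        show "((\<lambda>x. trunc_power (Suc (Suc i)) (x0 - g) x / real (i + 2)) has_real_derivative trunc_power (Suc i) (x0 - g) x) (at x)" for x
          using DERIV_cdivide[OF trunc_power_has_derivative[of i "x0 - g" x], of "real (i + 2)"] by simp
        show "trunc_power (Suc (Suc i)) (x0 - g) 0 / real (i + 2) = 0" using nn by (simp add: trunc_power_def)
      qed
      have "Ck_near (Suc (Suc i)) (\<lambda>x. antideriv (\<lambda>x. \<phi> i x - c * trunc_power (Suc i) (x0 - g) x) (x - g)) x0"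
        by (intro Ck_near_antideriv_shift \<psi> c(2))
      also have "(\<lambda>x. antideriv (\<lambda>x. \<phi> i x - c * trunc_power (Suc i) (x0 - g) x) (x - g))
         = (\<lambda>x. antideriv (\<phi> i) (x - g) - c / real (i + 2) * trunc_power (Suc (Suc i)) x0 x)"
        by (simp add: conv_diff[OF kernel_indicator phi_causal ct] conv_cmult flip: at)
          (simp add: trunc_power_def algebra_simps)
      finally show ?thesis using True c(1)
        by (intro exI[of _ "c / real (i + 2)"]) (auto simp: zero_less_mult_iff zero_less_divide_iff)
    qed
    then obtain C where C: "\<And>g. g \<in> F \<Longrightarrow> x0 - g \<in> asums A (Suc i) \<Longrightarrow> (-1) ^ i * C g > 0"
      "\<And>g. g \<in> F \<Longrightarrow> x0 - g \<notin> asums A (Suc i) \<Longrightarrow> C g = 0"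
      "\<And>g. g \<in> F \<Longrightarrow> Ck_near (Suc (Suc i)) (\<lambda>x. antideriv (\<phi> i) (x - g) - C g * trunc_power (Suc (Suc i)) x0 x) x0"
      by metis
    \<comment> \<open>The minus sign of the steps turns the sign (-1)^i into (-1)^(i+1). All
      contributing atoms then carry the same sign, so they cannot cancel, and g0 contributes
      strictly.\<close>
    define c where "c = - (\<Sum>g\<in>F. a g * C g)"
    have "(-1) ^ Suc i * c = (\<Sum>g\<in>F. a g * ((-1) ^ i * C g))"
      by (simp add: c_def sum_distrib_left sum_negf mult_ac)
    also have "\<dots> > 0"
    proof (rule sum_pos2[OF F g0F])
      show "a g0 * ((-1) ^ i * C g0) > 0" using C(1)[OF g0F g0(2)] a_pos[OF g0(1)] by simp
      show "a g * ((-1) ^ i * C g) \<ge> 0" if "g \<in> F" for g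
        using C(1,2)[OF that] a_pos[of g] that by (cases "x0 - g \<in> asums A (Suc i)") (auto simp: F_def)
    qed
    finally have pos: "(-1) ^ Suc i * c > 0" .
    have "Ck_near (Suc (Suc i)) (\<lambda>x. (\<phi> (Suc i) x + (\<Sum>g\<in>F. a g * antideriv (\<phi> i) (x - g)))
        - (\<Sum>g\<in>F. a g * (antideriv (\<phi> i) (x - g) - C g * trunc_power (Suc (Suc i)) x0 x))) x0"
      using \<epsilon>0(2)[OF \<epsilon>(1,2)] by (intro Ck_near_diff Ck_near_sum Ck_near_cmult C) (simp_all add: phi_Suc F_def)
    also have "(\<lambda>x. (\<phi> (Suc i) x + (\<Sum>g\<in>F. a g * antideriv (\<phi> i) (x - g)))
        - (\<Sum>g\<in>F. a g * (antideriv (\<phi> i) (x - g) - C g * trunc_power (Suc (Suc i)) x0 x)))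
      = (\<lambda>x. \<phi> (Suc i) x - c * trunc_power (Suc (Suc i)) x0 x)"
      by (simp add: c_def right_diff_distrib sum_subtractf sum_distrib_right mult.assoc)
    finally show ?thesis using pos by blast
  qed
  ultimately show ?case by blast
qed

section \<open>Transfer to a solution of the renewal equation\<close>

context
  fixes U :: "real \<Rightarrow> real"
  assumes U: "causal U" and renewal: "\<And>x. U x = c0 * trunc_power 1 0 x - conv \<kappa> U x"
    and smoothing: "\<And>k. \<exists>n0. \<forall>n\<ge>n0. Ck_on k ((conv \<kappa> ^^ n) U) UNIV"
begin

lemma renewal_expansion: "U x = (\<Sum>i<n. (-1) ^ i * \<phi> i x) + (-1) ^ n * (conv \<kappa> ^^ n) U x"
proof (induction n)
  case (Suc n)
  have "(conv \<kappa> ^^ n) U = (conv \<kappa> ^^ n) (\<lambda>x. c0 * trunc_power 1 0 x - conv \<kappa> U x)"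
    by (rule arg_cong[OF ext[OF renewal]])
  also have "\<dots> = (\<lambda>x. \<phi> n x - (conv \<kappa> ^^ n) (conv \<kappa> U) x)"
    unfolding \<phi>_def using trunc_power_causal[of 0 0]
    by (intro funpow_conv_diff kernel causal_cmult conv_causal U) simp_all
  also have "(conv \<kappa> ^^ n) (conv \<kappa> U) = (conv \<kappa> ^^ Suc n) U" by (simp add: funpow_swap1)
  finally have "(conv \<kappa> ^^ n) U x = \<phi> n x - (conv \<kappa> ^^ Suc n) U x" by (rule fun_cong)
  with Suc show ?case by (simp add: algebra_simps)
qed simp

lemma Ck_near_renewal: "x0 \<notin> asums A (Suc k) \<Longrightarrow> Ck_near (Suc k) U x0"
proof -
  assume x0: "x0 \<notin> asums A (Suc k)"
  obtain n where n: "Ck_on (Suc k) ((conv \<kappa> ^^ n) U) UNIV" using smoothing by blast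
  have "Ck_near (Suc k) (\<phi> i) x0" for i
  proof -
    have "x0 \<notin> exceptional i (Suc k)"
      using x0 asums_mono[of "Suc i" "Suc k" A] asums_mono[of k "Suc k" A]
      by (auto simp: exceptional_def simp del: asums.simps)
    then show ?thesis using phi_regularity by blast
  qed
  then have "Ck_near (Suc k) (\<lambda>x. (\<Sum>i<n. (-1) ^ i * \<phi> i x) + (-1) ^ n * (conv \<kappa> ^^ n) U x) x0"
    by (intro Ck_near_add Ck_near_sum Ck_near_cmult Ck_nearI_UNIV[OF n])
  then show ?thesis by (simp flip: renewal_expansion)
qed

text \<open>Of the whole expansion only the k-th term fails to be of class C^(k+1) at x0: for
  earlier terms x0 needs too many atoms, later terms have gained an order by further convolution,
  and the remainder is covered by \<open>smoothing\<close>.\<close>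

lemma not_times_differentiable_renewal:
  assumes x0: "x0 \<in> asums A (Suc k)" "x0 \<notin> asums A k"
  shows "\<not> times_differentiable_at (Suc k) U x0"
proof -
  obtain n0 where n0: "\<And>n. n \<ge> n0 \<Longrightarrow> Ck_on (Suc k) ((conv \<kappa> ^^ n) U) UNIV" using smoothing by blast
  \<comment> \<open>n has to exceed k so that \<open>\<phi> k\<close> occurs among the
    summands.\<close>
  define n where "n = max n0 (Suc k)"
  obtain c where c: "(-1) ^ k * c > 0" "Ck_near (Suc k) (\<lambda>x. \<phi> k x - c * trunc_power (Suc k) x0 x) x0"
    using phi_regularity[of k] x0 by blast
  have *: "Ck_near (Suc k) (\<phi> i) x0" if "i \<noteq> k" for i
  proof -
    have "x0 \<notin> exceptional i (Suc k)"
      using x0 asums_mono[of "Suc i" k A] that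
      by (auto simp: exceptional_def simp del: asums.simps)
    then show ?thesis using phi_regularity by blast
  qed
  define \<psi> where "\<psi> = (\<lambda>x. (\<Sum>i\<in>{..<n} - {k}. (-1) ^ i * \<phi> i x) + (-1) ^ n * (conv \<kappa> ^^ n) U x
    + (-1) ^ k * (\<phi> k x - c * trunc_power (Suc k) x0 x))"
  have "Ck_near (Suc k) \<psi> x0"
    unfolding \<psi>_def
    by (intro Ck_near_add Ck_near_sum Ck_near_cmult Ck_nearI_UNIV[OF n0] c(2) *) (auto simp: n_def)
  then obtain r where r: "r > 0" "Ck_on (Suc k) \<psi> {x0 - r<..<x0 + r}" unfolding Ck_near_def by blast
  have "U x = \<psi> x + ((-1) ^ k * c) * trunc_power (Suc k) x0 x" for x
  proof -
    have "(\<Sum>i<n. (-1) ^ i * \<phi> i x) = (-1) ^ k * \<phi> k x + (\<Sum>i\<in>{..<n} - {k}. (-1) ^ i * \<phi> i x)"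
      by (rule sum.remove) (auto simp: n_def)
    then show ?thesis using renewal_expansion[of x n] by (simp add: \<psi>_def algebra_simps)
  qed
  then show ?thesis
    by (intro not_times_differentiable_at_trunc_power[OF r(2), of x0 "(-1) ^ k * c"]) (use c r in auto)
qed

end

end

end

section \<open>Levy kernels and smoothing\<close>

locale levy_kernel =
  fixes \<Lambda> :: "real measure" and q \<delta> :: real
  assumes levy: "levy_measure \<Lambda>" and q_nonneg: "q \<ge> 0" and \<delta>_pos: "\<delta> > 0"
begin

lemma sets_levy[measurable_cong, simp]: "sets \<Lambda> = sets borel"
  using levy by (simp add: levy_measure_def)

lemma space_levy[simp]: "space \<Lambda> = UNIV"
  using sets_eq_imp_space_eq[OF sets_levy] by simp

lemma AE_levy_pos: "AE z in \<Lambda>. z > 0"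
proof -
  have "{..0} \<in> null_sets \<Lambda>" using levy by (auto simp: levy_measure_def null_sets_def)
  then show ?thesis by (rule AE_I') auto
qed

lemma nn_integral_min_levy: "(\<integral>\<^sup>+ z. ennreal (min 1 z) \<partial>\<Lambda>) < \<infinity>"
  using levy by (simp add: levy_measure_def)

lemma emeasure_tail_finite:
  assumes "y > 0" shows "emeasure \<Lambda> {y..} < \<infinity>"
proof -
  have "ennreal (min 1 y) * emeasure \<Lambda> {y..} = (\<integral>\<^sup>+ z. ennreal (min 1 y) * indicator {y..} z \<partial>\<Lambda>)"
    by (simp add: nn_integral_cmult_indicator)
  also have "\<dots> \<le> (\<integral>\<^sup>+ z. ennreal (min 1 z) \<partial>\<Lambda>)"
    by (intro nn_integral_mono) (auto simp: indicator_def intro!: ennreal_leI)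
  also have "\<dots> < \<infinity>" by (rule nn_integral_min_levy)
  finally show ?thesis using assms by (auto simp: ennreal_mult_less_top)
qed

lemma emeasure_tail: "y > 0 \<Longrightarrow> emeasure \<Lambda> {y..} = ennreal (tail \<Lambda> y)"
  using emeasure_tail_finite[of y] by (simp add: tail_def emeasure_eq_ennreal_measure less_top)

lemma tail_nonneg: "tail \<Lambda> y \<ge> 0" by (simp add: tail_def)

lemma sigma_finite_levy: "sigma_finite_measure \<Lambda>"
proof (rule sigma_finite_measure.intro)
  show "\<exists>A. countable A \<and> A \<subseteq> sets \<Lambda> \<and> \<Union>A = space \<Lambda> \<and> (\<forall>a\<in>A. emeasure \<Lambda> a \<noteq> \<infinity>)"
  proof (intro exI conjI ballI)
    let ?A = "insert {..0} (range (\<lambda>n::nat. {1 / real (Suc n)..}))"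
    show "countable ?A" by simp
    show "?A \<subseteq> sets \<Lambda>" by auto
    have "x \<in> \<Union>?A" for x :: real
    proof (cases "x \<le> 0")
      case False
      then obtain n where "1 / real (Suc n) < x" by (metis nat_approx_posE not_le)
      then show ?thesis by (auto intro!: exI[of _ n])
    qed auto
    then show "\<Union>?A = space \<Lambda>" by auto
    fix a assume "a \<in> ?A"
    then show "emeasure \<Lambda> a \<noteq> \<infinity>"
      using emeasure_tail_finite[of "1 / real (Suc n)" for n] levy by (auto simp: levy_measure_def less_top)
  qed
qed

sublocale sigma_finite_measure \<Lambda> by (rule sigma_finite_levy)

sublocale pair_levy: pair_sigma_finite lborel \<Lambda> ..

definition \<kappa> :: "real \<Rightarrow> real" where
  "\<kappa> y = (if y > 0 then (q + tail \<Lambda> y) / \<delta> else 0)"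

lemma tail_eq_LINT:
  assumes "y > 0"
  shows "integrable \<Lambda> (\<lambda>z. indicator {0<..z} y :: real)" "tail \<Lambda> y = (LINT z|\<Lambda>. indicator {0<..z} y)"
proof -
  have eq: "(\<lambda>z. indicator {0<..z} y :: real) = indicator {y..}"
    using assms by (auto simp: indicator_def fun_eq_iff)
  show "integrable \<Lambda> (\<lambda>z. indicator {0<..z} y :: real)" "tail \<Lambda> y = (LINT z|\<Lambda>. indicator {0<..z} y)"
    unfolding eq using emeasure_tail_finite[OF assms] by (simp_all add: tail_def)
qed

lemma measurable_tail[measurable]: "tail \<Lambda> \<in> borel_measurable borel"
proof -
  have "{p \<in> space (borel \<Otimes>\<^sub>M borel). fst p \<le> snd p} \<in> sets (borel \<Otimes>\<^sub>M borel :: (real \<times> real) measure)"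
    by measurable
  then have "{(y, z). y \<le> z} \<in> sets (borel \<Otimes>\<^sub>M \<Lambda>)"
    by (simp add: space_pair_measure case_prod_unfold cong: sets_pair_measure_cong)
  then have "(\<lambda>y. emeasure \<Lambda> (Pair y -` {(y, z). y \<le> z})) \<in> borel_measurable (borel :: real measure)"
    by (rule measurable_emeasure_Pair)
  then have "(\<lambda>y. enn2real (emeasure \<Lambda> (Pair y -` {(y, z). y \<le> z}))) \<in> borel_measurable (borel :: real measure)"
    by measurable
  also have "(\<lambda>y. enn2real (emeasure \<Lambda> (Pair y -` {(y, z). y \<le> z}))) = tail \<Lambda>"
    by (auto simp: tail_def measure_def fun_eq_iff vimage_def atLeast_def)
  finally show ?thesis .
qed

lemma measurable_kappa[measurable]: "\<kappa> \<in> borel_measurable borel"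
  unfolding \<kappa>_def by measurable

lemma kappa_nonneg: "\<kappa> y \<ge> 0"
  using q_nonneg \<delta>_pos tail_nonneg by (simp add: \<kappa>_def)

text \<open>Tonelli applied to the tail, seen as the \<Lambda>-mass of the z with z \<ge> y. An
  integral against the tail becomes a \<Lambda>-integral of primitives of f.\<close>

lemma nn_integral_tail:
  assumes [measurable]: "f \<in> borel_measurable borel"
  shows "(\<integral>\<^sup>+ y. indicator {0<..} y * ennreal (tail \<Lambda> y) * f y \<partial>lborel)
    = (\<integral>\<^sup>+ z. (\<integral>\<^sup>+ y. indicator {0<..z} y * f y \<partial>lborel) \<partial>\<Lambda>)"
proof -
  have "indicator {0<..} y * ennreal (tail \<Lambda> y) * f y = (\<integral>\<^sup>+ z. indicator {0<..z} y * f y \<partial>\<Lambda>)" for y :: real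
  proof (cases "y > 0")
    case True
    then have eq: "(\<lambda>z. indicator {0<..z} y * f y) = (\<lambda>z. indicator {y..} z * f y)"
      by (auto simp: indicator_def fun_eq_iff)
    show ?thesis unfolding eq using True by (simp add: nn_integral_multc emeasure_tail)
  qed (auto simp: indicator_def)
  then have "(\<integral>\<^sup>+ y. indicator {0<..} y * ennreal (tail \<Lambda> y) * f y \<partial>lborel)
     = (\<integral>\<^sup>+ y. (\<integral>\<^sup>+ z. indicator {0<..z} y * f y \<partial>\<Lambda>) \<partial>lborel)" by simp
  also have "\<dots> = (\<integral>\<^sup>+ z. (\<integral>\<^sup>+ y. indicator {0<..z} y * f y \<partial>lborel) \<partial>\<Lambda>)"
    by (rule pair_levy.Fubini'[symmetric]) (simp add: indicator_def)
  finally show ?thesis .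
qed

text \<open>For K \<ge> 0 the integral of the tail over (0, K] is the \<Lambda>-integral of min z K,
  which is finite by the defining condition of a Levy measure.\<close>

lemma kernel_kappa: "kernel \<kappa>"
  unfolding kernel_def
proof (intro conjI allI impI)
  fix K :: real
  have "(\<integral>\<^sup>+ y. indicator {0<..} y * ennreal (tail \<Lambda> y) * indicator {..K} y \<partial>lborel)
     = (\<integral>\<^sup>+ z. (\<integral>\<^sup>+ y. indicator {0<..z} y * indicator {..K} y \<partial>lborel) \<partial>\<Lambda>)"
    by (rule nn_integral_tail) simp
  also have "\<dots> = (\<integral>\<^sup>+ z. ennreal (min z (max 0 K)) \<partial>\<Lambda>)"
  proof (intro nn_integral_cong_AE, use AE_levy_pos in eventually_elim)
    case (elim z)
    have "(\<lambda>y. indicator {0<..z} y * indicator {..K} y :: ennreal) = indicator {0<..min z K}"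
      by (auto simp: indicator_def fun_eq_iff)
    then have "(\<integral>\<^sup>+ y. indicator {0<..z} y * indicator {..K} y \<partial>lborel) = emeasure lborel {0<..min z K}"
      by simp
    also have "\<dots> = ennreal (min z (max 0 K))"
      using elim by (cases "K \<ge> 0") (auto simp: min_def max_def)
    finally show ?case .
  qed
  also have "\<dots> \<le> (\<integral>\<^sup>+ z. ennreal (max 1 K) * ennreal (min 1 z) \<partial>\<Lambda>)"
  proof (intro nn_integral_mono_AE, use AE_levy_pos in eventually_elim)
    case (elim z)
    have "min z (max 0 K) \<le> max 1 K * min 1 z"
    proof (cases "z \<le> 1")
      case True
      have "1 * z \<le> max 1 K * z" using elim by (intro mult_right_mono) auto
      then show ?thesis using True by auto
    qed auto
    then show ?case using elim by (simp add: ennreal_leI flip: ennreal_mult)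
  qed
  also have "\<dots> = ennreal (max 1 K) * (\<integral>\<^sup>+ z. ennreal (min 1 z) \<partial>\<Lambda>)"
    by (intro nn_integral_cmult) simp
  also have "\<dots> < \<infinity>" using nn_integral_min_levy by (auto simp: ennreal_mult_less_top)
  finally have fin: "(\<integral>\<^sup>+ y. indicator {0<..} y * ennreal (tail \<Lambda> y) * indicator {..K} y \<partial>lborel) < \<infinity>" .
  have "integrable lborel (\<lambda>y. indicator {0<..} y * tail \<Lambda> y * indicator {..K} y)"
  proof (rule integrableI_nonneg)
    have "(\<lambda>y. ennreal (indicator {0<..} y * tail \<Lambda> y * indicator {..K} y))
       = (\<lambda>y. indicator {0<..} y * ennreal (tail \<Lambda> y) * indicator {..K} y)"
      by (auto simp: indicator_def fun_eq_iff)
    then show "(\<integral>\<^sup>+ y. ennreal (indicator {0<..} y * tail \<Lambda> y * indicator {..K} y) \<partial>lborel) < \<infinity>"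
      using fin by simp
  qed (auto simp: tail_nonneg)
  then have "integrable lborel (\<lambda>y. (q / \<delta>) * (indicator {..K} y * indicator {0<..} y)
      + (1 / \<delta>) * (indicator {0<..} y * tail \<Lambda> y * indicator {..K} y))"
    using kernel_indicator unfolding kernel_def
    by (intro Bochner_Integration.integrable_add integrable_mult_right) auto
  also have "(\<lambda>y. (q / \<delta>) * (indicator {..K} y * indicator {0<..} y)
      + (1 / \<delta>) * (indicator {0<..} y * tail \<Lambda> y * indicator {..K} y)) = (\<lambda>y. indicator {..K} y * \<kappa> y)"
    by (auto simp: \<kappa>_def indicator_def fun_eq_iff add_divide_distrib)
  finally show "integrable lborel (\<lambda>y. indicator {..K} y * \<kappa> y)" .
qed (auto simp: \<kappa>_def)

lemma antideriv_integrable: "causal \<phi> \<Longrightarrow> integrable lborel (\<lambda>y. indicator {..<x} y * \<phi> y)"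
proof -
  assume \<phi>: "causal \<phi>"
  have "integrable lborel (\<lambda>y. indicator {0<..} y * \<phi> (x - y))"
    by (rule conv_integrable[OF kernel_indicator \<phi>])
  then have "integrable lborel (\<lambda>y. indicator {0<..} (x + (-1) * y) * \<phi> (x - (x + (-1) * y)))"
    by (rule lborel_integrable_real_affine) simp
  also have "(\<lambda>y. indicator {0<..} (x + (-1) * y) * \<phi> (x - (x + (-1) * y))) = (\<lambda>y. indicator {..<x} y * \<phi> y)"
    by (auto simp: indicator_def fun_eq_iff)
  finally show ?thesis .
qed

text \<open>The mixed second difference is the integral of the increment \<phi> (y + h) - \<phi> y
  over an interval of length k. One step thus contributes its length and the other the modulus of
  continuity of \<phi>.\<close>

lemma antideriv_increment:
  assumes "causal \<phi>" "k \<ge> 0" "\<And>u. u \<le> x \<Longrightarrow> \<bar>\<phi> (u + h) - \<phi> u\<bar> \<le> E"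
  shows "\<bar>antideriv \<phi> (x + h) - antideriv \<phi> x - (antideriv \<phi> (x + h - k) - antideriv \<phi> (x - k))\<bar> \<le> E * k"
proof -
  note [measurable] = causal_measurable[OF assms(1)]
  have sh: "antideriv \<phi> (u + h) = (LBINT y. indicator {..<u} y * \<phi> (y + h))"
    "integrable lborel (\<lambda>y. indicator {..<u} y * \<phi> (y + h))" for u
  proof -
    have eq: "(\<lambda>y. indicator {..<u + h} (h + 1 * y) * \<phi> (h + 1 * y)) = (\<lambda>y. indicator {..<u} y * \<phi> (y + h))"
      by (auto simp: indicator_def fun_eq_iff add.commute)
    show "antideriv \<phi> (u + h) = (LBINT y. indicator {..<u} y * \<phi> (y + h))"
      unfolding antideriv_eq by (subst lborel_integral_real_affine[of 1 _ h]) (simp_all only: eq, simp_all)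
    show "integrable lborel (\<lambda>y. indicator {..<u} y * \<phi> (y + h))"
      using lborel_integrable_real_affine[OF antideriv_integrable[OF assms(1), of "u + h"], of 1 h] unfolding eq by simp
  qed
  have 1: "antideriv \<phi> (x + h) - antideriv \<phi> x - (antideriv \<phi> (x - k + h) - antideriv \<phi> (x - k))
     = (LBINT y. (indicator {..<x} y * \<phi> (y + h) - indicator {..<x} y * \<phi> y)
       - (indicator {..<x - k} y * \<phi> (y + h) - indicator {..<x - k} y * \<phi> y))"
    unfolding sh(1) antideriv_eq[of \<phi> x] antideriv_eq[of \<phi> "x - k"]
    using sh(2) antideriv_integrable[OF assms(1)] by simp
  have 2: "\<bar>LBINT y. (indicator {..<x} y * \<phi> (y + h) - indicator {..<x} y * \<phi> y)
       - (indicator {..<x - k} y * \<phi> (y + h) - indicator {..<x - k} y * \<phi> y)\<bar> \<le> (LBINT y. indicator {x - k..<x} y * E)"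
  proof (rule order_trans[OF integral_abs_bound integral_mono])
    show "integrable lborel (\<lambda>y. indicator {x - k..<x} y * E)"
      using assms(2) by (intro integrable_mult_left) (simp add: integrable_indicator_iff)
    fix y
    show "\<bar>indicator {..<x} y * \<phi> (y + h) - indicator {..<x} y * \<phi> y
       - (indicator {..<x - k} y * \<phi> (y + h) - indicator {..<x - k} y * \<phi> y)\<bar> \<le> indicator {x - k..<x} y * E"
      using assms(2) assms(3)[of y] by (auto simp: indicator_def)
  qed (use sh(2) antideriv_integrable[OF assms(1)] in \<open>simp\<close>)
  have 3: "(LBINT y. indicator {x - k..<x} y * E) = E * k" using assms(2) by simp
  from 2 have "\<bar>antideriv \<phi> (x + h) - antideriv \<phi> x - (antideriv \<phi> (x - k + h) - antideriv \<phi> (x - k))\<bar> \<le> E * k" unfolding 1 3 .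
  moreover have "x - k + h = x + h - k" by simp
  ultimately show ?thesis by (simp only:)
qed

lemma antideriv_Lipschitz:
  assumes "causal \<phi>" "k \<ge> 0" "\<And>u. u \<le> x \<Longrightarrow> \<bar>\<phi> u\<bar> \<le> B"
  shows "\<bar>antideriv \<phi> x - antideriv \<phi> (x - k)\<bar> \<le> B * k"
proof -
  have 1: "antideriv \<phi> x - antideriv \<phi> (x - k) = (LBINT y. indicator {..<x} y * \<phi> y - indicator {..<x - k} y * \<phi> y)"
    unfolding antideriv_eq[of \<phi> x] antideriv_eq[of \<phi> "x - k"] using antideriv_integrable[OF assms(1)] by simp
  have 2: "\<bar>LBINT y. indicator {..<x} y * \<phi> y - indicator {..<x - k} y * \<phi> y\<bar> \<le> (LBINT y. indicator {x - k..<x} y * B)"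
  proof (rule order_trans[OF integral_abs_bound integral_mono])
    show "integrable lborel (\<lambda>y. indicator {x - k..<x} y * B)"
      using assms(2) by (intro integrable_mult_left) (simp add: integrable_indicator_iff)
    fix y show "\<bar>indicator {..<x} y * \<phi> y - indicator {..<x - k} y * \<phi> y\<bar> \<le> indicator {x - k..<x} y * B"
      using assms(2) assms(3)[of y] by (auto simp: indicator_def)
  qed (use antideriv_integrable[OF assms(1)] in simp)
  have 3: "(LBINT y. indicator {x - k..<x} y * B) = B * k" using assms(2) by simp
  from 2 show ?thesis unfolding 1 3 .
qed

lemma integrable_min_levy: "integrable \<Lambda> (\<lambda>z. indicator {0<..} z * min 1 z)"
proof (rule integrableI_nonneg)
  have "(\<integral>\<^sup>+ z. ennreal (indicator {0<..} z * min 1 z) \<partial>\<Lambda>) \<le> (\<integral>\<^sup>+ z. ennreal (min 1 z) \<partial>\<Lambda>)"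
    by (intro nn_integral_mono) (auto simp: indicator_def)
  then show "(\<integral>\<^sup>+ z. ennreal (indicator {0<..} z * min 1 z) \<partial>\<Lambda>) < \<infinity>"
    using nn_integral_min_levy by (rule le_less_trans)
qed (auto simp: indicator_def)

text \<open>For z \<le> 1 the primitive is Lipschitz, and for larger z it is bounded, so the
  difference is at most a multiple of min 1 z.\<close>

lemma antideriv_difference_integrable:
  assumes "causal \<phi>"
  shows "integrable \<Lambda> (\<lambda>z. indicator {0<..} z * (antideriv \<phi> x - antideriv \<phi> (x - z)))"
proof -
  have cJ: "causal (antideriv \<phi>)" by (rule conv_causal[OF kernel_indicator assms])
  note [measurable] = causal_measurable[OF cJ]
  obtain B where B: "B \<ge> 0" "\<And>u. u \<le> x \<Longrightarrow> \<bar>\<phi> u\<bar> \<le> B" using causal_bound[OF assms] by metis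
  obtain D where D: "D \<ge> 0" "\<And>u. u \<le> x \<Longrightarrow> \<bar>antideriv \<phi> u\<bar> \<le> D" using causal_bound[OF cJ] by metis
  have "\<bar>antideriv \<phi> x - antideriv \<phi> (x - z)\<bar> \<le> (B + 2 * D) * min 1 z" if "z > 0" for z
  proof (cases "z \<le> 1")
    case True
    have "\<bar>antideriv \<phi> x - antideriv \<phi> (x - z)\<bar> \<le> B * z"
      using that by (intro antideriv_Lipschitz[OF assms _ B(2)]) auto
    also have "\<dots> \<le> (B + 2 * D) * z" using that D by (intro mult_right_mono) auto
    finally show ?thesis using True by simp
  next
    case False
    then show ?thesis using D(2)[of x] D(2)[of "x - z"] B(1) by simp
  qed
  then show ?thesis
    by (intro Bochner_Integration.integrable_bound[OF integrable_mult_right[OF integrable_min_levy, of "B + 2 * D"]])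
      (use B D in \<open>auto intro!: AE_I2 simp: indicator_def\<close>)
qed

text \<open>Fubini replaces the tail by \<Lambda> itself, acting on differences of the primitive of
  \<phi>. In this form moments of \<Lambda> of order \<gamma> can be used.\<close>

lemma conv_kappa_eq:
  assumes "causal \<phi>"
  shows "conv \<kappa> \<phi> x = (q * antideriv \<phi> x
    + (LINT z|\<Lambda>. indicator {0<..} z * (antideriv \<phi> x - antideriv \<phi> (x - z)))) / \<delta>"
proof -
  note [measurable] = causal_measurable[OF assms]
  obtain B where B: "B \<ge> 0" "\<And>u. u \<le> x \<Longrightarrow> \<bar>\<phi> u\<bar> \<le> B" using causal_bound[OF assms] by metis
  define f where "f = (\<lambda>y z. indicator {0<..z} y * \<phi> (x - y))"
  have [measurable]: "(\<lambda>(y, z). f y z) \<in> borel_measurable (lborel \<Otimes>\<^sub>M \<Lambda>)"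
    by (simp add: f_def indicator_def)
  have inner: "(LINT z|\<Lambda>. f y z) = indicator {0<..} y * tail \<Lambda> y * \<phi> (x - y)"
    "integrable \<Lambda> (f y)"
    "(LINT z|\<Lambda>. norm (f y z)) = indicator {0<..} y * tail \<Lambda> y * \<bar>\<phi> (x - y)\<bar>" for y
  proof -
    have "(LINT z|\<Lambda>. indicator {0<..z} y * c) = indicator {0<..} y * tail \<Lambda> y * c
        \<and> integrable \<Lambda> (\<lambda>z. indicator {0<..z} y * c)" for c :: real
      using tail_eq_LINT[of y] by (cases "y > 0") auto
    then show "(LINT z|\<Lambda>. f y z) = indicator {0<..} y * tail \<Lambda> y * \<phi> (x - y)"
      "integrable \<Lambda> (f y)"
      "(LINT z|\<Lambda>. norm (f y z)) = indicator {0<..} y * tail \<Lambda> y * \<bar>\<phi> (x - y)\<bar>"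
      by (simp_all add: f_def abs_mult)
  qed
  \<comment> \<open>Integrability against the tail is recovered from that against \<kappa> by
    removing the constant part q.\<close>
  have kt: "indicator {0<..} y * tail \<Lambda> y = \<delta> * \<kappa> y - q * indicator {0<..} y" for y
    using \<delta>_pos by (auto simp: \<kappa>_def indicator_def)
  have int_tail: "integrable lborel (\<lambda>y. indicator {0<..} y * tail \<Lambda> y * \<phi> (x - y))"
    unfolding kt left_diff_distrib mult.assoc
    using conv_integrable[OF kernel_kappa assms] conv_integrable[OF kernel_indicator assms] by simp
  have int: "integrable (lborel \<Otimes>\<^sub>M \<Lambda>) (\<lambda>(y, z). f y z)"
  proof (rule pair_levy.Fubini_integrable)
    have "integrable lborel (\<lambda>y. \<bar>indicator {0<..} y * tail \<Lambda> y * \<phi> (x - y)\<bar>)" using int_tail by simp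
    then show "integrable lborel (\<lambda>y. LINT z|\<Lambda>. norm (case (y, z) of (y, z) \<Rightarrow> f y z))"
      unfolding prod.case inner(3) by (simp add: abs_mult tail_nonneg)
  qed (use inner(2) in auto)
  have "(LBINT y. indicator {0<..} y * tail \<Lambda> y * \<phi> (x - y)) = (LINT y|lborel. (LINT z|\<Lambda>. f y z))"
    by (simp add: inner)
  also have "\<dots> = (LINT z|\<Lambda>. (LINT y|lborel. f y z))" using pair_levy.Fubini_integral[OF int] by simp
  also have "\<dots> = (LINT z|\<Lambda>. indicator {0<..} z * (antideriv \<phi> x - antideriv \<phi> (x - z)))"
  proof (intro Bochner_Integration.integral_cong refl)
    fix z
    show "(LBINT y. f y z) = indicator {0<..} z * (antideriv \<phi> x - antideriv \<phi> (x - z))"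
    proof (cases "z > 0")
      case True
      have "(LBINT y. f y z) = (LBINT y. f (x + (-1) * y) z)"
        using lborel_integral_real_affine[of "-1" "\<lambda>y. f y z" x] by simp
      also have "\<dots> = (LBINT y. indicator {..<x} y * \<phi> y - indicator {..<x - z} y * \<phi> y)"
        by (intro Bochner_Integration.integral_cong) (use True in \<open>auto simp: f_def indicator_def\<close>)
      also have "\<dots> = antideriv \<phi> x - antideriv \<phi> (x - z)"
        unfolding antideriv_eq using antideriv_integrable[OF assms] by simp
      finally show ?thesis using True by simp
    qed (auto simp: f_def)
  qed
  finally have eq: "(LBINT y. indicator {0<..} y * tail \<Lambda> y * \<phi> (x - y))
      = (LINT z|\<Lambda>. indicator {0<..} z * (antideriv \<phi> x - antideriv \<phi> (x - z)))" .
  have "\<kappa> y * \<phi> (x - y) = (q * (indicator {0<..} y * \<phi> (x - y)) + indicator {0<..} y * tail \<Lambda> y * \<phi> (x - y)) / \<delta>" for y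
    by (auto simp: \<kappa>_def indicator_def add_divide_distrib algebra_simps)
  then have "conv \<kappa> \<phi> x = (LBINT y. q * (indicator {0<..} y * \<phi> (x - y)) + indicator {0<..} y * tail \<Lambda> y * \<phi> (x - y)) / \<delta>"
    unfolding conv_def[of \<kappa>] by simp
  also have "(LBINT y. q * (indicator {0<..} y * \<phi> (x - y)) + indicator {0<..} y * tail \<Lambda> y * \<phi> (x - y))
     = q * antideriv \<phi> x + (LBINT y. indicator {0<..} y * tail \<Lambda> y * \<phi> (x - y))"
    unfolding conv_def[of "indicator {0<..}"] using int_tail conv_integrable[OF kernel_indicator assms] by simp
  finally show ?thesis unfolding eq .
qed

end

section \<open>Local Hoelder continuity and its gain under convolution\<close>

definition loc_holder :: "real \<Rightarrow> (real \<Rightarrow> real) \<Rightarrow> bool" where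
  "loc_holder \<beta> \<phi> \<longleftrightarrow> (\<forall>K. \<exists>C. \<forall>x\<le>K. \<forall>t. 0 < t \<longrightarrow> t \<le> 1 \<longrightarrow> \<bar>\<phi> (x + t) - \<phi> x\<bar> \<le> C * t powr \<beta>)"

lemma loc_holderD:
  assumes "loc_holder \<beta> \<phi>"
  obtains C where "C \<ge> 0" "\<And>x t. x \<le> K \<Longrightarrow> 0 < t \<Longrightarrow> t \<le> 1 \<Longrightarrow> \<bar>\<phi> (x + t) - \<phi> x\<bar> \<le> C * t powr \<beta>"
proof -
  obtain C where C: "\<And>x t. x \<le> K \<Longrightarrow> 0 < t \<Longrightarrow> t \<le> 1 \<Longrightarrow> \<bar>\<phi> (x + t) - \<phi> x\<bar> \<le> C * t powr \<beta>"
    using assms unfolding loc_holder_def by blast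
  moreover have "C \<ge> 0" using C[of K 1] by simp
  ultimately show ?thesis using that by blast
qed

text \<open>Exponent 0 only expresses bounded increments, so the iteration can start from any causal
  function.\<close>

lemma loc_holder_0: assumes "causal \<phi>" shows "loc_holder 0 \<phi>"
  unfolding loc_holder_def
proof
  fix K
  obtain B where B: "\<And>u. u \<le> K + 1 \<Longrightarrow> \<bar>\<phi> u\<bar> \<le> B" using causal_bound[OF assms] by metis
  have "\<bar>\<phi> (x + t) - \<phi> x\<bar> \<le> (2 * B) * t powr 0" if "x \<le> K" "0 < t" "t \<le> 1" for x t
    using B[of x] B[of "x + t"] that by auto
  then show "\<exists>C. \<forall>x\<le>K. \<forall>t. 0 < t \<longrightarrow> t \<le> 1 \<longrightarrow> \<bar>\<phi> (x + t) - \<phi> x\<bar> \<le> C * t powr 0" by blast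
qed

lemma loc_holder_continuous: assumes "loc_holder \<beta> \<phi>" "\<beta> > 0" shows "continuous_on UNIV \<phi>"
proof (rule continuous_at_imp_continuous_on, rule ballI)
  fix x :: real
  obtain C where C: "C \<ge> 0" "\<And>y t. y \<le> x + 1 \<Longrightarrow> 0 < t \<Longrightarrow> t \<le> 1 \<Longrightarrow> \<bar>\<phi> (y + t) - \<phi> y\<bar> \<le> C * t powr \<beta>"
    using loc_holderD[OF assms(1)] by metis
  have ev: "\<forall>\<^sub>F y in at x. norm (\<phi> y - \<phi> x) \<le> C * \<bar>y - x\<bar> powr \<beta>"
  proof (rule eventually_mono)
    show "\<forall>\<^sub>F y in at x. dist y x < 1 \<and> y \<noteq> x" by (auto simp: eventually_at intro!: exI[of _ 1])
    fix y assume y: "dist y x < 1 \<and> y \<noteq> x"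
    then consider "x < y" | "y < x" by linarith
    then show "norm (\<phi> y - \<phi> x) \<le> C * \<bar>y - x\<bar> powr \<beta>"
    proof cases
      case 1 then show ?thesis using y C(2)[of x "y - x"] by (simp add: dist_real_def)
    next
      case 2 then show ?thesis using y C(2)[of y "x - y"] by (simp add: dist_real_def abs_minus_commute)
    qed
  qed
  have lim: "((\<lambda>y. C * \<bar>y - x\<bar> powr \<beta>) \<longlongrightarrow> C * 0) (at x)"
  proof (intro tendsto_mult tendsto_const)
    have "((\<lambda>y. \<bar>y - x\<bar>) \<longlongrightarrow> \<bar>x - x\<bar>) (at x)" by (intro tendsto_intros)
    then have "((\<lambda>y. \<bar>y - x\<bar> powr \<beta>) \<longlongrightarrow> 0 powr \<beta>) (at x)"
      using assms(2) by (intro tendsto_powr') auto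
    then show "((\<lambda>y. \<bar>y - x\<bar> powr \<beta>) \<longlongrightarrow> 0) (at x)" by simp
  qed
  have "((\<lambda>y. \<phi> y - \<phi> x) \<longlongrightarrow> 0) (at x)"
    by (rule Lim_null_comparison[OF ev]) (use lim in simp)
  then show "isCont \<phi> x" unfolding isCont_def by (rule LIM_zero_cancel)
qed

context levy_kernel
begin

context
  fixes \<gamma> :: real
  assumes \<gamma>: "0 < \<gamma>" "\<gamma> < 1"
    and index: "(\<integral>\<^sup>+ z\<in>{0<..1}. ennreal (z powr \<gamma>) \<partial>\<Lambda>) < \<infinity>"
begin

text \<open>This is min 1 (z powr \<gamma>) on the half-line, the \<Lambda>-integrable majorant for
  increments of \<gamma>-Hoelder functions.\<close>

definition weight :: "real \<Rightarrow> real" where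
  "weight z = indicator {0<..} z * (if z \<le> 1 then z powr \<gamma> else 1)"

lemma measurable_weight[measurable]: "weight \<in> borel_measurable borel"
  unfolding weight_def by measurable

lemma integrable_weight: "integrable \<Lambda> weight"
proof (rule integrableI_nonneg)
  have "(\<integral>\<^sup>+ z. ennreal (weight z) \<partial>\<Lambda>)
     = (\<integral>\<^sup>+ z. ennreal (z powr \<gamma>) * indicator {0<..1} z + indicator {1<..} z \<partial>\<Lambda>)"
    by (intro nn_integral_cong) (auto simp: weight_def indicator_def)
  also have "\<dots> = (\<integral>\<^sup>+ z\<in>{0<..1}. ennreal (z powr \<gamma>) \<partial>\<Lambda>) + emeasure \<Lambda> {1<..}"
    by (subst nn_integral_add) auto
  also have "\<dots> < \<infinity>"
  proof -
    have "emeasure \<Lambda> {1<..} \<le> emeasure \<Lambda> {1..}" by (intro emeasure_mono) auto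
    then show ?thesis using index emeasure_tail_finite[of 1] by (auto simp: less_top[symmetric] top_unique)
  qed
  finally show "(\<integral>\<^sup>+ z. ennreal (weight z) \<partial>\<Lambda>) < \<infinity>" .
qed (measurable, simp add: weight_def)

text \<open>For steps t and z \<le> 1 the second difference is at most C min(t, z) max(t,
  z)^\<beta>. This is at most C z^\<gamma> t^(\<beta> + 1 - \<gamma>): for z \<le> t because
  \<gamma> < 1, and for t < z because \<beta> \<le> \<gamma>. Integrating z^\<gamma> against
  \<Lambda> leaves the gain 1 - \<gamma>.\<close>

lemma loc_holder_conv:
  assumes "causal \<phi>" "loc_holder \<beta> \<phi>" "0 \<le> \<beta>" "\<beta> \<le> \<gamma>"
  shows "loc_holder (\<beta> + 1 - \<gamma>) (conv \<kappa> \<phi>)"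
  unfolding loc_holder_def
proof
  fix K
  define \<eta> where "\<eta> = \<beta> + 1 - \<gamma>"
  have \<eta>: "0 < \<eta>" "\<eta> \<le> 1" using \<gamma> assms by (auto simp: \<eta>_def)
  obtain B where B: "B \<ge> 0" "\<And>u. u \<le> K + 1 \<Longrightarrow> \<bar>\<phi> u\<bar> \<le> B" using causal_bound[OF assms(1)] by metis
  obtain C where C: "C \<ge> 0" "\<And>x t. x \<le> K + 1 \<Longrightarrow> 0 < t \<Longrightarrow> t \<le> 1 \<Longrightarrow> \<bar>\<phi> (x + t) - \<phi> x\<bar> \<le> C * t powr \<beta>"
    using loc_holderD[OF assms(2)] by metis
  define D where "D = C + 2 * B"
  have D: "C \<le> D" "2 * B \<le> D" "0 \<le> D" using B C by (auto simp: D_def)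
  have "\<bar>conv \<kappa> \<phi> (x + t) - conv \<kappa> \<phi> x\<bar> \<le> ((q * B + D * (LINT z|\<Lambda>. weight z)) / \<delta>) * t powr \<eta>"
    if x: "x \<le> K" and t: "0 < t" "t \<le> 1" for x t
  proof -
    have t_le: "t \<le> t powr \<eta>" using powr_mono'[of \<eta> 1 t] \<eta> t by simp
    have Lip: "\<bar>antideriv \<phi> (u + t) - antideriv \<phi> u\<bar> \<le> B * t" if "u \<le> K" for u
      using antideriv_Lipschitz[OF assms(1), of t "u + t" B] t B that by simp
    txt \<open>This second difference of \<open>antideriv \<phi>\<close> with steps \<open>t\<close> and \<open>z\<close> is symmetric in the two steps; the
      Hoelder bound is used for the larger step and the length of the smaller one.\<close>
    have R: "\<bar>antideriv \<phi> (x + t) - antideriv \<phi> (x + t - z) - (antideriv \<phi> x - antideriv \<phi> (x - z))\<bar> \<le> D * weight z * t powr \<eta>"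
      if z: "z > 0" for z
    proof -
      consider "z \<le> t" | "t < z" "z \<le> 1" | "1 < z" by linarith
      then show ?thesis
      proof cases
        case 1
        have "\<bar>antideriv \<phi> (x + t) - antideriv \<phi> x - (antideriv \<phi> (x + t - z) - antideriv \<phi> (x - z))\<bar> \<le> C * t powr \<beta> * z"
          by (rule antideriv_increment[OF assms(1)]) (use C x t z in auto)
        also have "C * t powr \<beta> * z = C * t powr \<beta> * (z powr \<gamma> * z powr (1 - \<gamma>))"
          using z by (simp flip: powr_add)
        also have "C * t powr \<beta> * (z powr \<gamma> * z powr (1 - \<gamma>)) \<le> C * t powr \<beta> * (z powr \<gamma> * t powr (1 - \<gamma>))"
          using C \<gamma> z 1 by (intro mult_left_mono powr_mono2) auto
        also have "\<dots> = C * z powr \<gamma> * t powr \<eta>" by (simp add: \<eta>_def powr_add[symmetric] algebra_simps)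
        also have "\<dots> \<le> D * z powr \<gamma> * t powr \<eta>" using D by (intro mult_right_mono) auto
        finally show ?thesis using z 1 t by (simp add: weight_def algebra_simps)
      next
        case 2
        \<comment> \<open>\<open>antideriv_increment\<close> with exchanged roles: base point x + t
          - z, Hoelder step z, length t.\<close>
        have "\<bar>antideriv \<phi> ((x + t - z) + z) - antideriv \<phi> (x + t - z) - (antideriv \<phi> ((x + t - z) + z - t) - antideriv \<phi> ((x + t - z) - t))\<bar> \<le> C * z powr \<beta> * t"
          by (rule antideriv_increment[OF assms(1)]) (use C x t z 2 in auto)
        also have "C * z powr \<beta> * t = C * z powr \<gamma> * (z powr (\<beta> - \<gamma>) * t)" by (simp flip: powr_add)
        also have "\<dots> \<le> C * z powr \<gamma> * (t powr (\<beta> - \<gamma>) * t)"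
          using C z 2 t assms(4) by (intro mult_left_mono mult_right_mono powr_mono2') auto
        also have "t powr (\<beta> - \<gamma>) * t = t powr \<eta>"
          using t powr_add[of t "\<beta> - \<gamma>" 1] by (simp add: \<eta>_def algebra_simps)
        also have "C * z powr \<gamma> * t powr \<eta> \<le> D * z powr \<gamma> * t powr \<eta>" using D by (intro mult_right_mono) auto
        finally show ?thesis using z 2 by (simp add: weight_def algebra_simps)
      next
        case 3
        have "\<bar>antideriv \<phi> (x + t) - antideriv \<phi> x\<bar> \<le> B * t" "\<bar>antideriv \<phi> ((x - z) + t) - antideriv \<phi> (x - z)\<bar> \<le> B * t"
          using Lip[of x] Lip[of "x - z"] x z by auto
        then have "\<bar>antideriv \<phi> (x + t) - antideriv \<phi> (x + t - z) - (antideriv \<phi> x - antideriv \<phi> (x - z))\<bar> \<le> 2 * B * t"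
          by (simp add: algebra_simps)
        also have "\<dots> \<le> D * t powr \<eta>" using D B t t_le by (intro mult_mono) auto
        finally show ?thesis using 3 by (simp add: weight_def)
      qed
    qed
    let ?d = "\<lambda>x z. indicator {0<..} z * (antideriv \<phi> x - antideriv \<phi> (x - z))"
    note int = antideriv_difference_integrable[OF assms(1)]
    have "\<bar>LINT z|\<Lambda>. ?d (x + t) z - ?d x z\<bar> \<le> (LINT z|\<Lambda>. D * weight z * t powr \<eta>)"
    proof (rule order_trans[OF integral_abs_bound integral_mono])
      show "\<bar>?d (x + t) z - ?d x z\<bar> \<le> D * weight z * t powr \<eta>" for z
        using R[of z] by (cases "z > 0") (auto simp: weight_def)
    qed (use int[of "x + t"] int[of x] integrable_weight in simp_all)
    then have 1: "\<bar>(LINT z|\<Lambda>. ?d (x + t) z) - (LINT z|\<Lambda>. ?d x z)\<bar> \<le> D * (LINT z|\<Lambda>. weight z) * t powr \<eta>"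
      using int[of "x + t"] int[of x] by simp
    have "q * \<bar>antideriv \<phi> (x + t) - antideriv \<phi> x\<bar> \<le> q * (B * t powr \<eta>)"
      using Lip[OF x] q_nonneg B t_le by (intro mult_left_mono order_trans[OF Lip[OF x]]) auto
    then have 2: "\<bar>q * antideriv \<phi> (x + t) - q * antideriv \<phi> x\<bar> \<le> q * (B * t powr \<eta>)"
      using q_nonneg by (simp add: abs_mult flip: right_diff_distrib)
    have "conv \<kappa> \<phi> (x + t) - conv \<kappa> \<phi> x = ((q * antideriv \<phi> (x + t) - q * antideriv \<phi> x)
       + ((LINT z|\<Lambda>. ?d (x + t) z) - (LINT z|\<Lambda>. ?d x z))) / \<delta>"
      unfolding conv_kappa_eq[OF assms(1)] by (simp add: diff_divide_distrib add_divide_distrib)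
    then have "\<bar>conv \<kappa> \<phi> (x + t) - conv \<kappa> \<phi> x\<bar> = \<bar>(q * antideriv \<phi> (x + t) - q * antideriv \<phi> x)
       + ((LINT z|\<Lambda>. ?d (x + t) z) - (LINT z|\<Lambda>. ?d x z))\<bar> / \<delta>" using \<delta>_pos by simp
    also have "\<dots> \<le> (q * (B * t powr \<eta>) + D * (LINT z|\<Lambda>. weight z) * t powr \<eta>) / \<delta>"
      using 1 2 \<delta>_pos by (intro divide_right_mono) auto
    also have "\<dots> = ((q * B + D * (LINT z|\<Lambda>. weight z)) / \<delta>) * t powr \<eta>" by (simp add: algebra_simps add_divide_distrib)
    finally show ?thesis .
  qed
  then show "\<exists>C. \<forall>x\<le>K. \<forall>t. 0 < t \<longrightarrow> t \<le> 1 \<longrightarrow> \<bar>conv \<kappa> \<phi> (x + t) - conv \<kappa> \<phi> x\<bar> \<le> C * t powr (\<beta> + 1 - \<gamma>)"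
    unfolding \<eta>_def by blast
qed

text \<open>At the exponent \<gamma> the increments of \<phi> itself are dominated by
  \<open>weight\<close>, so the formula of \<open>conv_kappa_eq\<close> can be differentiated under
  the \<Lambda>-integral.\<close>

lemma loc_holder_conv_differentiable:
  assumes "causal \<phi>" "loc_holder \<gamma> \<phi>"
  obtains \<psi> where "causal \<psi>" "continuous_on UNIV \<psi>" "\<And>x. (conv \<kappa> \<phi> has_real_derivative \<psi> x) (at x)"
proof -
  note [measurable] = causal_measurable[OF assms(1)]
  have cont: "continuous_on UNIV \<phi>" using loc_holder_continuous[OF assms(2)] \<gamma> by simp
  then have isC: "isCont \<phi> x" for x by (auto simp: continuous_on_eq_continuous_at)
  let ?d = "\<lambda>x z. indicator {0<..} z * (antideriv \<phi> x - antideriv \<phi> (x - z))"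
  let ?e = "\<lambda>x z. indicator {0<..} z * (\<phi> x - \<phi> (x - z))"
  define \<psi> where "\<psi> = (\<lambda>x. (q * \<phi> x + (LINT z|\<Lambda>. ?e x z)) / \<delta>)"
  have dom: "\<exists>w. integrable \<Lambda> w \<and> (\<forall>x\<le>K. \<forall>z. \<bar>?e x z\<bar> \<le> w z)" for K
  proof -
    obtain B where B: "B \<ge> 0" "\<And>u. u \<le> K \<Longrightarrow> \<bar>\<phi> u\<bar> \<le> B" using causal_bound[OF assms(1)] by metis
    obtain C where C: "C \<ge> 0" "\<And>x t. x \<le> K \<Longrightarrow> 0 < t \<Longrightarrow> t \<le> 1 \<Longrightarrow> \<bar>\<phi> (x + t) - \<phi> x\<bar> \<le> C * t powr \<gamma>"
      using loc_holderD[OF assms(2)] by metis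
    have "\<bar>?e x z\<bar> \<le> (C + 2 * B) * weight z" if x: "x \<le> K" for x z
    proof -
      consider "z \<le> 0" | "0 < z" "z \<le> 1" | "1 < z" by linarith
      then show ?thesis
      proof cases
        case 2
        have "\<bar>\<phi> ((x - z) + z) - \<phi> (x - z)\<bar> \<le> C * z powr \<gamma>" using 2 x by (intro C) auto
        also have "\<dots> \<le> (C + 2 * B) * z powr \<gamma>" using B by (intro mult_right_mono) auto
        finally show ?thesis using 2 by (simp add: weight_def)
      next
        case 3
        then show ?thesis using B(2)[of x] B(2)[of "x - z"] x C(1) by (simp add: weight_def)
      qed (simp add: weight_def)
    qed
    then show ?thesis using integrable_weight by (intro exI[of _ "\<lambda>z. (C + 2 * B) * weight z"]) auto
  qed
  have "isCont \<psi> x" for x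
  proof -
    obtain w where w: "integrable \<Lambda> w" "\<forall>y\<le>x + 1. \<forall>z. \<bar>?e y z\<bar> \<le> w z" using dom by blast
    have "isCont (\<lambda>x. LINT z|\<Lambda>. ?e x z) x"
      by (intro isCont_LINT[of x "x - 1" "x + 1" _ _ w])
        (use w in \<open>auto intro!: AE_I2 continuous_intros isC isCont_o2[OF _ isC]\<close>)
    then show ?thesis unfolding \<psi>_def using \<delta>_pos isC[of x] by (intro continuous_intros) auto
  qed
  then have "continuous_on UNIV \<psi>" by (auto intro: continuous_at_imp_continuous_on)
  moreover have "\<psi> x = 0" if "x \<le> 0" for x
  proof -
    have "?e x z = 0" for z using assms(1) that by (cases "z > 0") (auto simp: causal_def)
    then have "(LINT z|\<Lambda>. ?e x z) = 0" by (simp only: integral_zero)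
    then show ?thesis using assms(1) that by (simp add: \<psi>_def causal_def)
  qed
  ultimately have "causal \<psi>" by (intro causal_continuous)
  moreover have "(conv \<kappa> \<phi> has_real_derivative \<psi> x) (at x)" for x
  proof -
    obtain w where w: "integrable \<Lambda> w" "\<forall>y\<le>x + 1. \<forall>z. \<bar>?e y z\<bar> \<le> w z" using dom by blast
    note J = antideriv_has_derivative[OF assms(1) cont]
    have "((\<lambda>y. ?d y z) has_real_derivative ?e y z) (at y)" for y z
    proof -
      have "((\<lambda>y. antideriv \<phi> (y - z)) has_real_derivative \<phi> (y - z)) (at y)"
        using J[of "y + - z"] by (subst (asm) DERIV_shift) simp
      then show ?thesis by (intro DERIV_cmult DERIV_diff J)
    qed
    then have "((\<lambda>y. LINT z|\<Lambda>. ?d y z) has_real_derivative (LINT z|\<Lambda>. ?e x z)) (at x)"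
      by (intro DERIV_LINT[of x "x - 1" "x + 1" _ _ ?e w])
        (use w antideriv_difference_integrable[OF assms(1)] in auto)
    then show ?thesis
      unfolding conv_kappa_eq[OF assms(1), abs_def] \<psi>_def
      by (intro DERIV_cdivide DERIV_add DERIV_cmult J)
  qed
  ultimately show ?thesis using that \<open>continuous_on UNIV \<psi>\<close> by blast
qed

end

text \<open>With \<open>\<gamma> = 1 - 1 / N\<close> every application of \<open>conv \<kappa>\<close> gains exactly \<open>1 / N\<close>, so \<open>N\<close> applications
  gain a full derivative and the critical exponents are hit without interpolation.\<close>

lemma conv_power_smoothing:
  assumes "N \<ge> 2" "(\<integral>\<^sup>+ z\<in>{0<..1}. ennreal (z powr (1 - 1 / real N)) \<partial>\<Lambda>) < \<infinity>" "causal \<phi>"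
  shows "\<exists>n0. \<forall>n\<ge>n0. Ck_on m ((conv \<kappa> ^^ n) \<phi>) UNIV"
proof -
  define \<gamma> where "\<gamma> = 1 - 1 / real N"
  have \<gamma>: "0 < \<gamma>" "\<gamma> < 1" using assms(1) by (auto simp: \<gamma>_def)
  note idx = assms(2)[folded \<gamma>_def]
  note cf = causal_funpow[OF kernel_kappa] and contf = continuous_funpow[OF kernel_kappa]
  have step: "\<exists>\<psi>. causal \<psi> \<and> continuous_on UNIV \<psi> \<and> (\<forall>x. ((conv \<kappa> ^^ N) \<phi> has_real_derivative \<psi> x) (at x))"
    if \<phi>: "causal \<phi>" for \<phi>
  proof -
    have loc_holder_iter: "loc_holder (real j / real N) ((conv \<kappa> ^^ j) \<phi>)" if "j \<le> N - 1" for j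
      using that
    proof (induction j)
      case 0 then show ?case using loc_holder_0[OF \<phi>] by simp
    next
      case (Suc j)
      have "real j + 1 \<le> real N" using Suc.prems assms(1) by linarith
      then have "real j / real N \<le> \<gamma>" using assms(1) by (simp add: \<gamma>_def field_simps)
      then have "loc_holder (real j / real N + 1 - \<gamma>) (conv \<kappa> ((conv \<kappa> ^^ j) \<phi>))"
        using Suc by (intro loc_holder_conv[OF \<gamma> idx] cf \<phi>) auto
      moreover have "real j / real N + 1 - \<gamma> = real (Suc j) / real N" using assms(1) by (simp add: \<gamma>_def field_simps)
      ultimately show ?case by simp
    qed
    have "real (N - 1) / real N = \<gamma>" using assms(1) by (simp add: \<gamma>_def field_simps of_nat_diff)
    then have "loc_holder \<gamma> ((conv \<kappa> ^^ (N - 1)) \<phi>)" using loc_holder_iter[of "N - 1"] by simp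
    from loc_holder_conv_differentiable[OF \<gamma> idx cf[OF \<phi>] this]
    obtain \<psi> where "causal \<psi>" "continuous_on UNIV \<psi>"
      "\<And>x. (conv \<kappa> ((conv \<kappa> ^^ (N - 1)) \<phi>) has_real_derivative \<psi> x) (at x)" by blast
    moreover have "conv \<kappa> ((conv \<kappa> ^^ (N - 1)) \<phi>) = (conv \<kappa> ^^ N) \<phi>"
      using assms(1) by (cases N) auto
    ultimately show ?thesis by auto
  qed
  have deriv_iter: "((conv \<kappa> ^^ n) f has_real_derivative ((conv \<kappa> ^^ n) \<psi>) x) (at x)"
    if "causal f" "causal \<psi>" "\<And>x. (f has_real_derivative \<psi> x) (at x)" for f \<psi> n x
  proof (induction n arbitrary: x)
    case (Suc n)
    then show ?case by (simp) (intro conv_has_derivative kernel_kappa cf that)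
  qed (use that in auto)
  \<comment> \<open>N applications produce a derivative \<psi> that is again causal and continuous,
    and further convolutions commute with differentiation; the induction continues with \<psi> in
    place of f.\<close>
  have smooth: "Ck_on m ((conv \<kappa> ^^ (m * N)) f) UNIV" if "causal f" "continuous_on UNIV f" for m f
    using that
  proof (induction m arbitrary: f)
    case (Suc m)
    obtain \<psi> where \<psi>: "causal \<psi>" "continuous_on UNIV \<psi>" "\<And>x. ((conv \<kappa> ^^ N) f has_real_derivative \<psi> x) (at x)"
      using step[OF Suc.prems(1)] by blast
    have eq: "(conv \<kappa> ^^ (Suc m * N)) f = (conv \<kappa> ^^ (m * N)) ((conv \<kappa> ^^ N) f)"
      by (simp add: add.commute[of N] funpow_add)
    show ?case unfolding eq
      by (rule Ck_on_SucI[OF deriv_iter[OF cf[OF Suc.prems(1)] \<psi>(1,3)] Suc.IH[OF \<psi>(1,2)]])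
  qed simp
  \<comment> \<open>The innermost N applications make \<phi> continuous, surplus ones keep it so,
    and the outer m * N provide m derivatives.\<close>
  have "Ck_on m ((conv \<kappa> ^^ n) \<phi>) UNIV" if "n \<ge> m * N + N" for n
  proof -
    define i where "i = n - (m * N + N)"
    have n: "n = m * N + (i + N)" using that by (simp add: i_def)
    have "continuous_on UNIV ((conv \<kappa> ^^ N) \<phi>)"
      using step[OF assms(3)] by (auto intro!: continuous_at_imp_continuous_on intro: DERIV_isCont)
    then have "continuous_on UNIV ((conv \<kappa> ^^ (i + N)) \<phi>)"
      using contf[OF cf[OF assms(3)]] by (simp add: funpow_add)
    then have "Ck_on m ((conv \<kappa> ^^ (m * N)) ((conv \<kappa> ^^ (i + N)) \<phi>)) UNIV"
      by (intro smooth cf assms(3))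
    then show ?thesis by (simp add: n funpow_add)
  qed
  then show ?thesis by blast
qed

lemma blumenthal_getoor_less_1:
  assumes "blumenthal_getoor \<Lambda> < 1"
  obtains N :: nat where "N \<ge> 2" "(\<integral>\<^sup>+ z\<in>{0<..1}. ennreal (z powr (1 - 1 / real N)) \<partial>\<Lambda>) < \<infinity>"
proof -
  let ?S = "{\<gamma>. \<gamma> > 0 \<and> (\<integral>\<^sup>+ x\<in>{0<..1}. ennreal (x powr \<gamma>) \<partial>\<Lambda>) < \<infinity>}"
  have "(\<integral>\<^sup>+ x\<in>{0<..1}. ennreal (x powr 1) \<partial>\<Lambda>) \<le> (\<integral>\<^sup>+ z. ennreal (min 1 z) \<partial>\<Lambda>)"
    by (intro nn_integral_mono) (auto simp: indicator_def)
  then have "1 \<in> ?S" using nn_integral_min_levy by (auto intro: le_less_trans)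
  \<comment> \<open>The infimum of an empty set of reals would say nothing; the exponent 1 is always
    admissible for a Levy measure.\<close>
  then have "?S \<noteq> {}" by blast
  from cInf_lessD[OF this] obtain \<gamma> where \<gamma>: "\<gamma> > 0" "\<gamma> < 1" "(\<integral>\<^sup>+ x\<in>{0<..1}. ennreal (x powr \<gamma>) \<partial>\<Lambda>) < \<infinity>"
    using assms unfolding blumenthal_getoor_def by auto
  obtain n where n: "1 / real (Suc n) < 1 - \<gamma>" using nat_approx_posE[of "1 - \<gamma>"] \<gamma> by auto
  define N where "N = Suc (Suc n)"
  have "1 / real N \<le> 1 / real (Suc n)" by (simp add: N_def frac_le)
  then have N: "\<gamma> \<le> 1 - 1 / real N" using n by simp
  have "(\<integral>\<^sup>+ z\<in>{0<..1}. ennreal (z powr (1 - 1 / real N)) \<partial>\<Lambda>) \<le> (\<integral>\<^sup>+ x\<in>{0<..1}. ennreal (x powr \<gamma>) \<partial>\<Lambda>)"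
    using N by (intro nn_integral_mono) (auto simp: indicator_def intro!: ennreal_leI powr_mono')
  then have "(\<integral>\<^sup>+ z\<in>{0<..1}. ennreal (z powr (1 - 1 / real N)) \<partial>\<Lambda>) < \<infinity>" using \<gamma>(3) by (rule le_less_trans)
  then show ?thesis using that[of N] by (auto simp: N_def)
qed

end

section \<open>Splitting off the atoms\<close>

context levy_kernel
begin

lemma atoms_pos: "x \<in> atoms \<Lambda> \<Longrightarrow> x > 0"
proof (rule ccontr)
  assume "x \<in> atoms \<Lambda>" "\<not> x > 0"
  then have "emeasure \<Lambda> {x} \<le> emeasure \<Lambda> {..0}" by (intro emeasure_mono) auto
  then show False using levy \<open>x \<in> atoms \<Lambda>\<close> by (simp add: levy_measure_def atoms_def)
qed

lemma emeasure_finite_above: "y > 0 \<Longrightarrow> S \<subseteq> {y..} \<Longrightarrow> emeasure \<Lambda> S \<noteq> \<infinity>"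
  using emeasure_mono[of S "{y..}" \<Lambda>] emeasure_tail_finite[of y] by (auto simp: top_unique)

lemma atom_iff: "x > 0 \<Longrightarrow> x \<in> atoms \<Lambda> \<longleftrightarrow> measure \<Lambda> {x} > 0"
  using emeasure_finite_above[of x "{x}"]
  by (auto simp: atoms_def emeasure_eq_ennreal_measure)

lemma tail_diff: 
  assumes "0 < y" "y \<le> z" shows "tail \<Lambda> y = measure \<Lambda> {y..<z} + tail \<Lambda> z"
proof -
  have "measure \<Lambda> ({y..<z} \<union> {z..}) = measure \<Lambda> {y..<z} + measure \<Lambda> {z..}"
    using assms by (intro measure_Union emeasure_finite_above[of y]) auto
  moreover have "{y..<z} \<union> {z..} = {y..}" using assms by auto
  ultimately show ?thesis by (simp add: tail_def)
qed

text \<open>The tail counts closed half-lines, so just to the right of x exactly the mass of {x} is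
  lost. Atoms can therefore be read off from tails, which are all that the splitting hypothesis
  relates.\<close>

lemma tail_right_limit:
  assumes "x > 0" shows "(\<lambda>n. tail \<Lambda> (x + 1 / real (Suc n))) \<longlonglongrightarrow> tail \<Lambda> x - measure \<Lambda> {x}"
proof -
  have un: "(\<Union>n. {x + 1 / real (Suc n)..}) = {x<..}"
  proof (intro equalityI subsetI)
    fix y assume "y \<in> {x<..}"
    then obtain n where "1 / real (Suc n) < y - x" using nat_approx_posE[of "y - x"] by auto
    then show "y \<in> (\<Union>n. {x + 1 / real (Suc n)..})" by (auto intro!: exI[of _ n] simp: field_simps)
  next
    fix y assume "y \<in> (\<Union>n. {x + 1 / real (Suc n)..})"
    then obtain n where "x + 1 / real (Suc n) \<le> y" by auto
    moreover have "1 / real (Suc n) > 0" by simp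
    ultimately show "y \<in> {x<..}" by (simp only: greaterThan_iff)
  qed
  have "(\<lambda>n. measure \<Lambda> {x + 1 / real (Suc n)..}) \<longlonglongrightarrow> measure \<Lambda> (\<Union>n. {x + 1 / real (Suc n)..})"
  proof (rule Lim_measure_incseq)
    show "incseq (\<lambda>n. {x + 1 / real (Suc n)..})"
      by (auto simp: incseq_def intro: order_trans[rotated] frac_le)
    show "emeasure \<Lambda> (\<Union>n. {x + 1 / real (Suc n)..}) \<noteq> \<infinity>"
      unfolding un using assms by (intro emeasure_finite_above[of x]) auto
  qed auto
  then have "(\<lambda>n. tail \<Lambda> (x + 1 / real (Suc n))) \<longlonglongrightarrow> measure \<Lambda> {x<..}" unfolding un tail_def .
  moreover have "measure \<Lambda> ({x} \<union> {x<..}) = measure \<Lambda> {x} + measure \<Lambda> {x<..}"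
    using assms by (intro measure_Union emeasure_finite_above[of x]) auto
  moreover have "{x} \<union> {x<..} = {x..}" by auto
  ultimately show ?thesis unfolding tail_def[of \<Lambda> x] by (simp only: add_diff_cancel_left')
qed

end

text \<open>The index is shifted because \<open>asums\<close> counts strictly fewer summands than
  its index. It also contains the empty sum 0, which x > 0 excludes.\<close>

lemma atom_sums_iff:
  assumes "x > 0"
  shows "x \<in> atom_sums \<Lambda> k \<longleftrightarrow> x \<in> asums (atoms \<Lambda>) (Suc k)"
proof
  have *: "(\<Sum>i=1..j. g i) \<in> asums (atoms \<Lambda>) (Suc j)" if "\<forall>i\<in>{1..j}. g i \<in> atoms \<Lambda>" for j g
    using that
  proof (induction j)
    case (Suc j)
    then have "(\<Sum>i=1..j. g i) \<in> asums (atoms \<Lambda>) (Suc j)" "g (Suc j) \<in> atoms \<Lambda>" by auto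
    then show ?case unfolding asums.simps(2)[of _ "Suc j"] by force
  qed simp
  assume "x \<in> atom_sums \<Lambda> k"
  then obtain j g where "j \<le> k" "\<forall>i\<in>{1..j}. g i \<in> atoms \<Lambda>" "x = (\<Sum>i=1..j. g i)"
    by (auto simp: atom_sums_def)
  then show "x \<in> asums (atoms \<Lambda>) (Suc k)"
    using *[of j g] asums_mono[of "Suc j" "Suc k" "atoms \<Lambda>"] by (simp del: asums.simps) blast
next
  have *: "\<exists>j g. j \<le> k \<and> (\<forall>i\<in>{1..j}. g i \<in> atoms \<Lambda>) \<and> s = (\<Sum>i=1..j. g i)"
    if "s \<in> asums (atoms \<Lambda>) (Suc k)" for s k
    using that
  proof (induction k arbitrary: s)
    case (Suc k)
    from Suc.prems consider "s = 0" | "s \<in> asums (atoms \<Lambda>) (Suc k)"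
      | s' g where "s = s' + g" "s' \<in> asums (atoms \<Lambda>) (Suc k)" "g \<in> atoms \<Lambda>"
      unfolding asums.simps(2)[of _ "Suc k"] by blast
    then show ?case
    proof cases
      case 2
      then show ?thesis using Suc.IH[of s] by (meson le_SucI)
    next
      case 3
      then obtain j h where jh: "j \<le> k" "\<forall>i\<in>{1..j}. h i \<in> atoms \<Lambda>" "s' = (\<Sum>i=1..j. h i)"
        using Suc.IH by blast
      have "(\<Sum>i=1..Suc j. (h(Suc j := g)) i) = s" using jh 3 by simp
      then show ?thesis using jh 3
        by (intro exI[of _ "Suc j"] exI[of _ "h(Suc j := g)"]) auto
    qed (intro exI[of _ 0], simp)
  qed (intro exI[of _ 0], simp)
  assume "x \<in> asums (atoms \<Lambda>) (Suc k)"
  from *[OF this] obtain j g where jg: "j \<le> k" "\<forall>i\<in>{1..j}. g i \<in> atoms \<Lambda>" "x = (\<Sum>i=1..j. g i)" by blast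
  then have "j \<noteq> 0" using assms by (intro notI) simp
  then show "x \<in> atom_sums \<Lambda> k" using jg assms unfolding atom_sums_def
    by (intro CollectI conjI exI[of _ j] exI[of _ g]) simp_all
qed

locale split_levy = levy_kernel \<Lambda> q \<delta> + l1: levy_kernel \<Lambda>1 q \<delta> + l2: levy_kernel \<Lambda>2 q \<delta>
  for \<Lambda> \<Lambda>1 \<Lambda>2 q \<delta> +
  assumes tail_sum: "x > 0 \<Longrightarrow> tail \<Lambda> x = tail \<Lambda>1 x + tail \<Lambda>2 x"
    and atomic: "purely_atomic \<Lambda>1"
    and isolated: "x \<noteq> 0 \<Longrightarrow> \<not> x islimpt atoms \<Lambda>1"
    and smooth: "x > 0 \<Longrightarrow> infinitely_differentiable_at (tail \<Lambda>2) x"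
begin

lemma Ck_on_tail2: "Ck_on k (tail \<Lambda>2) {0<..}"
  by (rule times_differentiable_at_imp_Ck_on, rule smooth[unfolded infinitely_differentiable_at_def, rule_format]) simp

text \<open>Taking right limits in \<open>tail_sum\<close>: the tail of \<Lambda>2 is continuous, so
  any jump of the tail of \<Lambda> is one of the tail of \<Lambda>1.\<close>

lemma measure_singleton_eq:
  assumes "x > 0" shows "measure \<Lambda> {x} = measure \<Lambda>1 {x}"
proof -
  have lim: "(\<lambda>n. x + 1 / real (Suc n)) \<longlonglongrightarrow> x"
    using tendsto_add[OF tendsto_const[of x] LIMSEQ_inverse_real_of_nat] by (simp add: inverse_eq_divide)
  have "isCont (tail \<Lambda>2) x"
    using Ck_on_imp_continuous_on[OF Ck_on_tail2] assms by (auto simp: continuous_on_eq_continuous_at)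
  then have "(\<lambda>n. tail \<Lambda>2 (x + 1 / real (Suc n))) \<longlonglongrightarrow> tail \<Lambda>2 x"
    by (rule isCont_tendsto_compose[OF _ lim])
  from tendsto_add[OF l1.tail_right_limit[OF assms] this]
  have "(\<lambda>n. tail \<Lambda>1 (x + 1 / real (Suc n)) + tail \<Lambda>2 (x + 1 / real (Suc n)))
     \<longlonglongrightarrow> tail \<Lambda>1 x - measure \<Lambda>1 {x} + tail \<Lambda>2 x" .
  also have "(\<lambda>n. tail \<Lambda>1 (x + 1 / real (Suc n)) + tail \<Lambda>2 (x + 1 / real (Suc n)))
     = (\<lambda>n. tail \<Lambda> (x + 1 / real (Suc n)))" using assms by (intro ext tail_sum[symmetric]) (simp add: add_pos_nonneg)
  finally have "tail \<Lambda> x - measure \<Lambda> {x} = tail \<Lambda>1 x - measure \<Lambda>1 {x} + tail \<Lambda>2 x"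
    using LIMSEQ_unique tail_right_limit[OF assms] by blast
  then show ?thesis using tail_sum[OF assms] by simp
qed

lemma atoms_eq: "atoms \<Lambda> = atoms \<Lambda>1"
proof (rule set_eqI)
  fix x
  show "x \<in> atoms \<Lambda> \<longleftrightarrow> x \<in> atoms \<Lambda>1"
  proof (cases "x > 0")
    case True
    show ?thesis by (simp only: atom_iff[OF True] l1.atom_iff[OF True] measure_singleton_eq[OF True])
  next
    case False
    then show ?thesis using atoms_pos[of x] l1.atoms_pos[of x] by blast
  qed
qed

text \<open>Between \<epsilon> and y the measure \<Lambda>1 sits on finitely many atoms. The
  interval lost by the tail is half-open and omits y, which gives the strict comparison in
  \<open>indicator {g<..}\<close>.\<close>

lemma tail1_step:
  assumes "0 < \<epsilon>" "y \<in> {\<epsilon>..K}" and F: "finite (atoms \<Lambda>1 \<inter> {\<epsilon>..K})"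
  shows "tail \<Lambda>1 y = tail \<Lambda>1 \<epsilon> - (\<Sum>g\<in>atoms \<Lambda>1 \<inter> {\<epsilon>..K}. measure \<Lambda>1 {g} * indicator {g<..} y)"
proof -
  let ?F = "atoms \<Lambda>1 \<inter> {\<epsilon>..K}"
  let ?S = "{g\<in>?F. g < y}"
  have finS: "finite ?S" by (rule finite_subset[OF _ F]) auto
  have "measure \<Lambda>1 {\<epsilon>..<y} = measure \<Lambda>1 ?S"
  proof (rule measure_eq_AE)
    show "AE x in \<Lambda>1. (x \<in> {\<epsilon>..<y}) = (x \<in> ?S)"
      using atomic unfolding purely_atomic_def by eventually_elim (use assms in auto)
    show "?S \<in> sets \<Lambda>1" unfolding l1.sets_levy by (rule borel_closed[OF finite_imp_closed[OF finS]])
  qed auto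
  also have "emeasure \<Lambda>1 ?S = (\<Sum>g\<in>?S. emeasure \<Lambda>1 {g})"
    using finS by (intro emeasure_eq_sum_singleton) auto
  then have "measure \<Lambda>1 ?S = (\<Sum>g\<in>?S. measure \<Lambda>1 {g})"
  proof -
    assume *: "emeasure \<Lambda>1 ?S = (\<Sum>g\<in>?S. emeasure \<Lambda>1 {g})"
    have "(\<Sum>g\<in>?S. emeasure \<Lambda>1 {g}) = (\<Sum>g\<in>?S. ennreal (measure \<Lambda>1 {g}))"
      using assms(1) by (intro sum.cong refl emeasure_eq_ennreal_measure l1.emeasure_finite_above[of \<epsilon>, simplified]) auto
    also have "\<dots> = ennreal (\<Sum>g\<in>?S. measure \<Lambda>1 {g})" by (intro sum_ennreal) simp
    finally show ?thesis using * by (simp add: measure_def sum_nonneg)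
  qed
  also have "(\<Sum>g\<in>?S. measure \<Lambda>1 {g}) = (\<Sum>g\<in>?F. measure \<Lambda>1 {g} * indicator {g<..} y)"
    using F by (intro sum.mono_neutral_cong_left) (auto simp: indicator_def)
  finally show ?thesis using l1.tail_diff[of \<epsilon> y] assms by simp
qed

sublocale jump_kernel \<kappa> "atoms \<Lambda>" "\<lambda>g. measure \<Lambda> {g} / \<delta>"
proof
  show "kernel \<kappa>" by (rule kernel_kappa)
  show "g > 0" if "g \<in> atoms \<Lambda>" for g using that by (rule atoms_pos)
  show "measure \<Lambda> {g} / \<delta> > 0" if "g \<in> atoms \<Lambda>" for g
    using atom_iff[OF atoms_pos[OF that]] that \<delta>_pos by simp
  show fin: "finite (atoms \<Lambda> \<inter> {\<epsilon>..K})" if "0 < \<epsilon>" for \<epsilon> K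
    unfolding atoms_eq Int_commute[of "atoms \<Lambda>1"]
    by (intro finite_not_islimpt_in_compact isolated) (use that in auto)
  fix \<epsilon> K :: real assume \<epsilon>: "0 < \<epsilon>"
  \<comment> \<open>For fixed \<epsilon> the value \<open>tail \<Lambda>1 \<epsilon>\<close> is a
    constant, so only the smooth tail of \<Lambda>2 varies with y.\<close>
  define c where "c = (\<lambda>y. (1 / \<delta>) * (tail \<Lambda>2 y + (q + tail \<Lambda>1 \<epsilon>)))"
  have "Ck_on k c {0<..}" for k
    unfolding c_def by (intro Ck_on_cmult Ck_on_add Ck_on_tail2 Ck_on_const)
  moreover have "\<kappa> y = c y - (\<Sum>g\<in>atoms \<Lambda> \<inter> {\<epsilon>..K}. measure \<Lambda> {g} / \<delta> * indicator {g<..} y)"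
    if y: "y \<in> {\<epsilon>..K}" for y
  proof -
    define S where "S = (\<Sum>g\<in>atoms \<Lambda>1 \<inter> {\<epsilon>..K}. measure \<Lambda>1 {g} * indicator {g<..} y)"
    have sum: "(\<Sum>g\<in>atoms \<Lambda> \<inter> {\<epsilon>..K}. measure \<Lambda> {g} / \<delta> * indicator {g<..} y) = S / \<delta>"
      unfolding atoms_eq S_def sum_divide_distrib
      by (intro sum.cong refl) (use \<epsilon> in \<open>auto simp: measure_singleton_eq\<close>)
    have "tail \<Lambda>1 y = tail \<Lambda>1 \<epsilon> - S"
      unfolding S_def using \<epsilon> y fin[OF \<epsilon>, of K] by (intro tail1_step) (simp_all add: atoms_eq)
    then have tail: "tail \<Lambda> y = tail \<Lambda>1 \<epsilon> - S + tail \<Lambda>2 y" using tail_sum[of y] \<epsilon> y by simp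
    have "\<kappa> y = (q + tail \<Lambda> y) / \<delta>" using \<epsilon> y by (simp add: \<kappa>_def)
    then show ?thesis unfolding sum tail c_def by (simp add: add_divide_distrib diff_divide_distrib)
  qed
  ultimately show "\<exists>c. (\<forall>k. Ck_on k c {0<..}) \<and> (\<forall>y\<in>{\<epsilon>..K}. \<kappa> y = c y -
      (\<Sum>g\<in>atoms \<Lambda> \<inter> {\<epsilon>..K}. measure \<Lambda> {g} / \<delta> * indicator {g<..} y))" by blast
qed

lemma renewal_solution_differentiability:
  assumes "blumenthal_getoor \<Lambda> < 1" "causal U" "\<And>x. U x = 1 / \<delta> * trunc_power 1 0 x - conv \<kappa> U x"
  shows "(\<forall>k\<ge>1. \<forall>x>0. times_differentiable_at (k + 1) U x \<longleftrightarrow> x \<notin> atom_sums \<Lambda> k) \<and>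
    (\<forall>x>0. x \<notin> (\<Union>k\<in>{1..}. atom_sums \<Lambda> k) \<longrightarrow> infinitely_differentiable_at U x)"
proof -
  obtain N where N: "N \<ge> 2" "(\<integral>\<^sup>+ z\<in>{0<..1}. ennreal (z powr (1 - 1 / real N)) \<partial>\<Lambda>) < \<infinity>"
    using blumenthal_getoor_less_1[OF assms(1)] .
  have c0: "1 / \<delta> > 0" using \<delta>_pos by simp
  note smoothing = conv_power_smoothing[OF N assms(2)]
  have pos: "times_differentiable_at (Suc k) U x" if "x > 0" "x \<notin> atom_sums \<Lambda> k" for k x
    by (rule Ck_near_imp_times_differentiable_at[OF Ck_near_renewal[OF c0 assms(2,3) smoothing]])
      (use that atom_sums_iff in auto)
  have neg: "\<not> times_differentiable_at (Suc k) U x" if x: "x > 0" "x \<in> atom_sums \<Lambda> k" for k x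
  proof -
    have mem: "x \<in> asums (atoms \<Lambda>) (Suc k)" using x atom_sums_iff by blast
    \<comment> \<open>Minimality gives j = i + 1, where x is a sum of i atoms and of no fewer; j is
      positive because \<open>asums\<close> with index 0 is empty. Failure at order i + 1 \<le> k +
      1 is enough.\<close>
    define j where "j = (LEAST j. x \<in> asums (atoms \<Lambda>) j)"
    have j: "x \<in> asums (atoms \<Lambda>) j" "j \<le> Suc k" unfolding j_def using mem by (auto intro: LeastI Least_le simp del: asums.simps)
    then obtain i where i: "j = Suc i" by (cases j) auto
    have "x \<notin> asums (atoms \<Lambda>) i" using not_less_Least[of i "\<lambda>j. x \<in> asums (atoms \<Lambda>) j"] i by (simp add: j_def)
    then have "\<not> times_differentiable_at (Suc i) U x"
      using not_times_differentiable_renewal[OF c0 assms(2,3) smoothing] j i by blast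
    then show ?thesis using times_differentiable_at_le[of "Suc k" U x "Suc i"] j i by blast
  qed
  have "infinitely_differentiable_at U x" if x: "x > 0" "x \<notin> (\<Union>k\<in>{1..}. atom_sums \<Lambda> k)" for x
    unfolding infinitely_differentiable_at_def
  proof
    fix n
    have "times_differentiable_at (Suc (Suc n)) U x" by (rule pos) (use x in auto)
    then show "times_differentiable_at n U x" by (rule times_differentiable_at_le) simp
  qed
  then show ?thesis using pos neg by auto
qed

end

section \<open>Laplace functionals of Poisson random measures\<close>

text \<open>The function exp (- x) on [0, \<infinity>] with value 0 at \<infinity>. The case
  distinction matters because \<open>enn2real\<close> sends \<top> to 0, and integrals against a
  random measure may be infinite.\<close>

definition exp_neg :: "ennreal \<Rightarrow> ennreal" where
  "exp_neg x = (if x = \<top> then 0 else ennreal (exp (- enn2real x)))"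

lemma exp_neg_ennreal: "r \<ge> 0 \<Longrightarrow> exp_neg (ennreal r) = ennreal (exp (- r))"
  by (simp add: exp_neg_def)

lemma exp_neg_0[simp]: "exp_neg 0 = 1" by (simp add: exp_neg_def)

lemma exp_neg_top[simp]: "exp_neg \<top> = 0" by (simp add: exp_neg_def)

lemma measurable_exp_neg[measurable]: "exp_neg \<in> borel_measurable borel"
  unfolding exp_neg_def[abs_def] by measurable

lemma exp_neg_add: "exp_neg (x + y) = exp_neg x * exp_neg y"
proof (cases "x = \<top> \<or> y = \<top>")
  case False
  then obtain a b where "x = ennreal a" "a \<ge> 0" "y = ennreal b" "b \<ge> 0" by (metis ennreal_cases)
  then show ?thesis by (simp add: exp_neg_ennreal mult_exp_exp flip: ennreal_plus ennreal_mult)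
qed auto

lemma exp_neg_sum: "exp_neg (\<Sum>i\<in>I. f i) = (\<Prod>i\<in>I. exp_neg (f i))"
  by (induction I rule: infinite_finite_induct) (auto simp: exp_neg_add)

lemma exp_neg_le_1: "exp_neg x \<le> 1"
  by (auto simp: exp_neg_def)

lemma exp_neg_antimono: assumes "x \<le> y" shows "exp_neg y \<le> exp_neg x"
proof -
  obtain d where "y = x + d" using assms by (metis le_iff_add)
  then show ?thesis using mult_left_mono[OF exp_neg_le_1[of d], of "exp_neg x"] by (simp add: exp_neg_add)
qed

lemma exp_neg_tendsto:
  assumes "X \<longlonglongrightarrow> x" shows "(\<lambda>n. exp_neg (X n)) \<longlonglongrightarrow> exp_neg x"
proof (cases "x = \<top>")
  case True
  have "(\<lambda>n. exp_neg (X n)) \<longlonglongrightarrow> 0"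
  proof (rule order_tendstoI)
    fix a :: ennreal assume a: "0 < a"
    obtain r where r: "r > 0" "ennreal r < a"
      using a by (metis dense ennreal_cases ennreal_less_zero_iff less_top order_less_trans top.extremum_strict)
    have "\<forall>\<^sub>F n in sequentially. ennreal \<bar>ln r\<bar> < X n"
      using assms True by (intro order_tendstoD(1)) auto
    then show "\<forall>\<^sub>F n in sequentially. exp_neg (X n) < a"
    proof eventually_elim
      case (elim n)
      then have "exp_neg (X n) \<le> exp_neg (ennreal \<bar>ln r\<bar>)" by (intro exp_neg_antimono) auto
      also have "exp (- \<bar>ln r\<bar>) \<le> r"
        using r(1) by (metis abs_ge_minus_self exp_le_cancel_iff exp_ln minus_le_iff)
      then have "exp_neg (ennreal \<bar>ln r\<bar>) \<le> ennreal r" by (simp add: exp_neg_ennreal ennreal_leI)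
      finally show ?case using r(2) by (rule le_less_trans)
    qed
  qed auto
  then show ?thesis using True by simp
next
  case False
  have "\<forall>\<^sub>F n in sequentially. X n < \<top>"
    using assms False by (intro order_tendstoD(2)) (auto simp: less_top)
  then have ev: "\<forall>\<^sub>F n in sequentially. ennreal (exp (- enn2real (X n))) = exp_neg (X n)"
    by eventually_elim (auto simp: exp_neg_def)
  have "(\<lambda>n. enn2real (X n)) \<longlonglongrightarrow> enn2real x"
    using assms False tendsto_enn2real[of X "enn2real x" sequentially] by (simp add: less_top)
  then have "(\<lambda>n. ennreal (exp (- enn2real (X n)))) \<longlonglongrightarrow> ennreal (exp (- enn2real x))"
    by (intro tendsto_ennrealI tendsto_exp tendsto_minus)
  then show ?thesis using False Lim_transform_eventually[OF _ ev] by (simp add: exp_neg_def)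
qed

text \<open>A priori K may take any value in [0, \<infinity>]. The Poisson weights sum to 1, so K is
  almost surely a natural number and the expectation is an exponential series.\<close>

lemma poisson_Laplace:
  assumes M: "prob_space M" and [measurable]: "K \<in> borel_measurable M"
    and p: "\<And>n. measure M {\<omega>\<in>space M. K \<omega> = of_nat n} = m ^ n / fact n * exp (- m)"
    and m: "m \<ge> 0" and c: "c < \<top>"
  shows "(\<integral>\<^sup>+ \<omega>. exp_neg (c * K \<omega>) \<partial>M) = exp_neg ((1 - exp_neg c) * ennreal m)"
proof -
  interpret prob_space M by (rule M)
  obtain a where a: "c = ennreal a" "a \<ge> 0" using c by (metis ennreal_cases less_top)
  let ?B = "\<lambda>n::nat. {\<omega>\<in>space M. K \<omega> = of_nat n}"
  have Bm[measurable]: "?B n \<in> sets M" for n by measurable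
  have disj: "disjoint_family ?B" by (auto simp: disjoint_family_on_def)
  have sums1: "(\<lambda>n. m ^ n / fact n * exp (- m)) sums 1"
    using sums_mult2[OF exp_converges[of m], of "exp (- m)"] by (simp add: exp_minus divide_inverse mult.commute)
  have "(\<lambda>n. measure M (?B n)) sums measure M (\<Union>n. ?B n)"
    by (intro finite_measure_UNION disj) auto
  then have "measure M (\<Union>n. ?B n) = 1" using sums_unique2 sums1 unfolding p by blast
  then have AEB: "AE \<omega> in M. \<omega> \<in> (\<Union>n. ?B n)" by (intro prob_eq_1[THEN iffD1]) auto
  have "(\<integral>\<^sup>+ \<omega>. exp_neg (c * K \<omega>) \<partial>M) = (\<integral>\<^sup>+ \<omega>. (\<Sum>n. ennreal (exp (- (a * real n))) * indicator (?B n) \<omega>) \<partial>M)"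
  proof (intro nn_integral_cong_AE, use AEB in eventually_elim)
    case (elim \<omega>)
    then obtain n where n: "\<omega> \<in> ?B n" by blast
    have "(\<Sum>k. ennreal (exp (- (a * real k))) * indicator (?B k) \<omega>)
       = (\<Sum>k\<in>{n}. ennreal (exp (- (a * real k))) * indicator (?B k) \<omega>)"
      using n by (intro suminf_finite) (auto simp: indicator_def)
    also have "\<dots> = exp_neg (c * K \<omega>)"
      using n a by (simp add: ennreal_of_nat_eq_real_of_nat exp_neg_ennreal flip: ennreal_mult)
    finally show ?case by simp
  qed
  also have "\<dots> = (\<Sum>n. ennreal (exp (- (a * real n))) * emeasure M (?B n))"
    by (subst nn_integral_suminf) (auto simp: nn_integral_cmult_indicator)
  also have "\<dots> = (\<Sum>n. ennreal (exp (- (a * real n)) * (m ^ n / fact n * exp (- m))))"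
    using m by (intro suminf_cong) (simp add: emeasure_eq_measure p flip: ennreal_mult)
  also have "\<dots> = (\<Sum>n. ennreal (exp (- m) * ((m * exp (- a)) ^ n /\<^sub>R fact n)))"
    by (intro suminf_cong arg_cong[where f = ennreal])
      (simp add: power_mult_distrib exp_of_nat_mult[symmetric] divide_inverse mult_ac)
  also have "\<dots> = ennreal (exp (- m) * exp (m * exp (- a)))"
    using m by (intro suminf_ennreal_eq sums_mult exp_converges) (auto intro!: mult_nonneg_nonneg)
  also have "\<dots> = exp_neg ((1 - exp_neg c) * ennreal m)"
  proof -
    have "(1 - exp_neg c) * ennreal m = ennreal ((1 - exp (- a)) * m)"
      using a m by (simp add: exp_neg_ennreal ennreal_mult' flip: ennreal_minus ennreal_1)
    moreover have "0 \<le> (1 - exp (- a)) * m" using a m by auto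
    ultimately show ?thesis by (simp add: exp_neg_ennreal algebra_simps flip: exp_add)
  qed
  finally show ?thesis .
qed

lemma simple_function_restrict_sets_cong:
  "sets M = sets N \<Longrightarrow> simple_function M f \<longleftrightarrow> simple_function N f"
  by (auto simp: simple_function_def dest: sets_eq_imp_space_eq)

text \<open>The value 0 is left out because its level set may have infinite intensity. The remaining
  values are enumerated by naturals to match the independence clause of
  \<open>poisson_random_measure\<close>.\<close>

lemma nn_integral_simple_nonzero:
  assumes "simple_function M f" "bij_betw h {..<n} (f ` space M - {0})"
  shows "nn_integral M f = (\<Sum>i<n. h i * emeasure M (f -` {h i} \<inter> space M))"
proof -
  have fin: "finite (f ` space M)" using assms(1) by (rule simple_functionD)
  have "nn_integral M f = (\<Sum>v\<in>f ` space M. v * emeasure M (f -` {v} \<inter> space M))"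
    using assms(1) by (simp add: nn_integral_eq_simple_integral simple_integral_def)
  also have "\<dots> = (\<Sum>v\<in>f ` space M - {0}. v * emeasure M (f -` {v} \<inter> space M))"
    using fin by (intro sum.mono_neutral_right) auto
  also have "\<dots> = (\<Sum>i<n. h i * emeasure M (f -` {h i} \<inter> space M))"
    using sum.reindex_bij_betw[OF assms(2), of "\<lambda>v. v * emeasure M (f -` {v} \<inter> space M)"] by simp
  finally show ?thesis .
qed

text \<open>Level sets of distinct nonzero values are disjoint and, by \<open>fin\<close>, of finite
  intensity. Their counts are independent Poisson variables, and the expectation factorises.\<close>

lemma Laplace_simple:
  assumes M: "prob_space M" and N: "poisson_random_measure M N \<nu>"
    and f: "simple_function \<nu> f" "\<And>x. f x < \<top>"
    and fin: "\<And>v. v > 0 \<Longrightarrow> emeasure \<nu> {x\<in>space \<nu>. v \<le> f x} < \<infinity>"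
  shows "(\<integral>\<^sup>+ \<omega>. exp_neg (\<integral>\<^sup>+ x. f x \<partial>N \<omega>) \<partial>M) = exp_neg (\<integral>\<^sup>+ x. (1 - exp_neg (f x)) \<partial>\<nu>)"
    and "(\<lambda>\<omega>. \<integral>\<^sup>+ x. f x \<partial>N \<omega>) \<in> borel_measurable M"
proof -
  interpret prob_space M by (rule M)
  have setsN: "\<And>\<omega>. \<omega> \<in> space M \<Longrightarrow> sets (N \<omega>) = sets \<nu>"
    and meas: "\<And>A. A \<in> sets \<nu> \<Longrightarrow> (\<lambda>\<omega>. emeasure (N \<omega>) A) \<in> borel_measurable M"
    and pois: "\<And>A n. A \<in> sets \<nu> \<Longrightarrow> emeasure \<nu> A < \<infinity> \<Longrightarrow>
      measure M {\<omega>\<in>space M. emeasure (N \<omega>) A = of_nat n} = measure \<nu> A ^ n / fact n * exp (- measure \<nu> A)"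
    and ind: "\<And>n (A :: nat \<Rightarrow> 'b set). (\<forall>i<n. A i \<in> sets \<nu>) \<and> disjoint_family_on A {..<n} \<Longrightarrow>
        indep_vars (\<lambda>_. borel) (\<lambda>i \<omega>. emeasure (N \<omega>) (A i)) {..<n}"
    using N unfolding poisson_random_measure_def by blast+
  have finV: "finite (f ` space \<nu> - {0})" using f(1) by (auto dest: simple_functionD)
  obtain h where h: "bij_betw h {..<card (f ` space \<nu> - {0})} (f ` space \<nu> - {0})"
    using ex_bij_betw_nat_finite[OF finV] by (auto simp: atLeast0LessThan)
  define n where "n = card (f ` space \<nu> - {0})"
  note h = h[folded n_def]
  define A where "A i = f -` {h i} \<inter> space \<nu>" for i
  have hi: "h i \<in> f ` space \<nu>" "h i \<noteq> 0" "h i < \<top>" if "i < n" for i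
  proof -
    have *: "h i \<in> f ` space \<nu> - {0}" using bij_betwE[OF h] that by auto
    then show "h i \<in> f ` space \<nu>" "h i \<noteq> 0" by auto
    show "h i < \<top>" using * f(2) by force
  qed
  have A: "A i \<in> sets \<nu>" for i
    unfolding A_def using f(1) by (rule simple_functionD)
  have disj: "disjoint_family_on A {..<n}"
    using h by (auto simp: disjoint_family_on_def A_def bij_betw_def inj_on_def)
  have A_fin: "emeasure \<nu> (A i) < \<infinity>" if "i < n" for i
  proof -
    have "h i > 0" using hi(2)[OF that] by (simp add: zero_less_iff_neq_zero)
    have "emeasure \<nu> (A i) \<le> emeasure \<nu> {x\<in>space \<nu>. h i \<le> f x}"
    proof (rule emeasure_mono)
      show "{x\<in>space \<nu>. h i \<le> f x} \<in> sets \<nu>"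
        using borel_measurable_simple_function[OF f(1)] by measurable
    qed (auto simp: A_def)
    also have "\<dots> < \<infinity>" by (rule fin) fact
    finally show ?thesis .
  qed
  have int: "(\<integral>\<^sup>+ x. f x \<partial>N \<omega>) = (\<Sum>i<n. h i * emeasure (N \<omega>) (A i))" if "\<omega> \<in> space M" for \<omega>
    using nn_integral_simple_nonzero[of "N \<omega>" f h n] f(1) h simple_function_restrict_sets_cong[OF setsN[OF that], of f]
      sets_eq_imp_space_eq[OF setsN[OF that]] by (simp add: A_def)
  have measS: "(\<lambda>\<omega>. \<Sum>i<n. h i * emeasure (N \<omega>) (A i)) \<in> borel_measurable M"
    using meas[OF A] by measurable
  then show "(\<lambda>\<omega>. \<integral>\<^sup>+ x. f x \<partial>N \<omega>) \<in> borel_measurable M"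
    by (subst measurable_cong[OF int]) auto
  have "(\<integral>\<^sup>+ \<omega>. exp_neg (\<integral>\<^sup>+ x. f x \<partial>N \<omega>) \<partial>M) = (\<integral>\<^sup>+ \<omega>. (\<Prod>i<n. exp_neg (h i * emeasure (N \<omega>) (A i))) \<partial>M)"
    by (intro nn_integral_cong) (simp add: int exp_neg_sum)
  also have "\<dots> = (\<Prod>i<n. (\<integral>\<^sup>+ \<omega>. exp_neg (h i * emeasure (N \<omega>) (A i)) \<partial>M))"
  proof (rule indep_vars_nn_integral)
    have "indep_vars (\<lambda>_. borel) (\<lambda>i \<omega>. emeasure (N \<omega>) (A i)) {..<n}"
      by (intro ind conjI disj) (use A in auto)
    then show "indep_vars (\<lambda>_. borel) (\<lambda>i \<omega>. exp_neg (h i * emeasure (N \<omega>) (A i))) {..<n}"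
      by (rule indep_vars_compose2[where Y = "\<lambda>i x. exp_neg (h i * x)"]) measurable
  qed auto
  also have "\<dots> = (\<Prod>i<n. exp_neg ((1 - exp_neg (h i)) * emeasure \<nu> (A i)))"
  proof (intro prod.cong refl)
    fix i assume "i \<in> {..<n}"
    then have i: "i < n" by simp
    show "(\<integral>\<^sup>+ \<omega>. exp_neg (h i * emeasure (N \<omega>) (A i)) \<partial>M) = exp_neg ((1 - exp_neg (h i)) * emeasure \<nu> (A i))"
      using poisson_Laplace[OF M meas[OF A] pois[OF A A_fin[OF i]] _ hi(3)[OF i]] A_fin[OF i]
      by (simp add: emeasure_eq_ennreal_measure less_top)
  qed
  also have "\<dots> = exp_neg (\<Sum>i<n. (1 - exp_neg (h i)) * emeasure \<nu> (A i))" by (simp add: exp_neg_sum)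
  also have "(\<Sum>i<n. (1 - exp_neg (h i)) * emeasure \<nu> (A i)) = (\<integral>\<^sup>+ x. (\<Sum>i<n. (1 - exp_neg (h i)) * indicator (A i) x) \<partial>\<nu>)"
    using A by (subst nn_integral_sum) (auto simp: nn_integral_cmult_indicator)
  also have "\<dots> = (\<integral>\<^sup>+ x. (1 - exp_neg (f x)) \<partial>\<nu>)"
  proof (rule nn_integral_cong)
    fix x assume x: "x \<in> space \<nu>"
    show "(\<Sum>i<n. (1 - exp_neg (h i)) * indicator (A i) x) = 1 - exp_neg (f x)"
    proof (cases "f x = 0")
      case True
      then have "(\<Sum>i<n. (1 - exp_neg (h i)) * indicator (A i) x) = 0"
        using hi(2) by (intro sum.neutral) (auto simp: A_def indicator_def)
      then show ?thesis using True by simp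
    next
      case False
      then have "f x \<in> f ` space \<nu> - {0}" using x by auto
      then obtain j where j: "j < n" "h j = f x" using h by (metis bij_betw_imp_surj_on imageE lessThan_iff)
      have "(\<Sum>i<n. (1 - exp_neg (h i)) * indicator (A i) x) = (\<Sum>i\<in>{j}. (1 - exp_neg (h i)) * indicator (A i) x)"
        using j h by (intro sum.mono_neutral_right) (auto simp: A_def indicator_def bij_betw_def inj_on_def)
      also have "\<dots> = 1 - exp_neg (f x)" using j x by (simp add: A_def)
      finally show ?thesis .
    qed
  qed
  finally show "(\<integral>\<^sup>+ \<omega>. exp_neg (\<integral>\<^sup>+ x. f x \<partial>N \<omega>) \<partial>M) = exp_neg (\<integral>\<^sup>+ x. (1 - exp_neg (f x)) \<partial>\<nu>)" .
qed

text \<open>Along increasing simple approximations of f, the left side converges with majorant 1,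
  and the exponent on the right by monotone convergence.\<close>

lemma Laplace_functional:
  assumes M: "prob_space M" and N: "poisson_random_measure M N \<nu>"
    and f[measurable]: "f \<in> borel_measurable \<nu>"
    and fin: "\<And>v. v > 0 \<Longrightarrow> emeasure \<nu> {x\<in>space \<nu>. v \<le> f x} < \<infinity>"
  shows "(\<integral>\<^sup>+ \<omega>. exp_neg (\<integral>\<^sup>+ x. f x \<partial>N \<omega>) \<partial>M) = exp_neg (\<integral>\<^sup>+ x. (1 - exp_neg (f x)) \<partial>\<nu>)"
proof -
  interpret prob_space M by (rule M)
  obtain g where g: "\<And>i. simple_function \<nu> (g i)" "incseq g" "\<And>i x. g i x < \<top>" "\<And>x. (SUP i. g i x) = f x"
    using borel_measurable_implies_simple_function_sequence'[OF f] by blast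
  have setsN: "\<And>\<omega>. \<omega> \<in> space M \<Longrightarrow> sets (N \<omega>) = sets \<nu>"
    using N unfolding poisson_random_measure_def by blast
  have g_le: "g i x \<le> f x" for i x using g(4)[of x] by (metis SUP_upper UNIV_I)
  have fin_g: "emeasure \<nu> {x\<in>space \<nu>. v \<le> g i x} < \<infinity>" if "v > 0" for i v
  proof -
    have "emeasure \<nu> {x\<in>space \<nu>. v \<le> g i x} \<le> emeasure \<nu> {x\<in>space \<nu>. v \<le> f x}"
      using order_trans[OF _ g_le] by (intro emeasure_mono) auto
    then show ?thesis using fin[OF that] by (rule le_less_trans)
  qed
  have simple: "(\<integral>\<^sup>+ \<omega>. exp_neg (\<integral>\<^sup>+ x. g i x \<partial>N \<omega>) \<partial>M) = exp_neg (\<integral>\<^sup>+ x. (1 - exp_neg (g i x)) \<partial>\<nu>)"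
    "(\<lambda>\<omega>. \<integral>\<^sup>+ x. g i x \<partial>N \<omega>) \<in> borel_measurable M" for i
    using Laplace_simple[OF M N g(1,3)] fin_g by auto
  have inc: "incseq (\<lambda>i. g i x)" for x using g(2) by (auto simp: incseq_def le_fun_def)
  have gm[measurable]: "g i \<in> borel_measurable \<nu>" for i by (rule borel_measurable_simple_function[OF g(1)])
  have eqN: "(\<integral>\<^sup>+ x. f x \<partial>N \<omega>) = (SUP i. \<integral>\<^sup>+ x. g i x \<partial>N \<omega>)" if "\<omega> \<in> space M" for \<omega>
  proof -
    have [measurable]: "g i \<in> borel_measurable (N \<omega>)" for i
      using gm by (simp add: measurable_cong_sets[OF setsN[OF that] refl])
    show ?thesis
      unfolding g(4)[symmetric] by (intro nn_integral_monotone_convergence_SUP g) auto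
  qed
  have limN: "(\<lambda>i. \<integral>\<^sup>+ x. g i x \<partial>N \<omega>) \<longlonglongrightarrow> (\<integral>\<^sup>+ x. f x \<partial>N \<omega>)" if "\<omega> \<in> space M" for \<omega>
  proof -
    have "incseq (\<lambda>i. \<integral>\<^sup>+ x. g i x \<partial>N \<omega>)"
      using g(2) by (auto simp: incseq_def le_fun_def intro!: nn_integral_mono)
    then show ?thesis unfolding eqN[OF that] by (rule LIMSEQ_SUP)
  qed
  have limf: "(\<lambda>i. g i x) \<longlonglongrightarrow> f x" for x using LIMSEQ_SUP[OF inc[of x]] g(4)[of x] by simp
  have meas: "(\<lambda>\<omega>. \<integral>\<^sup>+ x. f x \<partial>N \<omega>) \<in> borel_measurable M"
    using simple(2) by (subst measurable_cong[OF eqN]) auto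
  have L: "(\<lambda>i. \<integral>\<^sup>+ \<omega>. exp_neg (\<integral>\<^sup>+ x. g i x \<partial>N \<omega>) \<partial>M) \<longlonglongrightarrow> (\<integral>\<^sup>+ \<omega>. exp_neg (\<integral>\<^sup>+ x. f x \<partial>N \<omega>) \<partial>M)"
    by (rule nn_integral_dominated_convergence[where w = "\<lambda>_. 1"])
      (use simple(2) meas in \<open>auto simp: exp_neg_le_1 emeasure_space_1 intro!: exp_neg_tendsto limN measurable_compose[OF _ measurable_exp_neg]\<close>)
  have mono1: "1 - exp_neg x \<le> 1 - exp_neg y" if "x \<le> y" for x y
    using exp_neg_antimono[OF that] by (intro ennreal_minus_mono) auto
  have lim1: "(\<lambda>i. 1 - exp_neg (g i x)) \<longlonglongrightarrow> 1 - exp_neg (f x)" for x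
    by (intro tendsto_diff_ennreal tendsto_const exp_neg_tendsto limf) (auto simp: exp_neg_def)
  have inc1: "incseq (\<lambda>i. 1 - exp_neg (g i x))" for x using inc[of x] by (auto simp: incseq_def intro!: mono1)
  have "(\<lambda>i. \<integral>\<^sup>+ x. (1 - exp_neg (g i x)) \<partial>\<nu>) \<longlonglongrightarrow> (\<integral>\<^sup>+ x. (1 - exp_neg (f x)) \<partial>\<nu>)"
  proof -
    have "(SUP i. 1 - exp_neg (g i x)) = 1 - exp_neg (f x)" for x
      using LIMSEQ_unique[OF LIMSEQ_SUP[OF inc1] lim1] .
    then have "(\<integral>\<^sup>+ x. (1 - exp_neg (f x)) \<partial>\<nu>) = (SUP i. \<integral>\<^sup>+ x. (1 - exp_neg (g i x)) \<partial>\<nu>)"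
      using nn_integral_monotone_convergence_SUP[of "\<lambda>i x. 1 - exp_neg (g i x)" \<nu>] inc1
      by (simp add: incseq_def le_fun_def)
    then show ?thesis
      using LIMSEQ_SUP[of "\<lambda>i. \<integral>\<^sup>+ x. (1 - exp_neg (g i x)) \<partial>\<nu>"] inc1
      by (auto simp: incseq_def intro!: nn_integral_mono)
  qed
  then have R: "(\<lambda>i. exp_neg (\<integral>\<^sup>+ x. (1 - exp_neg (g i x)) \<partial>\<nu>)) \<longlonglongrightarrow> exp_neg (\<integral>\<^sup>+ x. (1 - exp_neg (f x)) \<partial>\<nu>)"
    by (rule exp_neg_tendsto)
  show ?thesis by (rule LIMSEQ_unique[OF L[unfolded simple(1)] R])
qed

section \<open>The Laplace transform of a subordinator\<close>

lemma jump_nonneg: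
  assumes "cadlag f" "mono_on {0..} f" "s > 0"
  shows "jump f s \<ge> 0"
proof -
  obtain l where l: "(f \<longlongrightarrow> l) (at_left s)" using assms(1,3) by (auto simp: cadlag_def)
  then have "Lim (at_left s) f = l" by (intro tendsto_Lim) auto
  moreover have "\<forall>\<^sub>F r in at_left s. f r \<le> f s"
  proof (rule eventually_mono)
    show "\<forall>\<^sub>F r in at_left s. 0 < r \<and> r < s"
      using assms(3) by (auto simp: eventually_at_left_field)
    show "f r \<le> f s" if "0 < r \<and> r < s" for r
      using mono_onD[OF assms(2), of r s] that by auto
  qed
  then have "l \<le> f s" by (intro tendsto_upperbound[OF l]) auto
  ultimately show ?thesis by (simp add: jump_def)
qed

lemma nn_integral_count_space_has_sum:
  fixes f :: "'a \<Rightarrow> real"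
  assumes "(f has_sum S) A" "\<And>x. x \<in> A \<Longrightarrow> f x \<ge> 0"
  shows "(\<integral>\<^sup>+ x. ennreal (f x) \<partial>count_space A) = ennreal S"
proof -
  have s: "f summable_on A" using assms(1) by (auto simp: summable_on_def)
  have "(\<lambda>x. norm (f x)) summable_on A" using s by (rule summable_on_cong[THEN iffD1, rotated]) (use assms(2) in auto)
  then have "Infinite_Set_Sum.abs_summable_on f A" unfolding abs_summable_equivalent[symmetric] .
  then have "(\<integral>\<^sup>+ x. ennreal (f x) \<partial>count_space A) = ennreal (infsetsum f A)"
    by (rule nn_integral_conv_infsetsum) (use assms(2) in auto)
  also have "infsetsum f A = infsum f A"
    using \<open>Infinite_Set_Sum.abs_summable_on f A\<close> by (rule infsetsum_infsum)
  also have "infsum f A = S" using assms(1) by (rule infsumI)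
  finally show ?thesis .
qed

locale subord =
  fixes M :: "'a measure" and X :: "real \<Rightarrow> 'a \<Rightarrow> real" and \<delta> q :: real and \<Lambda> :: "real measure"
  assumes sub: "subordinator M X \<delta> \<Lambda>" and \<delta>0: "\<delta> > 0" and q0: "q \<ge> 0"
begin

sublocale levy_kernel \<Lambda> q \<delta>
  using sub \<delta>0 q0 by unfold_locales (auto simp: subordinator_def)

lemma levy_process: "levy_process M X" using sub by (simp add: subordinator_def)

sublocale P: prob_space M using levy_process by (simp add: levy_process_def)

lemma X_measurable[measurable]: "t \<ge> 0 \<Longrightarrow> X t \<in> borel_measurable M"
  using levy_process by (simp add: levy_process_def)

definition good :: "'a \<Rightarrow> bool" where
  "good \<omega> \<longleftrightarrow> cadlag (\<lambda>t. X t \<omega>) \<and> mono_on {0..} (\<lambda>t. X t \<omega>) \<and>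
    (\<forall>t\<ge>0. ((\<lambda>s. jump (\<lambda>r. X r \<omega>) s) has_sum (X t \<omega> - \<delta> * t)) {0<..t})"

lemma AE_good: "AE \<omega> in M. good \<omega>"
proof -
  have "AE \<omega> in M. cadlag (\<lambda>t. X t \<omega>)" using levy_process by (simp add: levy_process_def)
  moreover have "AE \<omega> in M. mono_on {0..} (\<lambda>t. X t \<omega>)" using sub by (simp add: subordinator_def)
  moreover have "AE \<omega> in M. \<forall>t\<ge>0. ((\<lambda>s. jump (\<lambda>r. X r \<omega>) s) has_sum (X t \<omega> - \<delta> * t)) {0<..t}"
    using sub by (simp add: subordinator_def)
  ultimately show ?thesis by eventually_elim (simp add: good_def)
qed

lemma good_ge: assumes "good \<omega>" "t \<ge> 0" shows "X t \<omega> \<ge> \<delta> * t"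
proof -
  have "((\<lambda>s. jump (\<lambda>r. X r \<omega>) s) has_sum (X t \<omega> - \<delta> * t)) {0<..t}"
    using assms by (simp add: good_def)
  then have "0 \<le> X t \<omega> - \<delta> * t"
    by (rule has_sum_nonneg) (use assms jump_nonneg in \<open>auto simp: good_def\<close>)
  then show ?thesis by simp
qed

text \<open>The jump part of the Laplace exponent, the full exponent being \<delta> c + \<psi>
  c.\<close>

definition \<psi> :: "real \<Rightarrow> real" where
  "\<psi> c = enn2real (\<integral>\<^sup>+ z. ennreal (1 - exp (- (c * z))) \<partial>\<Lambda>)"

lemma psi_finite:
  assumes "c > 0" shows "(\<integral>\<^sup>+ z. ennreal (1 - exp (- (c * z))) \<partial>\<Lambda>) = ennreal (\<psi> c)"
proof -
  have "(\<integral>\<^sup>+ z. ennreal (1 - exp (- (c * z))) \<partial>\<Lambda>) \<le> (\<integral>\<^sup>+ z. ennreal (max 1 c) * ennreal (min 1 z) \<partial>\<Lambda>)"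
  proof (intro nn_integral_mono_AE, use AE_levy_pos in eventually_elim)
    case (elim z)
    have 1: "1 - exp (- (c * z)) \<le> c * z" using exp_ge_add_one_self[of "- (c * z)"] by linarith
    have 2: "c * z \<le> max 1 c * z" using elim by (intro mult_right_mono) auto
    have 3: "1 - exp (- (c * z)) \<le> max 1 c" using exp_ge_zero[of "- (c * z)"] by linarith
    have "1 - exp (- (c * z)) \<le> max 1 c * min 1 z"
    proof (cases "z \<le> 1")
      case True then show ?thesis using order_trans[OF 1 2] by simp
    next
      case False then show ?thesis using 3 by simp
    qed
    then show ?case using elim by (simp add: ennreal_leI flip: ennreal_mult)
  qed
  also have "\<dots> = ennreal (max 1 c) * (\<integral>\<^sup>+ z. ennreal (min 1 z) \<partial>\<Lambda>)"
    by (intro nn_integral_cmult) simp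
  also have "\<dots> < \<infinity>" using nn_integral_min_levy by (auto simp: ennreal_mult_less_top)
  finally show ?thesis by (simp add: \<psi>_def)
qed

lemma psi_nonneg: "\<psi> c \<ge> 0" by (simp add: \<psi>_def)

text \<open>The Laplace functional is applied to c z on jump times in (0, t]. Almost surely its
  integral against N is c times the sum of the jumps up to t, that is c (X t - \<delta> t), and the
  drift is restored at the end.\<close>

lemma Laplace_X:
  assumes t: "t \<ge> 0" and c: "c > 0"
  shows "(\<integral>\<^sup>+ \<omega>. ennreal (exp (- (c * X t \<omega>))) \<partial>M) = ennreal (exp (- (t * (\<delta> * c + \<psi> c))))"
proof -
  define \<mu> where "\<mu> = density lborel (indicator {0<..} :: real \<Rightarrow> ennreal)"
  define \<nu> where "\<nu> = \<mu> \<Otimes>\<^sub>M \<Lambda>"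
  obtain N where N: "poisson_random_measure M N \<nu>"
    and NA: "AE \<omega> in M. \<forall>A\<in>sets (borel \<Otimes>\<^sub>M borel). emeasure (N \<omega>) A = emeasure (count_space UNIV)
             {s. 0 < s \<and> jump (\<lambda>r. X r \<omega>) s \<noteq> 0 \<and> (s, jump (\<lambda>r. X r \<omega>) s) \<in> A}"
    using sub unfolding subordinator_def \<nu>_def \<mu>_def by blast
  have sets_\<nu>: "sets \<nu> = sets (borel \<Otimes>\<^sub>M borel)"
    unfolding \<nu>_def by (rule sets_pair_measure_cong) (simp_all add: \<mu>_def)
  have space_\<nu>: "space \<nu> = UNIV" using sets_eq_imp_space_eq[OF sets_\<nu>] by (simp add: space_pair_measure)
  define f where "f = (\<lambda>(s, z). indicator {0<..t} s * ennreal (c * z))"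
  have f_bor: "f \<in> borel_measurable (borel \<Otimes>\<^sub>M borel)" unfolding f_def by measurable
  have f[measurable]: "f \<in> borel_measurable \<nu>"
    using f_bor measurable_cong_sets[OF sets_\<nu> refl] by blast
  \<comment> \<open>Exceeding the level r means s \<le> t and z \<ge> r / c, a set of intensity at
    most t times the tail of \<Lambda> at r / c.\<close>
  have "emeasure \<nu> {x\<in>space \<nu>. v \<le> f x} < \<infinity>" if v: "v > 0" for v
  proof (cases "v = \<top>")
    case True
    have "f x < \<top>" for x by (cases x) (simp add: f_def indicator_def)
    then have eq: "{x\<in>space \<nu>. v \<le> f x} = {}" using True by (auto simp: not_le)
    show ?thesis unfolding eq by simp
  next
    case False
    then obtain r where r: "v = ennreal r" "r > 0" using v by (cases v) auto
    have "emeasure \<nu> {x\<in>space \<nu>. v \<le> f x} \<le> emeasure \<nu> ({0<..t} \<times> {r / c..})"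
    proof (rule emeasure_mono)
      show "{x\<in>space \<nu>. v \<le> f x} \<subseteq> {0<..t} \<times> {r / c..}"
      proof (clarsimp)
        fix s z assume le: "v \<le> f (s, z)"
        have s: "s \<in> {0<..t}"
        proof (rule ccontr)
          assume "s \<notin> {0<..t}"
          then have "f (s, z) = 0" by (simp add: f_def)
          then show False using le v by simp
        qed
        then have "ennreal r \<le> ennreal (c * z)" using le r by (simp add: f_def)
        then have "r \<le> c * z" using r(2) unfolding ennreal_le_iff2 by linarith
        then show "0 < s \<and> s \<le> t \<and> r / c \<le> z" using s c by (simp add: field_simps)
      qed
      show "{0<..t} \<times> {r / c..} \<in> sets \<nu>" unfolding \<nu>_def by (intro pair_measureI) (auto simp: \<mu>_def)
    qed
    also have "\<dots> = emeasure \<mu> {0<..t} * emeasure \<Lambda> {r / c..}"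
      unfolding \<nu>_def by (rule emeasure_pair_measure_Times) (auto simp: \<mu>_def)
    also have "emeasure \<mu> {0<..t} \<le> emeasure lborel {0<..t}"
      unfolding \<mu>_def by (subst emeasure_density) (auto intro!: nn_integral_mono simp: indicator_def simp flip: nn_integral_indicator)
    then have "emeasure \<mu> {0<..t} * emeasure \<Lambda> {r / c..} < \<infinity>"
      using emeasure_tail_finite[of "r / c"] r c t by (auto simp: ennreal_mult_less_top intro: le_less_trans)
    finally show ?thesis .
  qed
  from Laplace_functional[OF P.prob_space_axioms N f this]
  have L: "(\<integral>\<^sup>+ \<omega>. exp_neg (\<integral>\<^sup>+ x. f x \<partial>N \<omega>) \<partial>M) = exp_neg (\<integral>\<^sup>+ x. (1 - exp_neg (f x)) \<partial>\<nu>)" .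
  have "(\<integral>\<^sup>+ x. (1 - exp_neg (f x)) \<partial>\<nu>) = (\<integral>\<^sup>+ s. (\<integral>\<^sup>+ z. (1 - exp_neg (f (s, z))) \<partial>\<Lambda>) \<partial>\<mu>)"
    unfolding \<nu>_def by (rule nn_integral_fst[symmetric]) (simp flip: \<nu>_def)
  also have "\<dots> = (\<integral>\<^sup>+ s. indicator {0<..t} s * ennreal (\<psi> c) \<partial>\<mu>)"
  proof (intro nn_integral_cong)
    fix s
    show "(\<integral>\<^sup>+ z. (1 - exp_neg (f (s, z))) \<partial>\<Lambda>) = indicator {0<..t} s * ennreal (\<psi> c)"
    proof (cases "s \<in> {0<..t}")
      case True
      have "(\<integral>\<^sup>+ z. (1 - exp_neg (f (s, z))) \<partial>\<Lambda>) = (\<integral>\<^sup>+ z. ennreal (1 - exp (- (c * z))) \<partial>\<Lambda>)"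
      proof (intro nn_integral_cong_AE, use AE_levy_pos in eventually_elim)
        case (elim z)
        then have eq: "exp_neg (f (s, z)) = ennreal (exp (- (c * z)))" using True c by (simp add: f_def exp_neg_ennreal)
        show ?case unfolding eq ennreal_1[symmetric] by (rule ennreal_minus) simp
      qed
      then show ?thesis using True by (simp add: psi_finite[OF c])
    qed (simp add: f_def)
  qed
  also have "\<dots> = ennreal (t * \<psi> c)"
  proof -
    have "(\<integral>\<^sup>+ s. indicator {0<..t} s * ennreal (\<psi> c) \<partial>\<mu>) = (\<integral>\<^sup>+ s. ennreal (\<psi> c) * indicator {0<..t} s \<partial>lborel)"
      unfolding \<mu>_def by (subst nn_integral_density) (auto intro!: nn_integral_cong simp: indicator_def)
    also have "\<dots> = ennreal (\<psi> c) * ennreal t" using t by (simp add: nn_integral_cmult_indicator)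
    finally show ?thesis using t by (simp add: psi_nonneg mult.commute flip: ennreal_mult)
  qed
  finally have R: "exp_neg (\<integral>\<^sup>+ x. (1 - exp_neg (f x)) \<partial>\<nu>) = ennreal (exp (- (t * \<psi> c)))"
    using t by (simp add: exp_neg_ennreal psi_nonneg)
  have setsN: "\<And>\<omega>. \<omega> \<in> space M \<Longrightarrow> sets (N \<omega>) = sets \<nu>"
    using N unfolding poisson_random_measure_def by blast
  have "(\<integral>\<^sup>+ \<omega>. exp_neg (\<integral>\<^sup>+ x. f x \<partial>N \<omega>) \<partial>M) = (\<integral>\<^sup>+ \<omega>. ennreal (exp (c * \<delta> * t)) * ennreal (exp (- (c * X t \<omega>))) \<partial>M)"
  proof (intro nn_integral_cong_AE, use AE_good NA AE_space in eventually_elim)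
    case (elim \<omega>)
    define j where "j = jump (\<lambda>r. X r \<omega>)"
    define J where "J = {s. 0 < s \<and> j s \<noteq> 0}"
    have j_nn: "j s \<ge> 0" if "s > 0" for s
      unfolding j_def using elim(1) that by (intro jump_nonneg) (auto simp: good_def)
    \<comment> \<open>N is given by its values on sets; as the image of counting measure on the jump
      times it turns integrals into sums over jumps.\<close>
    have Neq: "N \<omega> = distr (count_space J) (borel \<Otimes>\<^sub>M borel) (\<lambda>s. (s, j s))"
    proof (rule measure_eqI)
      show "sets (N \<omega>) = sets (distr (count_space J) (borel \<Otimes>\<^sub>M borel) (\<lambda>s. (s, j s)))"
        using setsN[OF elim(3)] sets_\<nu> by simp
      fix A assume "A \<in> sets (N \<omega>)"
      then have A: "A \<in> sets (borel \<Otimes>\<^sub>M borel)" using setsN[OF elim(3)] sets_\<nu> by simp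
      have "emeasure (distr (count_space J) (borel \<Otimes>\<^sub>M borel) (\<lambda>s. (s, j s))) A
         = emeasure (count_space J) {s. 0 < s \<and> j s \<noteq> 0 \<and> (s, j s) \<in> A}"
        using A by (subst emeasure_distr) (auto simp: J_def space_pair_measure vimage_def Int_def intro!: arg_cong2[where f = emeasure])
      also have "\<dots> = emeasure (count_space UNIV) {s. 0 < s \<and> j s \<noteq> 0 \<and> (s, j s) \<in> A}"
        by (subst (1 2) emeasure_count_space) (auto simp: J_def)
      also have "\<dots> = emeasure (N \<omega>) A" using elim(2) A by (simp add: j_def)
      finally show "emeasure (N \<omega>) A = emeasure (distr (count_space J) (borel \<Otimes>\<^sub>M borel) (\<lambda>s. (s, j s))) A" ..
    qed
    have "(\<integral>\<^sup>+ x. f x \<partial>N \<omega>) = (\<integral>\<^sup>+ s. f (s, j s) \<partial>count_space J)"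
      unfolding Neq by (rule nn_integral_distr) (auto simp: f_bor space_pair_measure)
    also have "\<dots> = (\<integral>\<^sup>+ s. f (s, j s) * indicator J s \<partial>count_space UNIV)"
      by (rule nn_integral_count_space_indicator) simp
    also have "\<dots> = (\<integral>\<^sup>+ s. ennreal (c * j s) * indicator {0<..t} s \<partial>count_space UNIV)"
      by (intro nn_integral_cong) (auto simp: f_def J_def indicator_def)
    also have "\<dots> = (\<integral>\<^sup>+ s. ennreal (c * j s) \<partial>count_space {0<..t})"
      by (rule nn_integral_count_space_indicator[symmetric]) simp
    also have "\<dots> = ennreal (c * (X t \<omega> - \<delta> * t))"
    proof (rule nn_integral_count_space_has_sum)
      show "((\<lambda>s. c * j s) has_sum c * (X t \<omega> - \<delta> * t)) {0<..t}"
        by (intro has_sum_cmult_right) (use elim(1) t in \<open>auto simp: good_def j_def\<close>)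
    qed (use j_nn c in auto)
    finally have eq: "(\<integral>\<^sup>+ x. f x \<partial>N \<omega>) = ennreal (c * (X t \<omega> - \<delta> * t))" .
    have "0 \<le> c * (X t \<omega> - \<delta> * t)" using good_ge[OF elim(1) t] c by simp
    then show ?case unfolding eq by (simp add: exp_neg_ennreal algebra_simps mult_exp_exp flip: ennreal_mult)
  qed
  also have "\<dots> = ennreal (exp (c * \<delta> * t)) * (\<integral>\<^sup>+ \<omega>. ennreal (exp (- (c * X t \<omega>))) \<partial>M)"
    using t by (intro nn_integral_cmult) measurable
  finally have "ennreal (exp (c * \<delta> * t)) * (\<integral>\<^sup>+ \<omega>. ennreal (exp (- (c * X t \<omega>))) \<partial>M) = ennreal (exp (- (t * \<psi> c)))"
    unfolding L R ..
  \<comment> \<open>Multiplying by the reciprocal exponential avoids a division in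
    \<open>ennreal\<close>.\<close>
  then have "ennreal (exp (- (c * \<delta> * t))) * (ennreal (exp (c * \<delta> * t)) * (\<integral>\<^sup>+ \<omega>. ennreal (exp (- (c * X t \<omega>))) \<partial>M))
     = ennreal (exp (- (c * \<delta> * t))) * ennreal (exp (- (t * \<psi> c)))" by simp
  moreover have "ennreal (exp (- (c * \<delta> * t))) * ennreal (exp (c * \<delta> * t)) = 1"
    by (simp add: mult_exp_exp flip: ennreal_mult)
  ultimately have "(\<integral>\<^sup>+ \<omega>. ennreal (exp (- (c * X t \<omega>))) \<partial>M) = ennreal (exp (- (c * \<delta> * t))) * ennreal (exp (- (t * \<psi> c)))"
    by (simp add: mult.assoc[symmetric])
  then show ?thesis by (simp add: mult_exp_exp algebra_simps flip: ennreal_mult)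
qed

end

section \<open>The renewal equation for the potential measure\<close>

lemma nn_integral_exp_atLeast:
  assumes "c > 0"
  shows "(\<integral>\<^sup>+ x. ennreal (exp (- (c * x))) * indicator {a..} x \<partial>lborel) = ennreal (exp (- (c * a)) / c)"
proof -
  have "(\<integral>\<^sup>+ x. ennreal (exp (- (c * x))) * indicator {a..} x \<partial>lborel) = ennreal (0 - (- exp (- (c * a)) / c))"
  proof (rule nn_integral_FTC_atLeast)
    show "((\<lambda>x. - exp (- (c * x)) / c) has_real_derivative exp (- (c * x))) (at x)" for x
      using assms by (auto intro!: derivative_eq_intros)
    have "((\<lambda>x. exp (- (c * x))) \<longlongrightarrow> 0) at_top"
      using assms
      by (intro filterlim_compose[OF exp_at_bot] filterlim_uminus_at_bot_at_top[THEN filterlim_compose]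
          filterlim_tendsto_pos_mult_at_top[OF tendsto_const] filterlim_ident)
    from tendsto_divide[OF tendsto_minus[OF this] tendsto_const[of c]]
    show "((\<lambda>x. - exp (- (c * x)) / c) \<longlongrightarrow> 0) at_top" using assms by simp
  qed auto
  then show ?thesis by simp
qed

lemma nn_integral_exp_Ioc:
  assumes "c > 0" "z > 0"
  shows "(\<integral>\<^sup>+ x. indicator {0<..z} x * ennreal (exp (- (c * x))) \<partial>lborel) = ennreal ((1 - exp (- (c * z))) / c)"
proof -
  have "(\<integral>\<^sup>+ x. indicator {0<..z} x * ennreal (exp (- (c * x))) \<partial>lborel)
     = (\<integral>\<^sup>+ x. ennreal (exp (- (c * x))) * indicator {0..z} x \<partial>lborel)"
    using AE_lborel_singleton[of "0::real"]
    by (intro nn_integral_cong_AE) (auto elim!: eventually_mono simp: indicator_def)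
  also have "\<dots> = ennreal ((- exp (- (c * z)) / c) - (- exp (- (c * 0)) / c))"
    by (rule nn_integral_FTC_Icc) (use assms in \<open>auto intro!: derivative_eq_intros\<close>)
  finally show ?thesis by (simp add: diff_divide_distrib)
qed

lemma nn_integral_ident_times_exp:
  assumes "c > 0"
  shows "(\<integral>\<^sup>+ x. ennreal (exp (- (c * x))) * ennreal (max 0 x) \<partial>lborel) = ennreal (1 / c ^ 2)"
proof -
  have *: "(\<integral>\<^sup>+ x. ennreal (x ^ 1 * exp (- x)) * indicator {0..} x \<partial>lborel) = 1"
    using nn_intergal_power_times_exp_Ici[of 1] by simp
  have "(\<integral>\<^sup>+ x. ennreal (exp (- (c * x))) * ennreal (max 0 x) \<partial>lborel)
     = ennreal \<bar>1 / c\<bar> * (\<integral>\<^sup>+ x. ennreal (exp (- (c * (0 + (1 / c) * x)))) * ennreal (max 0 (0 + (1 / c) * x)) \<partial>lborel)"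
    using assms by (intro nn_integral_real_affine) auto
  also have "(\<integral>\<^sup>+ x. ennreal (exp (- (c * (0 + (1 / c) * x)))) * ennreal (max 0 (0 + (1 / c) * x)) \<partial>lborel)
     = (\<integral>\<^sup>+ x. ennreal (1 / c) * (ennreal (x ^ 1 * exp (- x)) * indicator {0..} x) \<partial>lborel)"
    using assms by (intro nn_integral_cong)
      (auto simp: indicator_def max_def zero_le_divide_iff simp flip: ennreal_mult)
  also have "\<dots> = ennreal (1 / c)" by (subst nn_integral_cmult) (simp_all add: *[simplified])
  finally show ?thesis using assms by (simp add: power2_eq_square flip: ennreal_mult)
qed

text \<open>On the support of g the variable exp (- x) lies in [0, 1]. The vanishing moments handle
  polynomials in it, and Stone-Weierstrass leaves a uniform error times the integral of
  \<bar>g\<bar>.\<close>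

lemma integral_continuous_exp_eq_0:
  fixes g :: "real \<Rightarrow> real"
  assumes g: "integrable lborel g" "\<And>x. x < 0 \<Longrightarrow> g x = 0"
    and 0: "\<And>n::nat. (LBINT x. exp (- x) ^ n * g x) = 0"
    and \<phi>: "continuous_on {0..1} \<phi>" "(\<lambda>x. \<phi> (exp (- x)) * g x) \<in> borel_measurable borel"
  shows "integrable lborel (\<lambda>x. \<phi> (exp (- x)) * g x)" "(LBINT x. \<phi> (exp (- x)) * g x) = 0"
proof -
  have "compact (\<phi> ` {0..1})" by (intro compact_continuous_image \<phi>) auto
  then obtain C where C: "\<And>y. y \<in> {0..1} \<Longrightarrow> norm (\<phi> y) \<le> C"
    using bounded_iff compact_imp_bounded by (metis imageI)
  show int: "integrable lborel (\<lambda>x. \<phi> (exp (- x)) * g x)"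
  proof (rule Bochner_Integration.integrable_bound[of _ "\<lambda>x. C * \<bar>g x\<bar>"])
    show "AE x in lborel. norm (\<phi> (exp (- x)) * g x) \<le> norm (C * \<bar>g x\<bar>)"
    proof (rule AE_I2)
      fix x show "norm (\<phi> (exp (- x)) * g x) \<le> norm (C * \<bar>g x\<bar>)"
        using C[of "exp (- x)"] C[of 0] g(2)[of x]
        by (cases "x < 0") (auto simp: abs_mult intro!: mult_right_mono)
    qed
  qed (use g \<phi> in auto)
  have intn: "integrable lborel (\<lambda>x. exp (- x) ^ n * g x)" for n
  proof (rule Bochner_Integration.integrable_bound[OF g(1)])
    show "AE x in lborel. norm (exp (- x) ^ n * g x) \<le> norm (g x)"
    proof (rule AE_I2)
      fix x :: real
      have "exp (- x) ^ n * \<bar>g x\<bar> \<le> 1 * \<bar>g x\<bar>" if "x \<ge> 0"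
        using that by (intro mult_right_mono power_le_one) auto
      then show "norm (exp (- x) ^ n * g x) \<le> norm (g x)"
        using g(2)[of x] by (cases "x < 0") (auto simp: abs_mult)
    qed
  qed (use g(1) in measurable)
  have bound: "\<bar>LBINT x. \<phi> (exp (- x)) * g x\<bar> \<le> e * (LBINT x. \<bar>g x\<bar>)" if e: "e > 0" for e
  proof -
    obtain p where p: "real_polynomial_function p" "\<And>y. y \<in> {0..1} \<Longrightarrow> \<bar>\<phi> y - p y\<bar> < e"
      using Stone_Weierstrass_real_polynomial_function[OF _ \<phi>(1) e] by auto
    obtain a n where a: "p = (\<lambda>x. \<Sum>i\<le>n. a i * x ^ i)"
      using p(1) unfolding real_polynomial_function_iff_sum by blast
    have pint: "integrable lborel (\<lambda>x. \<Sum>i\<le>n. a i * (exp (- x) ^ i * g x))" by (intro Bochner_Integration.integrable_sum integrable_mult_right intn)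
    have p0: "(LBINT x. (\<Sum>i\<le>n. a i * (exp (- x) ^ i * g x))) = 0"
      by (subst Bochner_Integration.integral_sum) (auto intro!: intn integrable_mult_right sum.neutral simp: 0)
    have "(LBINT x. \<phi> (exp (- x)) * g x) = (LBINT x. \<phi> (exp (- x)) * g x - (\<Sum>i\<le>n. a i * (exp (- x) ^ i * g x)))"
      using int pint p0 by simp
    also have "\<bar>\<dots>\<bar> \<le> (LBINT x. e * \<bar>g x\<bar>)"
    proof (rule order_trans[OF integral_abs_bound integral_mono])
      fix x
      have "\<phi> (exp (- x)) * g x - (\<Sum>i\<le>n. a i * (exp (- x) ^ i * g x)) = (\<phi> (exp (- x)) - p (exp (- x))) * g x"
        unfolding a left_diff_distrib sum_distrib_right by (simp add: mult.assoc)
      also have "\<bar>\<dots>\<bar> \<le> e * \<bar>g x\<bar>"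
        using p(2)[of "exp (- x)"] g(2)[of x]
        by (cases "x < 0") (auto simp: abs_mult intro!: mult_right_mono)
      finally show "\<bar>\<phi> (exp (- x)) * g x - (\<Sum>i\<le>n. a i * (exp (- x) ^ i * g x))\<bar> \<le> e * \<bar>g x\<bar>" .
    qed (use int pint g(1) in auto)
    finally show ?thesis by simp
  qed
  show "(LBINT x. \<phi> (exp (- x)) * g x) = 0"
  proof (rule ccontr)
    assume ne: "(LBINT x. \<phi> (exp (- x)) * g x) \<noteq> 0"
    define I where "I = (LBINT x. \<bar>g x\<bar>)"
    have I: "I \<ge> 0" by (simp add: I_def)
    \<comment> \<open>With this e the absolute value of the integral is 2 (I + 1) e, which exceeds
      the bound e I; the added 1 covers the case I = 0.\<close>
    define e where "e = \<bar>LBINT x. \<phi> (exp (- x)) * g x\<bar> / (2 * (I + 1))"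
    have "e > 0" using ne I by (auto simp: e_def)
    from bound[OF this] have "2 * (I + 1) * e \<le> e * I" using I by (simp add: I_def[symmetric] e_def)
    then show False using \<open>e > 0\<close> I by (simp add: algebra_simps) (smt (verit) mult_nonneg_nonneg)
  qed
qed

text \<open>Polynomials in \<open>exp (- x)\<close> are uniformly dense among the continuous functions of \<open>exp (- x)\<close>, so
  \<open>F x - x\<close> is orthogonal to bump functions. If \<open>F x0 \<noteq> x0\<close>, monotonicity keeps the sign of \<open>F x - x\<close>
  constant between \<open>x0\<close> and \<open>F x0\<close>.\<close>

lemma Laplace_unique_mono:
  fixes F :: "real \<Rightarrow> real"
  assumes F: "\<And>x y. 0 \<le> x \<Longrightarrow> x \<le> y \<Longrightarrow> F x \<le> F y" "\<And>x. F x \<ge> 0" "\<And>x. x \<le> 0 \<Longrightarrow> F x = 0"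
    and [measurable]: "F \<in> borel_measurable borel"
    and L: "\<And>c. c > 0 \<Longrightarrow> (\<integral>\<^sup>+ x. ennreal (exp (- (c * x))) * ennreal (F x) \<partial>lborel) = ennreal (1 / c ^ 2)"
    and x0: "x0 \<ge> 0"
  shows "F x0 = x0"
proof -
  have FL: "integrable lborel (\<lambda>x. exp (- (c * x)) * F x)" "(LBINT x. exp (- (c * x)) * F x) = 1 / c ^ 2" if "c > 0" for c
  proof -
    have "has_bochner_integral lborel (\<lambda>x. exp (- (c * x)) * F x) (1 / c ^ 2)"
      by (rule has_bochner_integral_nn_integral) (use F(2) L[OF that] in \<open>auto simp: ennreal_mult\<close>)
    then show "integrable lborel (\<lambda>x. exp (- (c * x)) * F x)" "(LBINT x. exp (- (c * x)) * F x) = 1 / c ^ 2"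
      by (auto simp: has_bochner_integral_iff)
  qed
  have GL: "integrable lborel (\<lambda>x. exp (- (c * x)) * max 0 x)" "(LBINT x. exp (- (c * x)) * max 0 x) = 1 / c ^ 2" if "c > 0" for c :: real
  proof -
    have "has_bochner_integral lborel (\<lambda>x. exp (- (c * x)) * max 0 x) (1 / c ^ 2)"
      by (rule has_bochner_integral_nn_integral) (use nn_integral_ident_times_exp[OF that] in \<open>auto simp: ennreal_mult\<close>)
    then show "integrable lborel (\<lambda>x. exp (- (c * x)) * max 0 x)" "(LBINT x. exp (- (c * x)) * max 0 x) = 1 / c ^ 2"
      by (auto simp: has_bochner_integral_iff)
  qed
  \<comment> \<open>The damping factor makes the difference integrable; the n-th moment then
    corresponds to the transform at c = n + 1.\<close>
  define g where "g = (\<lambda>x. exp (- x) * (F x - max 0 x))"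
  have [measurable]: "g \<in> borel_measurable borel" unfolding g_def by measurable
  have g_int: "integrable lborel g"
    using FL(1)[of 1] GL(1)[of 1] by (simp add: g_def right_diff_distrib)
  have g_0: "g x = 0" if "x < 0" for x using that F(3)[of x] by (simp add: g_def)
  have moments: "(LBINT x. exp (- x) ^ n * g x) = 0" for n :: nat
  proof -
    have "(LBINT x. exp (- x) ^ n * g x)
       = (LBINT x. exp (- (real (Suc n) * x)) * F x - exp (- (real (Suc n) * x)) * max 0 x)"
    proof (intro Bochner_Integration.integral_cong refl)
      fix x :: real
      have "exp (- x) ^ n * exp (- x) = exp (- (real (Suc n) * x))"
        by (simp add: exp_of_nat_mult[symmetric] mult_exp_exp algebra_simps)
      then show "exp (- x) ^ n * g x = exp (- (real (Suc n) * x)) * F x - exp (- (real (Suc n) * x)) * max 0 x"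
        unfolding g_def by (metis mult.assoc right_diff_distrib)
    qed
    also have "\<dots> = 0"
      using FL[of "real (Suc n)"] GL[of "real (Suc n)"] by (subst Bochner_Integration.integral_diff) auto
    finally show ?thesis .
  qed
  have no_sign: False if ab: "0 \<le> a" "a < b" and sg: "\<And>x. x \<in> {a<..<b} \<Longrightarrow> \<sigma> * (F x - x) > 0" for a b \<sigma> :: real
  proof -
    \<comment> \<open>A bump in the variable y = exp (- x), positive exactly for exp (- b) < y < exp
      (- a), that is for a < x < b.\<close>
    define \<phi> where "\<phi> = (\<lambda>y. max 0 ((y - exp (- b)) * (exp (- a) - y)))"
    have [measurable]: "\<phi> \<in> borel_measurable borel" unfolding \<phi>_def by measurable
    have \<phi>: "\<phi> (exp (- x)) > 0 \<longleftrightarrow> x \<in> {a<..<b}" "\<phi> (exp (- x)) \<ge> 0" for x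
      using ab by (auto simp: \<phi>_def less_max_iff_disj zero_less_mult_iff)
    have \<phi>c: "continuous_on {0..1} \<phi>" unfolding \<phi>_def by (intro continuous_intros)
    note z = integral_continuous_exp_eq_0[OF g_int g_0 moments \<phi>c]
    have nn: "\<sigma> * (\<phi> (exp (- x)) * g x) \<ge> 0" for x
    proof (cases "x \<in> {a<..<b}")
      case True
      have "0 \<le> \<phi> (exp (- x)) * (exp (- x) * (\<sigma> * (F x - x)))"
        by (rule mult_nonneg_nonneg[OF \<phi>(2) mult_nonneg_nonneg[OF exp_ge_zero less_imp_le[OF sg[OF True]]]])
      then show ?thesis using True ab by (simp add: g_def mult_ac max_def)
    next
      case False
      then have "\<phi> (exp (- x)) = 0" using \<phi>[of x] by linarith
      then show ?thesis by simp
    qed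
    have "(LBINT x. \<sigma> * (\<phi> (exp (- x)) * g x)) = 0" using z by simp
    then have "AE x in lborel. \<sigma> * (\<phi> (exp (- x)) * g x) = 0"
      using z(1) nn by (subst (asm) integral_nonneg_eq_0_iff_AE) auto
    then have "AE x in lborel. x \<notin> {a<..<b}"
    proof eventually_elim
      case (elim x)
      show ?case
      proof
        assume x: "x \<in> {a<..<b}"
        then have "\<sigma> * (F x - max 0 x) \<noteq> 0" using sg[OF x] ab by (auto simp: max_def)
        moreover have "\<phi> (exp (- x)) \<noteq> 0" using \<phi>(1)[of x] x by auto
        ultimately show False using elim by (auto simp: g_def)
      qed
    qed
    then have "emeasure lborel {a<..<b} = 0"
      by (subst (asm) AE_iff_measurable[of "{a<..<b}"]) auto
    then show False using ab by simp
  qed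
  show ?thesis
  proof (rule ccontr)
    assume "F x0 \<noteq> x0"
    then consider "F x0 > x0" | "F x0 < x0" by linarith
    then show False
    proof cases
      case 1
      show False
      proof (rule no_sign[of x0 "F x0" 1])
        fix x assume "x \<in> {x0<..<F x0}"
        then show "1 * (F x - x) > 0" using F(1)[of x0 x] x0 by auto
      qed (use 1 x0 in auto)
    next
      case 2
      show False
      proof (rule no_sign[of "F x0" x0 "-1"])
        fix x assume "x \<in> {F x0<..<x0}"
        then show "- 1 * (F x - x) > 0" using F(1)[of x x0] F(2)[of x0] by auto
      qed (use 2 F(2) in auto)
    qed
  qed
qed

section \<open>A jointly measurable version and the potential measure\<close>

context subord
begin

text \<open>For t \<ge> 0 the least multiple of 1 / (n + 1) strictly to the right of t; strictness
  lets the right limit of the path be used. It is positive even for t < 0, so X is measurable at all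
  grid times.\<close>

definition grid :: "nat \<Rightarrow> real \<Rightarrow> real" where
  "grid n t = (real (nat \<lfloor>real (Suc n) * t\<rfloor>) + 1) / real (Suc n)"

text \<open>The process is only assumed measurable at each fixed time; \<open>Y\<close> is a jointly measurable
  version, by right-continuity of the paths.\<close>

definition Y :: "real \<times> 'a \<Rightarrow> real" where
  "Y p = lim (\<lambda>n. X (grid n (fst p)) (snd p))"

lemma measurable_Y[measurable]: "Y \<in> borel_measurable (lborel \<Otimes>\<^sub>M M)"
proof -
  have "(\<lambda>p. X ((real i + 1) / real (Suc n)) (snd p)) \<in> borel_measurable (lborel \<Otimes>\<^sub>M M)" for i n
    by (rule measurable_compose[OF measurable_snd X_measurable]) simp
  then have "(\<lambda>p. X ((real (nat \<lfloor>real (Suc n) * fst p\<rfloor>) + 1) / real (Suc n)) (snd p)) \<in> borel_measurable (lborel \<Otimes>\<^sub>M M)" for n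
    by (rule measurable_compose_countable) measurable
  then show ?thesis unfolding Y_def[abs_def] grid_def by (intro borel_measurable_lim_metric)
qed

lemma Y_eq: assumes "good \<omega>" "t \<ge> 0" shows "Y (t, \<omega>) = X t \<omega>"
proof -
  have gt: "grid n t > t" "grid n t \<le> t + 1 / real (Suc n)" for n
  proof -
    have fl: "real (nat \<lfloor>real (Suc n) * t\<rfloor>) = of_int \<lfloor>real (Suc n) * t\<rfloor>"
      using assms(2) by (intro of_nat_nat) simp
    have "real (Suc n) * t < real (nat \<lfloor>real (Suc n) * t\<rfloor>) + 1" "real (nat \<lfloor>real (Suc n) * t\<rfloor>) + 1 \<le> real (Suc n) * t + 1"
      unfolding fl by linarith+
    moreover have "(m + 1) / w > t \<and> (m + 1) / w \<le> t + 1 / w" if "w > 0" "w * t < m + 1" "m + 1 \<le> w * t + 1" for m w :: real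
      using that by (simp add: field_simps)
    ultimately show "grid n t > t" "grid n t \<le> t + 1 / real (Suc n)"
      unfolding grid_def by (metis of_nat_0_less_iff zero_less_Suc)+
  qed
  have "(\<lambda>n. grid n t) \<longlonglongrightarrow> t"
  proof (rule tendsto_sandwich[of "\<lambda>_. t"])
    show "(\<lambda>n. t + 1 / real (Suc n)) \<longlonglongrightarrow> t"
      using tendsto_add[OF tendsto_const[of t] LIMSEQ_inverse_real_of_nat] by (simp add: inverse_eq_divide)
  qed (use gt in \<open>auto intro!: always_eventually less_imp_le\<close>)
  then have "filterlim (\<lambda>n. grid n t) (at_right t) sequentially"
    using gt(1) by (simp add: filterlim_at less_imp_neq[OF gt(1), symmetric])
  moreover have "((\<lambda>t. X t \<omega>) \<longlongrightarrow> X t \<omega>) (at_right t)"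
    using assms by (auto simp: good_def cadlag_def)
  ultimately have "(\<lambda>n. X (grid n t) \<omega>) \<longlonglongrightarrow> X t \<omega>" by (rule filterlim_compose[rotated])
  then show ?thesis by (simp add: Y_def limI)
qed

definition H :: "real \<Rightarrow> real \<times> 'a \<Rightarrow> ennreal" where
  "H x p = ennreal (exp (- q * fst p)) * indicator {0..} (fst p) * indicator {0..x} (Y p)"

lemma measurable_H[measurable]: "H x \<in> borel_measurable (lborel \<Otimes>\<^sub>M M)"
  unfolding H_def by measurable

interpretation PM: pair_sigma_finite lborel M ..

lemma potential_eq: "potential M X q {0..x} = (\<integral>\<^sup>+ p. H x p \<partial>(lborel \<Otimes>\<^sub>M M))"
proof -
  have "potential M X q {0..x} = (\<integral>\<^sup>+ \<omega>. (\<integral>\<^sup>+ t. H x (t, \<omega>) \<partial>lborel) \<partial>M)"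
    unfolding potential_def
  proof (intro nn_integral_cong_AE, use AE_good in eventually_elim)
    case (elim \<omega>)
    show ?case by (intro nn_integral_cong) (auto simp: H_def indicator_def Y_eq[OF elim])
  qed
  also have "\<dots> = (\<integral>\<^sup>+ p. H x p \<partial>(lborel \<Otimes>\<^sub>M M))"
    by (rule PM.nn_integral_snd) measurable
  finally show ?thesis .
qed

abbreviation U :: "real \<Rightarrow> real" where "U \<equiv> potential_cdf M X q"

text \<open>The jumps are nonnegative, so X t \<ge> \<delta> t almost surely; the time spent in
  [0, x] is at most x / \<delta>, and discounting only lowers it.\<close>

lemma potential_le: "potential M X q {0..x} \<le> ennreal (max 0 x / \<delta>)"
proof -
  have "potential M X q {0..x} = (\<integral>\<^sup>+ \<omega>. (\<integral>\<^sup>+ t. H x (t, \<omega>) \<partial>lborel) \<partial>M)"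
    unfolding potential_eq by (rule PM.nn_integral_snd[symmetric]) measurable
  also have "\<dots> \<le> (\<integral>\<^sup>+ \<omega>. ennreal (max 0 x / \<delta>) \<partial>M)"
  proof (intro nn_integral_mono_AE, use AE_good in eventually_elim)
    case (elim \<omega>)
    have "H x (t, \<omega>) \<le> indicator {0..max 0 x / \<delta>} t" for t
    proof (cases "t \<ge> 0 \<and> X t \<omega> \<in> {0..x}")
      case True
      then have "\<delta> * t \<le> x" using good_ge[OF elim, of t] by auto
      then have "t \<le> x / \<delta>" using \<delta>0 by (simp add: field_simps)
      also have "x / \<delta> \<le> max 0 x / \<delta>" using \<delta>0 by (intro divide_right_mono) auto
      finally have "t \<in> {0..max 0 x / \<delta>}" using True by simp
      moreover have "ennreal (exp (- q * t)) \<le> 1" using True q0 by simp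
      ultimately show ?thesis using True by (simp add: H_def Y_eq[OF elim])
    next
      case False
      then have "H x (t, \<omega>) = 0" by (cases "t \<ge> 0") (auto simp: H_def Y_eq[OF elim] indicator_def)
      then show ?thesis by simp
    qed
    then have "(\<integral>\<^sup>+ t. H x (t, \<omega>) \<partial>lborel) \<le> (\<integral>\<^sup>+ t. indicator {0..max 0 x / \<delta>} t \<partial>lborel)"
      by (rule nn_integral_mono)
    then show ?case using \<delta>0 by simp
  qed
  also have "\<dots> = ennreal (max 0 x / \<delta>)" by (simp add: P.emeasure_space_1)
  finally show ?thesis .
qed

lemma ennreal_U: "ennreal (U x) = potential M X q {0..x}"
  unfolding potential_cdf_def
  by (rule ennreal_enn2real) (rule le_less_trans[OF potential_le ennreal_less_top])

lemma U_nonneg: "U x \<ge> 0" by (simp add: potential_cdf_def)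

lemma U_le: "U x \<le> max 0 x / \<delta>"
proof -
  have "ennreal (U x) \<le> ennreal (max 0 x / \<delta>)" unfolding ennreal_U by (rule potential_le)
  then show ?thesis using \<delta>0 by (subst (asm) ennreal_le_iff) auto
qed

lemma U_0: "x \<le> 0 \<Longrightarrow> U x = 0" using U_nonneg[of x] U_le[of x] by simp

lemma U_mono: "x \<le> y \<Longrightarrow> U x \<le> U y"
proof -
  assume "x \<le> y"
  then have "potential M X q {0..x} \<le> potential M X q {0..y}"
    unfolding potential_eq H_def by (intro nn_integral_mono mult_left_mono) (auto simp: indicator_def)
  then have "ennreal (U x) \<le> ennreal (U y)" by (simp add: ennreal_U)
  then show ?thesis using U_nonneg by (subst (asm) ennreal_le_iff) auto
qed

lemma U_measurable[measurable]: "U \<in> borel_measurable borel"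
  by (intro borel_measurable_mono monoI U_mono)

lemma causal_U: "causal U"
proof -
  have "\<exists>C. \<forall>x\<le>K. \<bar>U x\<bar> \<le> C" for K
    using U_mono[of _ K] U_nonneg by (intro exI[of _ "U K"]) auto
  then show ?thesis by (auto simp: causal_def U_0)
qed

text \<open>By Tonelli the integral over x \<ge> Y of exp (- c x) comes first and gives exp (- c Y)
  / c; then \<open>Laplace_X\<close> takes the expectation, and an exponential in t remains.\<close>

lemma Laplace_U:
  assumes c: "c > 0"
  shows "(\<integral>\<^sup>+ x. ennreal (exp (- (c * x))) * ennreal (U x) \<partial>lborel) = ennreal (1 / (c * (q + \<delta> * c + \<psi> c)))"
proof -
  interpret PMs: sigma_finite_measure "lborel \<Otimes>\<^sub>M M" by (rule PM.sigma_finite_measure_axioms)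
  interpret LPM: pair_sigma_finite lborel "lborel \<Otimes>\<^sub>M M" ..
  have Hm[measurable]: "(\<lambda>(x, p). H x p) \<in> borel_measurable (lborel \<Otimes>\<^sub>M (lborel \<Otimes>\<^sub>M M))"
  \<comment> \<open>Tonelli requires measurability jointly in x and p, so the indicator of {0..x} is
    rewritten as a comparison of Y with x.\<close>
  proof -
    have "(\<lambda>z. ennreal (exp (- q * fst (snd z))) * indicator {0..} (fst (snd z)) *
        (if 0 \<le> Y (snd z) \<and> Y (snd z) \<le> fst z then 1 else 0)) \<in> borel_measurable (lborel \<Otimes>\<^sub>M (lborel \<Otimes>\<^sub>M M))"
      by measurable
    also have "(\<lambda>z. ennreal (exp (- q * fst (snd z))) * indicator {0..} (fst (snd z)) *
        (if 0 \<le> Y (snd z) \<and> Y (snd z) \<le> fst z then 1 else 0)) = (\<lambda>(x, p). H x p)"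
      by (auto simp: H_def indicator_def fun_eq_iff)
    finally show ?thesis .
  qed
  have Hx: "(\<lambda>(x, p). ennreal (exp (- (c * x))) * H x p) \<in> borel_measurable (lborel \<Otimes>\<^sub>M (lborel \<Otimes>\<^sub>M M))"
    using Hm by (simp add: case_prod_unfold)
  have "(\<integral>\<^sup>+ x. ennreal (exp (- (c * x))) * ennreal (U x) \<partial>lborel)
     = (\<integral>\<^sup>+ x. (\<integral>\<^sup>+ p. ennreal (exp (- (c * x))) * H x p \<partial>(lborel \<Otimes>\<^sub>M M)) \<partial>lborel)"
    unfolding ennreal_U potential_eq by (intro nn_integral_cong nn_integral_cmult[symmetric]) measurable
  also have "\<dots> = (\<integral>\<^sup>+ p. (\<integral>\<^sup>+ x. ennreal (exp (- (c * x))) * H x p \<partial>lborel) \<partial>(lborel \<Otimes>\<^sub>M M))"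
    by (rule LPM.Fubini'[OF Hx, symmetric])
  also have "\<dots> = (\<integral>\<^sup>+ p. ennreal (exp (- q * fst p)) * indicator {0..} (fst p) * (indicator {0..} (Y p) * ennreal (exp (- (c * Y p)) / c)) \<partial>(lborel \<Otimes>\<^sub>M M))"
  proof (intro nn_integral_cong)
    fix p
    have "(\<integral>\<^sup>+ x. ennreal (exp (- (c * x))) * H x p \<partial>lborel)
       = (\<integral>\<^sup>+ x. (ennreal (exp (- q * fst p)) * indicator {0..} (fst p) * indicator {0..} (Y p)) * (ennreal (exp (- (c * x))) * indicator {Y p..} x) \<partial>lborel)"
      by (intro nn_integral_cong) (auto simp: H_def indicator_def mult.commute)
    also have "\<dots> = (ennreal (exp (- q * fst p)) * indicator {0..} (fst p) * indicator {0..} (Y p)) * ennreal (exp (- (c * Y p)) / c)"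
      by (subst nn_integral_cmult) (simp_all add: nn_integral_exp_atLeast[OF c])
    finally show "(\<integral>\<^sup>+ x. ennreal (exp (- (c * x))) * H x p \<partial>lborel)
      = ennreal (exp (- q * fst p)) * indicator {0..} (fst p) * (indicator {0..} (Y p) * ennreal (exp (- (c * Y p)) / c))"
      by (simp add: mult.assoc)
  qed
  also have "\<dots> = (\<integral>\<^sup>+ t. (\<integral>\<^sup>+ \<omega>. ennreal (exp (- q * t)) * indicator {0..} t * (indicator {0..} (Y (t, \<omega>)) * ennreal (exp (- (c * Y (t, \<omega>))) / c)) \<partial>M) \<partial>lborel)"
    by (subst P.nn_integral_fst[symmetric]) simp_all
  also have "\<dots> = (\<integral>\<^sup>+ t. ennreal (1 / c) * (ennreal (exp (- ((q + \<delta> * c + \<psi> c) * t))) * indicator {0..} t) \<partial>lborel)"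
  proof (intro nn_integral_cong)
    fix t :: real
    show "(\<integral>\<^sup>+ \<omega>. ennreal (exp (- q * t)) * indicator {0..} t * (indicator {0..} (Y (t, \<omega>)) * ennreal (exp (- (c * Y (t, \<omega>))) / c)) \<partial>M)
       = ennreal (1 / c) * (ennreal (exp (- ((q + \<delta> * c + \<psi> c) * t))) * indicator {0..} t)"
    proof (cases "t \<ge> 0")
      case True
      have "(\<integral>\<^sup>+ \<omega>. ennreal (exp (- q * t)) * indicator {0..} t * (indicator {0..} (Y (t, \<omega>)) * ennreal (exp (- (c * Y (t, \<omega>))) / c)) \<partial>M)
         = (\<integral>\<^sup>+ \<omega>. ennreal (exp (- q * t) / c) * ennreal (exp (- (c * X t \<omega>))) \<partial>M)"
      proof (intro nn_integral_cong_AE, use AE_good in eventually_elim)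
        case (elim \<omega>)
        have "X t \<omega> \<ge> 0" using good_ge[OF elim True] True \<delta>0 by (meson mult_nonneg_nonneg less_imp_le order_trans)
        then show ?case using True c by (simp add: Y_eq[OF elim True] flip: ennreal_mult)
      qed
      also have "\<dots> = ennreal (exp (- q * t) / c) * ennreal (exp (- (t * (\<delta> * c + \<psi> c))))"
        using True by (subst nn_integral_cmult) (auto simp: Laplace_X[OF True c])
      also have "\<dots> = ennreal (1 / c) * ennreal (exp (- ((q + \<delta> * c + \<psi> c) * t)))"
        using c by (simp add: mult_exp_exp algebra_simps flip: ennreal_mult)
      finally show ?thesis using True by simp
    qed simp
  qed
  also have "\<dots> = ennreal (1 / c) * ennreal (exp (- ((q + \<delta> * c + \<psi> c) * 0)) / (q + \<delta> * c + \<psi> c))"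
  proof -
    have "q + \<delta> * c + \<psi> c > 0" using q0 psi_nonneg[of c] mult_pos_pos[OF \<delta>0 c] by linarith
    then show ?thesis by (subst nn_integral_cmult) (simp_all add: nn_integral_exp_atLeast)
  qed
  also have "\<dots> = ennreal (1 / (c * (q + \<delta> * c + \<psi> c)))"
    using c by (simp flip: ennreal_mult')
  finally show ?thesis .
qed

text \<open>The integral of exp (- c y) over (0, z] is (1 - exp (- c z)) / c, so the tail has
  transform \<psi> c / c and the constant q has transform q / c.\<close>

lemma Laplace_kappa:
  assumes c: "c > 0"
  shows "(\<integral>\<^sup>+ y. ennreal (\<kappa> y) * ennreal (exp (- (c * y))) \<partial>lborel) = ennreal ((q + \<psi> c) / (c * \<delta>))"
proof -
  have "(\<integral>\<^sup>+ y. indicator {0<..} y * ennreal (exp (- (c * y))) \<partial>lborel)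
     = (\<integral>\<^sup>+ y. ennreal (exp (- (c * y))) * indicator {0..} y \<partial>lborel)"
    using AE_lborel_singleton[of "0::real"]
    by (intro nn_integral_cong_AE) (auto elim!: eventually_mono simp: indicator_def)
  then have 1: "(\<integral>\<^sup>+ y. indicator {0<..} y * ennreal (exp (- (c * y))) \<partial>lborel) = ennreal (1 / c)"
    by (simp add: nn_integral_exp_atLeast[OF c])
  have "(\<integral>\<^sup>+ y. indicator {0<..} y * ennreal (tail \<Lambda> y) * ennreal (exp (- (c * y))) \<partial>lborel)
     = (\<integral>\<^sup>+ z. (\<integral>\<^sup>+ y. indicator {0<..z} y * ennreal (exp (- (c * y))) \<partial>lborel) \<partial>\<Lambda>)"
    by (rule nn_integral_tail) measurable
  also have "\<dots> = (\<integral>\<^sup>+ z. ennreal (1 / c) * ennreal (1 - exp (- (c * z))) \<partial>\<Lambda>)"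
  proof (intro nn_integral_cong_AE, use AE_levy_pos in eventually_elim)
    case (elim z)
    then show ?case using c by (simp add: nn_integral_exp_Ioc[OF c elim] flip: ennreal_mult')
  qed
  also have "\<dots> = ennreal (\<psi> c / c)"
    using c psi_nonneg by (subst nn_integral_cmult) (simp_all add: psi_finite[OF c] flip: ennreal_mult')
  finally have 2: "(\<integral>\<^sup>+ y. indicator {0<..} y * ennreal (tail \<Lambda> y) * ennreal (exp (- (c * y))) \<partial>lborel) = ennreal (\<psi> c / c)" .
  have "(\<integral>\<^sup>+ y. ennreal (\<kappa> y) * ennreal (exp (- (c * y))) \<partial>lborel)
     = (\<integral>\<^sup>+ y. ennreal (q / \<delta>) * (indicator {0<..} y * ennreal (exp (- (c * y))))
        + ennreal (1 / \<delta>) * (indicator {0<..} y * ennreal (tail \<Lambda> y) * ennreal (exp (- (c * y)))) \<partial>lborel)"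
  proof (intro nn_integral_cong)
    fix y
    have "ennreal (\<kappa> y) = ennreal (q / \<delta>) * indicator {0<..} y + ennreal (1 / \<delta>) * (indicator {0<..} y * ennreal (tail \<Lambda> y))"
      using q0 \<delta>0 tail_nonneg[of y]
      by (cases "y > 0") (auto simp: \<kappa>_def add_divide_distrib simp flip: ennreal_mult ennreal_plus)
    then show "ennreal (\<kappa> y) * ennreal (exp (- (c * y))) = ennreal (q / \<delta>) * (indicator {0<..} y * ennreal (exp (- (c * y))))
        + ennreal (1 / \<delta>) * (indicator {0<..} y * ennreal (tail \<Lambda> y) * ennreal (exp (- (c * y))))"
      by (simp add: distrib_right mult.assoc)
  qed
  also have "\<dots> = ennreal (q / \<delta>) * ennreal (1 / c) + ennreal (1 / \<delta>) * ennreal (\<psi> c / c)"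
    by (subst nn_integral_add) (simp_all add: nn_integral_cmult 1 2)
  also have "\<dots> = ennreal (q / \<delta> * (1 / c) + 1 / \<delta> * (\<psi> c / c))"
    using q0 \<delta>0 c psi_nonneg[of c] by (simp flip: ennreal_mult ennreal_plus)
  also have "q / \<delta> * (1 / c) + 1 / \<delta> * (\<psi> c / c) = (q + \<psi> c) / (c * \<delta>)"
    using \<delta>0 c by (simp add: field_simps)
  finally show ?thesis .
qed

lemma conv_kappa_U_nn: "ennreal (conv \<kappa> U x) = (\<integral>\<^sup>+ y. ennreal (\<kappa> y) * ennreal (U (x - y)) \<partial>lborel)"
  unfolding conv_def
  by (subst nn_integral_eq_integral[symmetric])
    (auto intro!: conv_integrable kernel_kappa causal_U mult_nonneg_nonneg simp: kappa_nonneg U_nonneg ennreal_mult)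

lemma Laplace_conv:
  assumes c: "c > 0"
  shows "(\<integral>\<^sup>+ x. ennreal (exp (- (c * x))) * ennreal (conv \<kappa> U x) \<partial>lborel)
    = ennreal ((q + \<psi> c) / (c * \<delta>)) * ennreal (1 / (c * (q + \<delta> * c + \<psi> c)))"
proof -
  have "(\<integral>\<^sup>+ x. ennreal (exp (- (c * x))) * ennreal (conv \<kappa> U x) \<partial>lborel)
     = (\<integral>\<^sup>+ x. (\<integral>\<^sup>+ y. ennreal (exp (- (c * x))) * (ennreal (\<kappa> y) * ennreal (U (x - y))) \<partial>lborel) \<partial>lborel)"
    unfolding conv_kappa_U_nn by (intro nn_integral_cong nn_integral_cmult[symmetric]) measurable
  also have "\<dots> = (\<integral>\<^sup>+ y. (\<integral>\<^sup>+ x. ennreal (exp (- (c * x))) * (ennreal (\<kappa> y) * ennreal (U (x - y))) \<partial>lborel) \<partial>lborel)"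
    by (rule lborel_pair.Fubini'[symmetric]) measurable
  also have "\<dots> = (\<integral>\<^sup>+ y. (ennreal (\<kappa> y) * ennreal (exp (- (c * y)))) * ennreal (1 / (c * (q + \<delta> * c + \<psi> c))) \<partial>lborel)"
  proof (intro nn_integral_cong)
    fix y
    have "(\<integral>\<^sup>+ x. ennreal (exp (- (c * x))) * (ennreal (\<kappa> y) * ennreal (U (x - y))) \<partial>lborel)
       = ennreal \<bar>1\<bar> * (\<integral>\<^sup>+ x. ennreal (exp (- (c * (y + 1 * x)))) * (ennreal (\<kappa> y) * ennreal (U (y + 1 * x - y))) \<partial>lborel)"
      by (rule nn_integral_real_affine) auto
    also have "\<dots> = (\<integral>\<^sup>+ x. (ennreal (\<kappa> y) * ennreal (exp (- (c * y)))) * (ennreal (exp (- (c * x))) * ennreal (U x)) \<partial>lborel)"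
    proof -
      have "exp (- (c * (y + x))) = exp (- (c * y)) * exp (- (c * x))" for x
        by (simp add: mult_exp_exp algebra_simps)
      then show ?thesis by (auto intro!: nn_integral_cong simp: ennreal_mult mult_ac)
    qed
    also have "\<dots> = (ennreal (\<kappa> y) * ennreal (exp (- (c * y)))) * (\<integral>\<^sup>+ x. ennreal (exp (- (c * x))) * ennreal (U x) \<partial>lborel)"
      by (rule nn_integral_cmult) measurable
    finally show "(\<integral>\<^sup>+ x. ennreal (exp (- (c * x))) * (ennreal (\<kappa> y) * ennreal (U (x - y))) \<partial>lborel)
      = (ennreal (\<kappa> y) * ennreal (exp (- (c * y)))) * ennreal (1 / (c * (q + \<delta> * c + \<psi> c)))"
      unfolding Laplace_U[OF c] .
  qed
  also have "\<dots> = (\<integral>\<^sup>+ y. ennreal (\<kappa> y) * ennreal (exp (- (c * y))) \<partial>lborel) * ennreal (1 / (c * (q + \<delta> * c + \<psi> c)))"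
    by (rule nn_integral_multc) measurable
  finally show ?thesis unfolding Laplace_kappa[OF c] .
qed

text \<open>The Laplace transform of \<delta> (U + conv \<kappa> U) is 1 / c^2, that of the identity
  on the half-line. Both summands are monotone, so \<open>Laplace_unique_mono\<close> gives the
  equation at every x rather than almost everywhere.\<close>

lemma renewal_equation: "U x = 1 / \<delta> * max 0 x - conv \<kappa> U x"
proof -
  have cU: "causal (conv \<kappa> U)" by (rule conv_causal[OF kernel_kappa causal_U])
  note [measurable] = causal_measurable[OF cU]
  have conv_nn: "conv \<kappa> U x \<ge> 0" for x
    unfolding conv_def by (intro Bochner_Integration.integral_nonneg mult_nonneg_nonneg kappa_nonneg U_nonneg)
  have conv_mono: "conv \<kappa> U x \<le> conv \<kappa> U y" if "x \<le> y" for x y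
    unfolding conv_def
    by (intro integral_mono conv_integrable kernel_kappa causal_U mult_left_mono U_mono kappa_nonneg) (use that in auto)
  define F where "F = (\<lambda>x. \<delta> * (U x + conv \<kappa> U x))"
  have F_eq: "F x = x" if "x \<ge> 0" for x
  proof (rule Laplace_unique_mono[OF _ _ _ _ _ that])
    fix c :: real assume c: "c > 0"
    define \<Phi> where "\<Phi> = q + \<delta> * c + \<psi> c"
    have \<Phi>: "\<Phi> > 0" using q0 psi_nonneg[of c] mult_pos_pos[OF \<delta>0 c] unfolding \<Phi>_def by linarith
    have "(\<integral>\<^sup>+ x. ennreal (exp (- (c * x))) * ennreal (F x) \<partial>lborel)
      = (\<integral>\<^sup>+ x. ennreal \<delta> * (ennreal (exp (- (c * x))) * ennreal (U x) + ennreal (exp (- (c * x))) * ennreal (conv \<kappa> U x)) \<partial>lborel)"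
      using \<delta>0 U_nonneg conv_nn
      by (intro nn_integral_cong) (simp add: F_def ennreal_mult distrib_left mult_ac)
    also have "\<dots> = ennreal \<delta> * (ennreal (1 / (c * \<Phi>)) + ennreal ((q + \<psi> c) / (c * \<delta>)) * ennreal (1 / (c * \<Phi>)))"
      unfolding \<Phi>_def by (subst nn_integral_cmult nn_integral_add, measurable)+ (simp add: Laplace_U[OF c] Laplace_conv[OF c])
    also have "\<dots> = ennreal (\<delta> * (1 / (c * \<Phi>) + (q + \<psi> c) / (c * \<delta>) * (1 / (c * \<Phi>))))"
      using \<delta>0 c q0 psi_nonneg[of c] \<Phi> by (simp flip: ennreal_mult ennreal_plus)
    also have "\<delta> * (1 / (c * \<Phi>) + (q + \<psi> c) / (c * \<delta>) * (1 / (c * \<Phi>))) = (\<delta> * c + (q + \<psi> c)) / (c * (c * \<Phi>))"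
      using \<delta>0 c \<Phi> by (simp add: field_simps)
    also have "\<dots> = 1 / c ^ 2"
      using \<Phi> c by (simp add: \<Phi>_def power2_eq_square add_ac)
    finally show "(\<integral>\<^sup>+ x. ennreal (exp (- (c * x))) * ennreal (F x) \<partial>lborel) = ennreal (1 / c ^ 2)" .
  next
    show "F x \<le> F y" if "x \<le> y" for x y
      unfolding F_def using U_mono[OF that] conv_mono[OF that] \<delta>0 by (intro mult_left_mono) auto
    show "F x \<ge> 0" for x unfolding F_def using U_nonneg[of x] conv_nn[of x] \<delta>0 by simp
    show "F x = 0" if "x \<le> 0" for x
      using that U_0 cU by (simp add: F_def causal_def)
    show "F \<in> borel_measurable borel" unfolding F_def by measurable
  qed
  show ?thesis
  proof (cases "x \<ge> 0")
    case True
    then show ?thesis using F_eq[OF True] \<delta>0 by (simp add: F_def field_simps)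
  next
    case False
    then show ?thesis using U_0[of x] cU by (simp add: causal_def)
  qed
qed

end

theorem theorem3:
  fixes M :: "'a measure" and X :: "real \<Rightarrow> 'a \<Rightarrow> real"
    and \<delta> q :: real and \<Lambda> \<Lambda>\<^sub>1 \<Lambda>\<^sub>2 :: "real measure"
  assumes "subordinator M X \<delta> \<Lambda>"
    and "\<delta> > 0"
    and "blumenthal_getoor \<Lambda> < 1"
    and "q \<ge> 0"
    and "levy_measure \<Lambda>\<^sub>1" and "levy_measure \<Lambda>\<^sub>2"
    and "\<And>x. x > 0 \<Longrightarrow> tail \<Lambda> x = tail \<Lambda>\<^sub>1 x + tail \<Lambda>\<^sub>2 x"
    and "purely_atomic \<Lambda>\<^sub>1"
    and "\<And>x. x \<noteq> 0 \<Longrightarrow> \<not> x islimpt atoms \<Lambda>\<^sub>1"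
    and "\<And>x. x > 0 \<Longrightarrow> infinitely_differentiable_at (tail \<Lambda>\<^sub>2) x"
  shows "(\<forall>k\<ge>1. \<forall>x>0.
            times_differentiable_at (k + 1) (potential_cdf M X q) x \<longleftrightarrow> x \<notin> atom_sums \<Lambda> k) \<and>
         (\<forall>x>0. x \<notin> (\<Union>k\<in>{1..}. atom_sums \<Lambda> k) \<longrightarrow>
            infinitely_differentiable_at (potential_cdf M X q) x)"
proof -
  interpret S: subord M X \<delta> q \<Lambda> by (rule subord.intro) fact+
  interpret split_levy \<Lambda> \<Lambda>\<^sub>1 \<Lambda>\<^sub>2 q \<delta>
    by (intro split_levy.intro split_levy_axioms.intro levy_kernel.intro S.levy) fact+
  have "potential_cdf M X q x = 1 / \<delta> * trunc_power 1 0 x - conv S.\<kappa> (potential_cdf M X q) x" for x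
    using S.renewal_equation[of x] by (simp add: trunc_power_def)
  then show ?thesis
    by (rule renewal_solution_differentiability[OF assms(3) S.causal_U])
qed

end
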